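(* The physical correlation function of a 2D Gaussian fermion isometric tensor network state (translationally invariant, brick-wall structure) decays exponentially along the spatial direction: with $G_P(x)=\int_{-\pi}^{\pi}\frac{dk}{2\pi}\,e^{ikx}\,\big(A_{P,k}+B_{P,k}\,\Gamma^{(\mathrm s)}_{k,d}\,B_{P,k}^\dagger\big)$, $x\in\mathbb{Z}$, the bulk correlation matrix between physical modes in unit cells of the same row at separation $x$, there exist constants $C,\xi>0$ such that $\lVert G_P(x)\rVert\le Ce^{-|x|/\xi}$ for all $x\in\mathbb{Z}$.
   Context: **Setting.** A 2D Gaussian fermion isometric tensor network state (isoTNS) is the state of the environment generated by purifying a 1D brick-wall Gaussian fermion channel circuit; the spatial direction $x$ of the isoTNS is the direction along the 1D chain, and the vertical direction $y$ is time. Each site of the chain ("virtual" system) hosts $n$ Majorana modes; a unit cell consists of two sites ($2n$ modes). Each two-site gate is a local Gaussian isometry from the virtual modes of two sites to the virtual modes of these two sites together with finitely many new physical modes. A Gaussian isometry acts on correlation matrices by $$\Gamma_V\mapsto\begin{pmatrix}\mathsf A_P&\mathsf A_{PV}\\ -\mathsf A_{PV}^T&\mathsf A\end{pmatrix}+\begin{pmatrix}\mathsf B_P\\ \mathsf B\end{pmatrix}\Gamma_V\begin{pmatrix}\mathsf B_P^T&\mathsf B^T\end{pmatrix},\qquad \Lambda^T\Lambda=I,\quad \Lambda=\begin{pmatrix}\mathsf A_P&\mathsf A_{PV}&\mathsf B_P\\ -\mathsf A_{PV}^T&\mathsf A&\mathsf B\\ -\mathsf B_P^T&-\mathsf B^T&0\end{pmatrix},$$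 with real blocks and $\mathsf A_P,\mathsf A$ antisymmetric. In odd time steps the same two-site isometry acts on the two sites of every unit cell; in even steps the same two-site isometry (possibly different from the odd one) acts on every pair formed by the second site of a cell and the first site of the next one. A "row" below means one period (two time steps). **Momentum space.** By translation invariance, one period acts at momentum $k$ as an isometric Gaussian map with blocks $A_{P,k},A_{PV,k},A_k,B_{P,k},B_k$ (trigonometric polynomials in $k$), i.e. $\Gamma_k\mapsto\begin{pmatrix}A_{P,k}&A_{PV,k}\\ -A_{PV,k}^\dagger&A_k\end{pmatrix}+\begin{pmatrix}B_{P,k}\\ B_k\end{pmatrix}\Gamma_k\begin{pmatrix}B_{P,k}^\dagger&B_k^\dagger\end{pmatrix}$, with $B_{P,k}^\dagger B_{P,k}+B_k^\dagger B_k=I$ and $A_k^\dagger A_k+B_kB_k^\dagger\le I$ for real $k$; $P$ refers to the physical modes of a unit cell produced in this period. **Steady state and bulk correlations.** $V_{k,u}\subset\mathbb{C}^{2n}$ is the span of eigenvectors of $B_k$ with eigenvalues of modulus $1$, $V_{k,d}=V_{k,u}^\perp$ (invariant under $A_k$, $B_k$), with orthogonal projector $P_{k,d}$; the restriction of $B_k$ to $V_{k,d}$ has spectral radius less than $1$. $\Gamma^{(\mathrm s)}_{k,d}$ is the unique operator on $V_{k,d}$ (extended by $0$ on $V_{k,u}$) with $\Gamma^{(\mathrm s)}_{k,d}=P_{k,d}A_k+P_{k,d}B_k\Gamma^{(\mathrm s)}_{k,d}B_k^\dagger P_{k,d}$. Since $B_{P,k}$ vanishes on $V_{k,u}$, deep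 in the bulk (far from the bottom boundary, in the thermodynamic limit) the momentum-space correlation matrix of the physical modes in one row is $A_{P,k}+B_{P,k}\Gamma^{(\mathrm s)}_{k,d}B_{P,k}^\dagger$, independently of the boundary condition. *)

theory Defs
  imports
    "HOL-Analysis.Henstock_Kurzweil_Integration"
    "Jordan_Normal_Form.Schur_Decomposition"
begin

no_notation Finite_Cartesian_Product.vec_nth (infixl "$" 90)
hide_const (open) Finite_Cartesian_Product.vec

text \<open>
  Index dimensions are natural numbers, so that a layer is allowed to produce no physical mode.
  \<open>n\<close> is the number of Majorana modes of a site; a unit cell has \<open>2 * n\<close> virtual modes, those of
  its first site coming first.
\<close>

section \<open>Gaussian isometries\<close>

record 'a gaussian_map =
  blk_AP :: "'a mat"
  blk_APV :: "'a mat"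
  blk_A :: "'a mat"
  blk_BP :: "'a mat"
  blk_B :: "'a mat"

definition lambda_mat :: "real gaussian_map \<Rightarrow> real mat" where
  "lambda_mat g =
     four_block_mat
       (four_block_mat (blk_AP g) (blk_APV g) (- transpose_mat (blk_APV g)) (blk_A g))
       (blk_BP g @\<^sub>r blk_B g)
       (- transpose_mat (blk_BP g @\<^sub>r blk_B g))
       (0\<^sub>m (dim_col (blk_B g)) (dim_col (blk_B g)))"

text \<open>\<open>gaussian_isometry p m g\<close>: from \<open>m\<close> virtual modes to \<open>p\<close> physical and \<open>m\<close> virtual modes.\<close>

definition gaussian_isometry :: "nat \<Rightarrow> nat \<Rightarrow> real gaussian_map \<Rightarrow> bool" where
  "gaussian_isometry p m g \<longleftrightarrow>
     blk_AP g \<in> carrier_mat p p \<and> blk_APV g \<in> carrier_mat p m \<and> blk_A g \<in> carrier_mat m m \<and>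
     blk_BP g \<in> carrier_mat p m \<and> blk_B g \<in> carrier_mat m m \<and>
     transpose_mat (blk_AP g) = - blk_AP g \<and> transpose_mat (blk_A g) = - blk_A g \<and>
     transpose_mat (lambda_mat g) * lambda_mat g = 1\<^sub>m (p + m + m)"

section \<open>One period of the brick-wall circuit at momentum \<open>k\<close>\<close>

text \<open>
  Fourier convention: \<open>f\<^sub>k = (\<Sum>j. exp (- \<i> k j) f\<^sub>j)\<close> for a mode \<open>f\<^sub>j\<close> of cell \<open>j\<close>. The odd layer acts
  within each cell, so its blocks do not depend on \<open>k\<close>.
\<close>

definition odd_layer :: "real gaussian_map \<Rightarrow> complex gaussian_map" where
  "odd_layer g =
     \<lparr>blk_AP = map_mat complex_of_real (blk_AP g),
      blk_APV = map_mat complex_of_real (blk_APV g),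
      blk_A = map_mat complex_of_real (blk_A g),
      blk_BP = map_mat complex_of_real (blk_BP g),
      blk_B = map_mat complex_of_real (blk_B g)\<rparr>"

text \<open>
  The \<open>j\<close>-th gate of the even layer acts on the second site of cell \<open>j\<close> (left leg) and the first
  site of cell \<open>j + 1\<close> (right leg). On Fourier components the legs are \<open>(f\<^sub>k\<^sub>,\<^sub>2, exp (\<i> k) f\<^sub>k\<^sub>,\<^sub>1)\<close>;
  the unitary \<open>bond_mat n k\<close> maps the cell components \<open>(f\<^sub>k\<^sub>,\<^sub>1, f\<^sub>k\<^sub>,\<^sub>2)\<close> to these. The physical modes
  of the \<open>j\<close>-th gate are counted to cell \<open>j\<close>.
\<close>

definition bond_mat :: "nat \<Rightarrow> real \<Rightarrow> complex mat" where
  "bond_mat n k = four_block_mat (0\<^sub>m n n) (1\<^sub>m n) (cis k \<cdot>\<^sub>m 1\<^sub>m n) (0\<^sub>m n n)"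

definition even_layer :: "nat \<Rightarrow> real gaussian_map \<Rightarrow> real \<Rightarrow> complex gaussian_map" where
  "even_layer n g k =
     (let S = bond_mat n k in
     \<lparr>blk_AP = map_mat complex_of_real (blk_AP g),
      blk_APV = map_mat complex_of_real (blk_APV g) * S,
      blk_A = mat_adjoint S * map_mat complex_of_real (blk_A g) * S,
      blk_BP = map_mat complex_of_real (blk_BP g) * S,
      blk_B = mat_adjoint S * map_mat complex_of_real (blk_B g) * S\<rparr>)"

text \<open>
  First \<open>g\<close>, then \<open>h\<close> on the virtual modes left by \<open>g\<close>; the physical modes of \<open>g\<close> precede those of
  \<open>h\<close>. The blocks are read off by inserting the output of \<open>g\<close>, whose physical modes are not touched
  any more, into the action of \<open>h\<close>.
\<close>

definition gaussian_comp ::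
  "complex gaussian_map \<Rightarrow> complex gaussian_map \<Rightarrow> complex gaussian_map" where
  "gaussian_comp h g =
     \<lparr>blk_AP = four_block_mat
        (blk_AP g) (blk_APV g * mat_adjoint (blk_BP h))
        (- mat_adjoint (blk_APV g * mat_adjoint (blk_BP h)))
        (blk_AP h + blk_BP h * blk_A g * mat_adjoint (blk_BP h)),
      blk_APV = (blk_APV g * mat_adjoint (blk_B h)) @\<^sub>r
        (blk_APV h + blk_BP h * blk_A g * mat_adjoint (blk_B h)),
      blk_A = blk_A h + blk_B h * blk_A g * mat_adjoint (blk_B h),
      blk_BP = blk_BP g @\<^sub>r (blk_BP h * blk_B g),
      blk_B = blk_B h * blk_B g\<rparr>"

definition period ::
  "nat \<Rightarrow> real gaussian_map \<Rightarrow> real gaussian_map \<Rightarrow> real \<Rightarrow> complex gaussian_map" where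
  "period n g_odd g_even k = gaussian_comp (even_layer n g_even k) (odd_layer g_odd)"

section \<open>Steady state\<close>

definition undamped_space :: "nat \<Rightarrow> complex mat \<Rightarrow> complex vec set" where
  "undamped_space m B =
     LinearCombinations.module.span class_ring (module_vec TYPE(complex) m)
       {v. \<exists>c. cmod c = 1 \<and> eigenvector B v c}"

definition orthogonal_compl :: "nat \<Rightarrow> complex vec set \<Rightarrow> complex vec set" where
  "orthogonal_compl m W = {v \<in> carrier_vec m. \<forall>w\<in>W. v \<bullet>c w = 0}"

definition damped_space :: "nat \<Rightarrow> complex mat \<Rightarrow> complex vec set" where
  "damped_space m B = orthogonal_compl m (undamped_space m B)"

definition orthogonal_projector :: "nat \<Rightarrow> complex vec set \<Rightarrow> complex mat" where
  "orthogonal_projector m W =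
     (THE P. P \<in> carrier_mat m m \<and>
        (\<forall>v\<in>carrier_vec m. P *\<^sub>v v \<in> W \<and> v - P *\<^sub>v v \<in> orthogonal_compl m W))"

text \<open>
  The two conditions before the fixed-point equation say that \<open>X\<close> is an operator on the damped
  space, extended by 0 on the undamped one.
\<close>

definition steady_state :: "nat \<Rightarrow> complex mat \<Rightarrow> complex mat \<Rightarrow> complex mat" where
  "steady_state m A B =
     (let P = orthogonal_projector m (damped_space m B) in
      THE X. X \<in> carrier_mat m m \<and>
        (\<forall>v\<in>damped_space m B. X *\<^sub>v v \<in> damped_space m B) \<and>
        (\<forall>v\<in>undamped_space m B. X *\<^sub>v v = 0\<^sub>v m) \<and>
        X = P * A + P * B * X * mat_adjoint B * P)"

section \<open>Physical correlations\<close>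

definition bulk_correlation_momentum ::
  "nat \<Rightarrow> real gaussian_map \<Rightarrow> real gaussian_map \<Rightarrow> real \<Rightarrow> complex mat" where
  "bulk_correlation_momentum n g_odd g_even k =
     (let g = period n g_odd g_even k in
      blk_AP g + blk_BP g * steady_state (2 * n) (blk_A g) (blk_B g) * mat_adjoint (blk_BP g))"

text \<open>\<open>p\<close> and \<open>q\<close> are the numbers of physical modes per gate of the odd and the even layer.\<close>

definition bulk_correlation ::
  "nat \<Rightarrow> nat \<Rightarrow> nat \<Rightarrow> real gaussian_map \<Rightarrow> real gaussian_map \<Rightarrow> int \<Rightarrow> complex mat" where
  "bulk_correlation n p q g_odd g_even x =
     mat (p + q) (p + q) (\<lambda>(i, j). integral {-pi..pi} (\<lambda>k.
       1 / (2 * complex_of_real pi) * cis (k * real_of_int x) *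
       bulk_correlation_momentum n g_odd g_even k $$ (i, j)))"

definition l2_norm_vec :: "complex vec \<Rightarrow> real" where
  "l2_norm_vec v = sqrt (\<Sum>i<dim_vec v. (cmod (v $ i))\<^sup>2)"

definition operator_norm :: "complex mat \<Rightarrow> real" where
  "operator_norm M = (SUP v\<in>{v \<in> carrier_vec (dim_col M). l2_norm_vec v \<le> 1}. l2_norm_vec (M *\<^sub>v v))"

end

theory Submission
  imports Defs "HOL-Complex_Analysis.Meromorphic" "Jordan_Normal_Form.Spectral_Radius"
begin

no_notation Formal_Power_Series.fps.fps_nth (infixl "$" 75)
no_notation Finite_Cartesian_Product.vec_nth (infixl "$" 90)
no_notation Inner_Product.real_inner_class.inner (infix "\<bullet>" 70)
hide_const (open) Finite_Cartesian_Product.vec Determinants.det Polynomial.order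

text \<open>
  Let \<open>C\<^sub>j = B\<^sub>P B\<^sup>j\<close> at momentum \<open>k\<close>. Since \<open>B\<^sub>P\<close> vanishes on the undamped space, the projector drops
  out of the steady-state term: it is the sum of the series \<open>C\<^sub>j A C\<^sub>j\<^sup>\<dagger>\<close>, and the isometry condition,
  in the form \<open>(\<Sum>j. C\<^sub>j\<^sup>\<dagger> C\<^sub>j) \<le> 1\<close>, bounds it uniformly in \<open>k\<close>. By Cayley--Hamilton, each entry of
  the series obeys a monic linear recurrence whose coefficients are Laurent polynomials in
  \<open>z = exp (\<i> k)\<close>. If the coefficients sum to 0 for all \<open>z\<close>, the factor \<open>x - 1\<close> can be removed from the
  recurrence, because the terms of the series tend to 0; after finitely many steps, summing the
  recurrence presents the series as a quotient of functions holomorphic on the punctured plane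
  whose denominator is not identically 0. A quotient that is bounded on the unit circle has no
  poles there, even at those \<open>k\<close> where the dimension of the undamped space jumps. Hence the
  correlation matrix extends holomorphically to an annulus around the circle (up to finitely many
  values of \<open>k\<close>, which the integral does not see), and shifting the contour yields exponential decay.
\<close>

section \<open>Fourier coefficients of bounded quotients\<close>

text \<open>The obstacle is the behaviour near exceptional momenta. Where an eigenvalue of
  \<open>B\<close> reaches modulus 1 at an isolated \<open>k\<close>, the projector onto the damped
  space jumps, and close to that \<open>k\<close> the spectral radius of \<open>B\<close> on the
  damped space comes arbitrarily close to 1, so no estimate through a spectral gap is uniform in
  \<open>k\<close>. Nor is the steady state simply a resolvent: if \<open>B\<close> has an
  eigenvalue \<open>c\<close> of modulus 1 at every \<open>k\<close>, the map
  \<open>X \<mapsto> B X B\<^sup>\<dagger>\<close> has the eigenvalue \<open>c * cnj c = 1\<close>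
  at every \<open>k\<close>, and Cramer's rule yields 0 / 0. The coefficient sum of its
  characteristic polynomial is exactly the vanishing determinant, which is why a factor
  \<open>x - 1\<close> may have to be removed. The uniform bound bypasses the gap: along an orbit of
  \<open>B\<close>, the squared norm lost in each step is the squared norm emitted into the physical
  modes, and the total emission cannot exceed the initial squared norm. The isometry condition also
  makes every undamped eigenvector an eigenvector of the adjoint of \<open>B\<close> and a null
  vector of \<open>A\<close>, so the undamped space splits off orthogonally.\<close>

definition circle_holomorphic :: "(real \<Rightarrow> complex) \<Rightarrow> bool" where
  "circle_holomorphic \<phi> \<longleftrightarrow> (\<exists>f. f holomorphic_on -{0} \<and> (\<forall>k. \<phi> k = f (cis k)))"

lemma circle_holomorphic_const [intro, simp]: "circle_holomorphic (\<lambda>_. c)"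
  unfolding circle_holomorphic_def by (intro exI[of _ "\<lambda>_. c"]) auto

lemma circle_holomorphic_cis [intro, simp]: "circle_holomorphic cis"
  unfolding circle_holomorphic_def by (intro exI[of _ "\<lambda>z. z"]) (auto intro!: holomorphic_intros)

lemma circle_holomorphic_add [intro]:
  assumes "circle_holomorphic \<phi>" "circle_holomorphic \<psi>"
  shows "circle_holomorphic (\<lambda>k. \<phi> k + \<psi> k)"
proof -
  obtain f g where "f holomorphic_on -{0}" "\<And>k. \<phi> k = f (cis k)"
    "g holomorphic_on -{0}" "\<And>k. \<psi> k = g (cis k)"
    using assms unfolding circle_holomorphic_def by blast
  then show ?thesis
    unfolding circle_holomorphic_def
    by (intro exI[of _ "\<lambda>z. f z + g z"]) (auto intro!: holomorphic_intros)
qed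

lemma circle_holomorphic_mult [intro]:
  assumes "circle_holomorphic \<phi>" "circle_holomorphic \<psi>"
  shows "circle_holomorphic (\<lambda>k. \<phi> k * \<psi> k)"
proof -
  obtain f g where "f holomorphic_on -{0}" "\<And>k. \<phi> k = f (cis k)"
    "g holomorphic_on -{0}" "\<And>k. \<psi> k = g (cis k)"
    using assms unfolding circle_holomorphic_def by blast
  then show ?thesis
    unfolding circle_holomorphic_def
    by (intro exI[of _ "\<lambda>z. f z * g z"]) (auto intro!: holomorphic_intros)
qed

text \<open>On the unit circle \<open>cnj z = 1 / z\<close>, so conjugating the values of
  \<open>f\<close> amounts to reflection in the circle:
  \<open>z \<mapsto> cnj (f (1 / cnj z))\<close> is holomorphic off 0 and agrees with
  \<open>cnj \<circ> f\<close> on the circle. The reflection exchanges 0 and infinity, which is why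
  the domain is punctured at 0; adjoint matrices enter through this closure property.\<close>

lemma circle_holomorphic_cnj [intro]:
  assumes "circle_holomorphic \<phi>"
  shows "circle_holomorphic (\<lambda>k. cnj (\<phi> k))"
proof -
  obtain f where f: "f holomorphic_on -{0}" and \<phi>: "\<And>k. \<phi> k = f (cis k)"
    using assms unfolding circle_holomorphic_def by blast
  have "(f \<circ> inverse) holomorphic_on -{0}"
    by (rule holomorphic_on_compose_gen[OF _ f]) (auto intro!: holomorphic_intros)
  moreover have "z \<in> cnj ` (-{0})" if "z \<noteq> 0" for z
    using that by (intro image_eqI[of _ _ "cnj z"]) auto
  then have "cnj ` (-{0}) = -{0}" by auto
  ultimately have "(cnj \<circ> (f \<circ> inverse) \<circ> cnj) holomorphic_on -{0}"
    by (intro holomorphic_on_compose_cnj_cnj) auto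
  then show ?thesis
    unfolding circle_holomorphic_def
    by (intro exI[of _ "cnj \<circ> (f \<circ> inverse) \<circ> cnj"]) (auto simp: \<phi> cis_cnj)
qed

lemma circle_holomorphic_uminus [intro]:
  "circle_holomorphic \<phi> \<Longrightarrow> circle_holomorphic (\<lambda>k. - \<phi> k)"
  using circle_holomorphic_mult[OF circle_holomorphic_const[of "-1"]] by fastforce

lemma circle_holomorphic_sum [intro]:
  "(\<And>i. i \<in> I \<Longrightarrow> circle_holomorphic (\<phi> i)) \<Longrightarrow> circle_holomorphic (\<lambda>k. \<Sum>i\<in>I. \<phi> i k)"
  by (induction I rule: infinite_finite_induct) auto

lemma bounded_on_circle:
  assumes "circle_holomorphic \<phi>"
  obtains M where "\<And>k. cmod (\<phi> k) \<le> M"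
proof -
  obtain f where f: "f holomorphic_on -{0}" and \<phi>: "\<And>k. \<phi> k = f (cis k)"
    using assms unfolding circle_holomorphic_def by blast
  have "continuous_on (sphere 0 1) f"
    by (rule continuous_on_subset[OF holomorphic_on_imp_continuous_on[OF f]]) auto
  then have "bounded (f ` sphere 0 1)"
    by (intro compact_imp_bounded compact_continuous_image) auto
  then obtain M where "\<forall>z\<in>sphere 0 1. cmod (f z) \<le> M"
    unfolding bounded_iff by auto
  then show ?thesis by (intro that[of M]) (auto simp: \<phi>)
qed

text \<open>The zeros of the denominator on the circle are finite in number by the identity theorem.
  Near each of them the quotient is meromorphic, and a pole would make it unbounded along the
  circle. \<open>Z\<close> is the set of these zeros: there the equation says nothing about
  \<open>T\<close>, so agreement can be claimed only off \<open>Z\<close>.\<close>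

lemma bounded_quotient_extends_analytically:
  assumes "circle_holomorphic \<gamma>" "circle_holomorphic \<eta>"
    and quot: "\<And>k. T k * \<eta> k = \<gamma> k" and bound: "\<And>k. cmod (T k) \<le> M" and nz: "\<eta> k\<^sub>0 \<noteq> 0"
  obtains f Z where "f analytic_on sphere 0 1" "finite Z" "\<And>k. cis k \<notin> Z \<Longrightarrow> T k = f (cis k)"
proof -
  obtain g h where g: "g holomorphic_on -{0}" "\<And>k. \<gamma> k = g (cis k)"
    and h: "h holomorphic_on -{0}" "\<And>k. \<eta> k = h (cis k)"
    using assms unfolding circle_holomorphic_def by blast
  define f\<^sub>0 where "f\<^sub>0 = (\<lambda>z. g z / h z)"
  have an: "g analytic_on {w}" "h analytic_on {w}" if "w \<noteq> 0" for w
    using that g(1) h(1) by (auto simp: analytic_at intro!: exI[of _ "-{0}"])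
  \<comment> \<open>Division by 0 gives 0, so the bound holds at the zeros of \<open>h\<close> as
    well.\<close>
  have small: "cmod (f\<^sub>0 z) \<le> M" if "z \<in> sphere 0 1" for z
  proof -
    have M: "0 \<le> M" using bound[of 0] norm_ge_zero order_trans by blast
    have "z = cis (Arg z)" using that rcis_cmod_Arg[of z] by (simp add: rcis_def)
    then obtain k where k: "z = cis k" by blast
    show ?thesis
    proof (cases "h z = 0")
      case False
      then have "f\<^sub>0 z = T k"
        using quot[of k] unfolding f\<^sub>0_def k g h by (simp add: field_simps)
      then show ?thesis using bound by simp
    qed (use M in \<open>simp add: f\<^sub>0_def\<close>)
  qed
  define Z where "Z = {z \<in> sphere 0 1. h z = 0}"
  have "finite Z"
  proof (cases "h constant_on -{0}")
    case True
    then obtain c where c: "\<And>z. z \<noteq> 0 \<Longrightarrow> h z = c" unfolding constant_on_def by auto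
    with nz h(2) have "c \<noteq> 0" by (metis cis_neq_zero)
    then have "Z = {}" unfolding Z_def using c by (auto, metis norm_zero zero_neq_one)
    then show ?thesis by simp
  next
    case False
    show ?thesis unfolding Z_def
    proof (rule holomorphic_compact_finite_zeros[OF h(1) _ _ _ _ False])
      show "connected (- {0 :: complex})" by (rule connected_punctured_universe) simp
    qed auto
  qed
  moreover have "remove_sings f\<^sub>0 analytic_on sphere 0 1"
  proof (subst analytic_on_analytic_at, intro ballI)
    fix w :: complex assume w: "w \<in> sphere 0 1"
    then have "w \<noteq> 0" by auto
    then have iso: "isolated_singularity_at f\<^sub>0 w" and ne: "not_essential f\<^sub>0 w"
      unfolding f\<^sub>0_def using an[of w]
      by (simp_all add: not_essential_divide isolated_singularity_at_divide
          not_essential_analytic isolated_singularity_at_analytic)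
    have "\<not> is_pole f\<^sub>0 w"
    proof
      assume "is_pole f\<^sub>0 w"
      then have "eventually (\<lambda>z. M + 1 \<le> cmod (f\<^sub>0 z)) (at w)"
        unfolding is_pole_def filterlim_at_infinity[OF order_refl]
        by (metis add_nonneg_pos bound less_numeral_extra(1) norm_ge_zero order_trans)
      then obtain d where d: "d > 0" "\<And>z. z \<noteq> w \<Longrightarrow> dist z w < d \<Longrightarrow> M + 1 \<le> cmod (f\<^sub>0 z)"
        unfolding eventually_at by auto
      \<comment> \<open>A pole makes the quotient large in a punctured disc around \<open>w\<close>;
        the contradiction needs a point of the circle in that disc.\<close>
      have "w islimpt sphere 0 1"
      proof (rule connected_imp_perfect[OF connected_sphere w])
        fix a :: complex
        have "1 \<in> sphere (0 :: complex) 1" "-1 \<in> sphere (0 :: complex) 1" by auto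
        then show "sphere 0 1 \<noteq> {a}" by force
      qed simp
      then obtain z where "z \<in> sphere 0 1" "z \<noteq> w" "dist z w < d"
        using d(1) unfolding islimpt_approachable by blast
      then show False using d(2)[of z] small[of z] by simp
    qed
    then obtain c where "f\<^sub>0 \<midarrow>w\<rightarrow> c" using ne unfolding not_essential_def by auto
    then show "remove_sings f\<^sub>0 analytic_on {w}" by (rule remove_sings_analytic_at[OF iso])
  qed
  moreover have "T k = remove_sings f\<^sub>0 (cis k)" if "cis k \<notin> Z" for k
  proof -
    have hz: "h (cis k) \<noteq> 0" using that by (auto simp: Z_def)
    then have "f\<^sub>0 analytic_on {cis k}"
      unfolding f\<^sub>0_def using an[of "cis k"] by (intro analytic_on_divide) auto
    then show ?thesis
      using hz quot[of k] by (simp add: f\<^sub>0_def g h field_simps)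
  qed
  ultimately show ?thesis using that by blast
qed

text \<open>On the circle of radius \<open>r\<close> the factor \<open>z powi x\<close> has modulus
  \<open>r powi x\<close>, so the contour is moved inwards for positive \<open>x\<close> and
  outwards for negative \<open>x\<close>.\<close>

lemma fourier_coefficients_decay:
  assumes "f analytic_on sphere 0 1"
  obtains C \<delta> where "C > 0" "\<delta> > 0"
    "\<And>x::int. cmod (integral {-pi..pi} (\<lambda>k. cis (k * real_of_int x) * f (cis k)))
       \<le> C * exp (- \<delta> * real_of_int \<bar>x\<bar>)"
proof -
  obtain U where U: "open U" "sphere 0 1 \<subseteq> U" "f holomorphic_on U"
    using assms analytic_on_holomorphic by blast
  obtain e\<^sub>0 where e\<^sub>0: "e\<^sub>0 > 0" "(\<Union>x\<in>sphere 0 1. ball x e\<^sub>0) \<subseteq> U"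
    using compact_subset_open_imp_ball_epsilon_subset[of "sphere 0 1" U] U by auto
  \<comment> \<open>The cap at 1 keeps 0 outside the annulus \<open>S\<close>, where
    \<open>F\<close> contains negative powers of \<open>z\<close>, and keeps
    \<open>1 - e / 2\<close> positive for the logarithm below.\<close>
  define e where "e = min e\<^sub>0 1"
  define S where "S = (\<lambda>z::complex. cmod z) -` {1 - e <..< 1 + e}"
  have e: "e > 0" "e \<le> e\<^sub>0" "e \<le> 1" using e\<^sub>0(1) by (auto simp: e_def)
  have S_open: "open S"
    unfolding S_def by (intro open_vimage continuous_intros)
  have S0: "0 \<notin> S" using e by (auto simp: S_def)
  have SU: "S \<subseteq> U"
  proof
    fix z :: complex assume z: "z \<in> S"
    with S0 have "z \<noteq> 0" by auto
    \<comment> \<open>\<open>sgn z\<close> is the radial projection of \<open>z\<close> to the unit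
      circle.\<close>
    have "dist (sgn z) z = \<bar>cmod z - 1\<bar>"
    proof -
      have "z = complex_of_real (cmod z) * sgn z"
        using \<open>z \<noteq> 0\<close> by (simp add: sgn_div_norm scaleR_conv_of_real)
      then have "sgn z - z = complex_of_real (1 - cmod z) * sgn z"
        by (metis left_diff_distrib mult_1 of_real_1 of_real_diff)
      then show ?thesis using \<open>z \<noteq> 0\<close>
        by (simp only: dist_norm norm_mult norm_of_real norm_sgn) (auto simp: abs_minus_commute)
    qed
    also have "\<dots> < e\<^sub>0" using z e unfolding S_def by auto
    finally have "z \<in> ball (sgn z) e\<^sub>0" by simp
    moreover have "sgn z \<in> sphere 0 1" using \<open>z \<noteq> 0\<close> by (simp add: norm_sgn)
    ultimately show "z \<in> U" using e\<^sub>0(2) by blast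
  qed
  define K where "K = cball 0 (1 + e / 2) - ball (0 :: complex) (1 - e / 2)"
  have "K \<subseteq> S" using e by (auto simp: K_def S_def)
  then have "continuous_on K f"
    using SU U(3) holomorphic_on_imp_continuous_on continuous_on_subset by blast
  moreover have "compact K" unfolding K_def by (intro compact_diff) auto
  ultimately have "bounded (f ` K)"
    by (intro compact_imp_bounded compact_continuous_image)
  then obtain B where B: "B > 0" "\<And>z. z \<in> K \<Longrightarrow> cmod (f z) \<le> B"
    unfolding bounded_pos by auto
  have shift: "cmod (integral {-pi..pi} (\<lambda>k. cis (k * real_of_int x) * f (cis k))) \<le> B * (2 * pi) * r powi x"
    if r: "\<bar>r - 1\<bar> = e / 2" for r :: real and x :: int
  proof -
    define F where "F = (\<lambda>z. z powi (x - 1) * f z)"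
    have r0: "r > 0" using r e by (auto simp: abs_if split: if_splits)
    have F: "F holomorphic_on S"
      unfolding F_def using S0 SU U(3)
      by (auto intro!: holomorphic_intros intro: holomorphic_on_subset)
    \<comment> \<open>Both circles are traversed with the same argument at each time, so the linear
      homotopy moves radially and stays inside the annulus.\<close>
    have "homotopic_loops S (part_circlepath 0 1 (-pi) pi) (part_circlepath 0 r (-pi) pi)"
    proof (rule homotopic_loops_linear)
      fix t :: real
      show "closed_segment (part_circlepath 0 1 (-pi) pi t) (part_circlepath 0 r (-pi) pi t) \<subseteq> S"
      proof
        fix z assume "z \<in> closed_segment (part_circlepath 0 1 (-pi) pi t) (part_circlepath 0 r (-pi) pi t)"
        then obtain u where u: "0 \<le> u" "u \<le> 1"
          and z: "z = (1 - u) *\<^sub>R part_circlepath 0 1 (-pi) pi t + u *\<^sub>R part_circlepath 0 r (-pi) pi t"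
          unfolding closed_segment_def by auto
        define s where "s = 1 + u * (r - 1)"
        have "z = complex_of_real s * exp (\<i> * complex_of_real (linepath (-pi) pi t))"
          unfolding z part_circlepath_def s_def by (simp add: algebra_simps scaleR_conv_of_real)
        then have "cmod z = \<bar>s\<bar>" by (simp add: norm_mult)
        moreover have "\<bar>u * (r - 1)\<bar> < e"
        proof -
          have "\<bar>u * (r - 1)\<bar> \<le> 1 * (e / 2)"
            unfolding abs_mult r using u e by (intro mult_mono) auto
          then show ?thesis using e by simp
        qed
        ultimately show "z \<in> S" using e unfolding S_def s_def by auto
      qed
    qed (rule path_part_circlepath, rule path_part_circlepath, auto simp: part_circlepath_def pathfinish_def pathstart_def linepath_def exp_minus
          simp flip: cis_conv_exp)
    then have eq: "contour_integral (part_circlepath 0 1 (-pi) pi) F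
        = contour_integral (part_circlepath 0 r (-pi) pi) F"
      by (rule Cauchy_theorem_homotopic_loops[OF _ S_open F]) auto
    have cis_x: "cis (t * real_of_int x) = cis (t * (real_of_int x - 1)) * cis t" for t
      by (simp add: cis_mult algebra_simps)
    \<comment> \<open>With \<open>z = cis k\<close> one has \<open>dz = \<i> * z dk\<close>; this
      explains the factor \<open>\<i>\<close> and the exponent \<open>x - 1\<close> in
      \<open>F\<close>.\<close>
    have "integral {-pi..pi} (\<lambda>k. cis (k * real_of_int x) * f (cis k)) * \<i>
        = integral {-pi..pi} (\<lambda>k. cis (k * real_of_int x) * f (cis k) * \<i>)"
      by (rule integral_mult_left[symmetric])
    also have "\<dots> = contour_integral (part_circlepath 0 1 (-pi) pi) F"
      by (subst contour_integral_part_circlepath_eq, simp, rule integral_cong)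
        (simp add: F_def cis_power_int cis_x mult_ac)
    finally have "cmod (integral {-pi..pi} (\<lambda>k. cis (k * real_of_int x) * f (cis k)))
        = cmod (contour_integral (part_circlepath 0 r (-pi) pi) F)"
      unfolding eq[symmetric] by (metis mult.right_neutral norm_ii norm_mult)
    also have "\<dots> \<le> (r powi (x - 1) * B) * r * \<bar>pi - (-pi)\<bar>"
    proof (rule contour_integral_bound_part_circlepath)
      show "F contour_integrable_on part_circlepath 0 r (-pi) pi"
      proof (rule contour_integrable_holomorphic_simple[OF F S_open])
        show "path_image (part_circlepath 0 r (-pi) pi) \<subseteq> S"
          using path_image_part_circlepath_subset'[of r 0 "-pi" pi] r r0 e
          by (force simp: S_def abs_if split: if_splits)
      qed auto
      fix z assume "z \<in> path_image (part_circlepath 0 r (-pi) pi)"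
      then have z: "cmod z = r"
        using path_image_part_circlepath_subset'[of r 0 "-pi" pi] r0 by auto
      then have "z \<in> K" using r e by (auto simp: K_def abs_if split: if_splits)
      then show "cmod (F z) \<le> r powi (x - 1) * B"
        unfolding F_def norm_mult norm_power_int z using B r0 by (intro mult_left_mono) auto
    qed (use r0 B in auto)
    also have "\<dots> = B * (2 * pi) * r powi x"
      using r0 by (simp add: power_int_diff)
    finally show ?thesis .
  qed
  \<comment> \<open>The two logarithms are the decay rates obtained from the outer and the inner
    circle; the smaller one serves both signs of \<open>x\<close>.\<close>
  define \<delta> where "\<delta> = min (ln (1 + e / 2)) (- ln (1 - e / 2))"
  show ?thesis
  proof (rule that[of "B * (2 * pi)" \<delta>])
    show "\<delta> > 0" using e by (auto simp: \<delta>_def)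
    fix x :: int
    obtain r where r: "\<bar>r - 1\<bar> = e / 2" "r > 0" "r powi x \<le> exp (- \<delta> * real_of_int \<bar>x\<bar>)"
    proof (cases "x \<ge> 0")
      case True
      have "(1 - e / 2) powi x = exp (ln (1 - e / 2) * real_of_int x)"
        using e by (simp add: powr_real_of_int'[symmetric] powr_def mult.commute)
      also have "\<dots> \<le> exp (- \<delta> * real_of_int \<bar>x\<bar>)"
        using True mult_right_mono[of "ln (1 - e / 2)" "- \<delta>" "real_of_int x"]
        unfolding exp_le_cancel_iff by (simp add: \<delta>_def)
      finally show ?thesis using that[of "1 - e / 2"] e by auto
    next
      case False
      have "(1 + e / 2) powi x = exp (- ln (1 + e / 2) * real_of_int \<bar>x\<bar>)"
        using e False by (simp add: powr_real_of_int'[symmetric] powr_def mult.commute)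
      also have "\<dots> \<le> exp (- \<delta> * real_of_int \<bar>x\<bar>)"
        unfolding exp_le_cancel_iff \<delta>_def by (intro mult_right_mono) auto
      finally show ?thesis using that[of "1 + e / 2"] e by auto
    qed
    show "cmod (integral {-pi..pi} (\<lambda>k. cis (k * real_of_int x) * f (cis k)))
        \<le> B * (2 * pi) * exp (- \<delta> * real_of_int \<bar>x\<bar>)"
      using order_trans[OF shift[OF r(1), of x] mult_left_mono[OF r(3)]] B by auto
  qed (use B in auto)
qed

lemma finite_cis_preimage:
  assumes "finite Z"
  shows "finite {k \<in> {-pi..pi}. cis k \<in> Z}"
proof -
  have "inj_on cis {-pi<..pi}" by (rule inj_onI) (metis cis_Arg_unique greaterThanAtMost_iff sgn_cis)
  then have "finite (cis -` Z \<inter> {-pi<..pi})" by (rule finite_vimage_IntI[OF assms])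
  moreover have "{k \<in> {-pi..pi}. cis k \<in> Z} \<subseteq> insert (-pi) (cis -` Z \<inter> {-pi<..pi})" by auto
  ultimately show ?thesis by (meson finite_insert finite_subset)
qed

text \<open>Shaped after an entry of the correlation matrix: \<open>\<rho>\<close> will be the entry
  of the physical block, holomorphic by itself, and \<open>T\<close> that of the steady-state term,
  known only as a bounded quotient.\<close>

lemma fourier_decay_of_bounded_quotient:
  assumes "circle_holomorphic \<rho>" "circle_holomorphic \<gamma>" "circle_holomorphic \<eta>"
    and "\<And>k. T k * \<eta> k = \<gamma> k" "\<And>k. cmod (T k) \<le> M" "\<eta> k\<^sub>0 \<noteq> 0"
  shows "\<exists>C>0. \<exists>\<delta>>0. \<forall>x::int.
    cmod (integral {-pi..pi} (\<lambda>k. 1 / (2 * complex_of_real pi) * cis (k * real_of_int x) * (\<rho> k + T k)))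
      \<le> C * exp (- \<delta> * real_of_int \<bar>x\<bar>)"
proof -
  obtain f Z where f: "f analytic_on sphere 0 1" "finite Z" "\<And>k. cis k \<notin> Z \<Longrightarrow> T k = f (cis k)"
    using bounded_quotient_extends_analytically[OF assms(2-)] by blast
  obtain r where r: "r holomorphic_on -{0}" "\<And>k. \<rho> k = r (cis k)"
    using assms(1) unfolding circle_holomorphic_def by blast
  have "r analytic_on -{0}" using r(1) by (subst analytic_on_open) auto
  then have "r analytic_on sphere 0 1" by (rule analytic_on_subset) auto
  then have "(\<lambda>z. 1 / (2 * complex_of_real pi) * (r z + f z)) analytic_on sphere 0 1"
    using f(1) by (intro analytic_intros) auto
  then obtain C \<delta> where C: "C > 0" "\<delta> > 0"
    "\<And>x::int. cmod (integral {-pi..pi} (\<lambda>k. cis (k * real_of_int x) *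
        (1 / (2 * complex_of_real pi) * (r (cis k) + f (cis k))))) \<le> C * exp (- \<delta> * real_of_int \<bar>x\<bar>)"
    by (rule fourier_coefficients_decay) blast
  have "integral {-pi..pi} (\<lambda>k. 1 / (2 * complex_of_real pi) * cis (k * real_of_int x) * (\<rho> k + T k))
      = integral {-pi..pi} (\<lambda>k. cis (k * real_of_int x) *
        (1 / (2 * complex_of_real pi) * (r (cis k) + f (cis k))))" for x :: int
  proof (rule integral_spike[OF negligible_finite[OF finite_cis_preimage[OF f(2)]]])
    fix k assume "k \<in> {-pi..pi} - {k \<in> {-pi..pi}. cis k \<in> Z}"
    then have "T k = f (cis k)" using f(3) by auto
    then show "cis (k * real_of_int x) * (1 / (2 * complex_of_real pi) * (r (cis k) + f (cis k)))
      = 1 / (2 * complex_of_real pi) * cis (k * real_of_int x) * (\<rho> k + T k)"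
      by (simp add: r(2))
  qed
  with C show ?thesis by auto
qed

section \<open>Recurrences\<close>

text \<open>Induction on the order of the recurrence, for all \<open>k\<close> at once: a factor
  \<open>x - 1\<close> is removed only if the coefficient sum vanishes at every \<open>k\<close>.
  The leading coefficient stays 1 under this division, so at the latest the process ends at order 0,
  where the recurrence says that \<open>c\<close> vanishes identically and \<open>\<eta> = 1\<close>
  will do.\<close>

lemma summable_recurrence_quotient:
  fixes c a :: "nat \<Rightarrow> real \<Rightarrow> complex"
  assumes c: "\<And>j. circle_holomorphic (c j)" and sm: "\<And>k. summable (\<lambda>j. c j k)"
    and "\<And>i. circle_holomorphic (a i)" "\<And>k. a N k = 1"
    and "\<And>k j. (\<Sum>i\<le>N. a i k * c (j + i) k) = 0"
  shows "\<exists>\<gamma> \<eta> k\<^sub>0. circle_holomorphic \<gamma> \<and> circle_holomorphic \<eta> \<and> \<eta> k\<^sub>0 \<noteq> 0 \<and>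
    (\<forall>k. (\<Sum>j. c j k) * \<eta> k = \<gamma> k)"
  using assms(3-)
proof (induction N arbitrary: a)
  case (0 a)
  then have "c j k = 0" for j k using "0.prems"(3)[of k j] by simp
  then show ?case
    by (intro exI[of _ "\<lambda>_. 0"] exI[of _ "\<lambda>_. 1"]) auto
next
  case (Suc M a)
  note hol = Suc.prems(1) and monic = Suc.prems(2) and rec = Suc.prems(3)
  show ?case
  proof (cases "\<exists>k\<^sub>0. (\<Sum>i\<le>Suc M. a i k\<^sub>0) \<noteq> 0")
    case True
    then obtain k\<^sub>0 where k\<^sub>0: "(\<Sum>i\<le>Suc M. a i k\<^sub>0) \<noteq> 0" by blast
    have hol': "circle_holomorphic (\<lambda>k. \<Sum>i\<le>Suc M. a i k * (\<Sum>l<i. c l k))"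
      "circle_holomorphic (\<lambda>k. \<Sum>i\<le>Suc M. a i k)"
      by (intro circle_holomorphic_sum circle_holomorphic_mult hol c)+
    \<comment> \<open>Summed over all \<open>j\<close>, the sequence shifted by \<open>i\<close>
      contributes the full series without its first \<open>i\<close> terms.\<close>
    have "(\<Sum>j. c j k) * (\<Sum>i\<le>Suc M. a i k) = (\<Sum>i\<le>Suc M. a i k * (\<Sum>l<i. c l k))" for k
    proof -
      have sm': "summable (\<lambda>j. c (j + i) k)" for i
        by (rule summable_ignore_initial_segment[OF sm])
      have "(\<Sum>i\<le>Suc M. a i k * ((\<Sum>j. c j k) - (\<Sum>l<i. c l k))) = (\<Sum>i\<le>Suc M. a i k * (\<Sum>j. c (j + i) k))"
        by (simp add: suminf_minus_initial_segment[OF sm])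
      also have "\<dots> = (\<Sum>j. \<Sum>i\<le>Suc M. a i k * c (j + i) k)"
        using sm' by (subst suminf_sum) (auto intro!: summable_mult simp: suminf_mult)
      also have "\<dots> = 0" by (simp only: rec suminf_zero)
      finally have "(\<Sum>i\<le>Suc M. a i k * (\<Sum>j. c j k)) - (\<Sum>i\<le>Suc M. a i k * (\<Sum>l<i. c l k)) = 0"
        by (simp only: right_diff_distrib sum_subtractf)
      then show ?thesis
        by (simp only: sum_distrib_right[symmetric] mult.commute[of "\<Sum>j. c j k"] right_minus_eq)
    qed
    with k\<^sub>0 hol' show ?thesis
      by (intro exI[of _ "\<lambda>k. \<Sum>i\<le>Suc M. a i k * (\<Sum>l<i. c l k)"]
          exI[of _ "\<lambda>k. \<Sum>i\<le>Suc M. a i k"] exI[of _ k\<^sub>0] conjI allI)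
  next
    case False
    then have sum0: "(\<Sum>i\<le>Suc M. a i k) = 0" for k by blast
    \<comment> \<open>The quotient of the characteristic polynomial by \<open>x - 1\<close> still annihilates the
      sequence: the defect is constant in \<open>j\<close> and tends to 0.\<close>
    define b where "b = (\<lambda>i k. \<Sum>l\<in>{i<..Suc M}. a l k)"
    have b_step: "a (Suc i) k = b i k - b (Suc i) k" if "i \<le> M" for i k
    proof -
      have "{i<..Suc M} = insert (Suc i) {Suc i<..Suc M}" using that by auto
      then show ?thesis by (simp add: b_def)
    qed
    \<comment> \<open>The vanishing coefficient sum enters here: it is the remainder of the division
      by \<open>x - 1\<close>.\<close>
    have b_0: "a 0 k = - b 0 k" for k
    proof -
      have "{..Suc M} = insert 0 {0<..Suc M}" by auto
      then show ?thesis using sum0[of k] by (simp add: b_def add_eq_0_iff)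
    qed
    have b_last: "b (Suc M) k = 0" for k by (simp add: b_def)
    show ?thesis
    proof (rule Suc.IH[of b])
      show "circle_holomorphic (b i)" for i unfolding b_def by (intro circle_holomorphic_sum hol)
      have "{M<..Suc M} = {Suc M}" by auto
      then show "b M k = 1" for k by (simp add: b_def monic)
      fix k
      define e where "e = (\<lambda>j. \<Sum>i\<le>M. b i k * c (j + i) k)"
      have "e (Suc j) = e j" for j
      proof -
        have "0 = a 0 k * c j k + (\<Sum>i\<le>M. a (Suc i) k * c (j + Suc i) k)"
          using rec[where k=k and j=j] by (subst (asm) sum.atMost_Suc_shift) simp
        also have "(\<Sum>i\<le>M. a (Suc i) k * c (j + Suc i) k)
            = e (Suc j) - (\<Sum>i\<le>M. b (Suc i) k * c (j + Suc i) k)"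
          by (simp add: b_step e_def left_diff_distrib sum_subtractf)
        also have "(\<Sum>i\<le>M. b (Suc i) k * c (j + Suc i) k) = (\<Sum>i\<le>Suc M. b i k * c (j + i) k) - b 0 k * c j k"
          by (subst sum.atMost_Suc_shift) simp
        also have "(\<Sum>i\<le>Suc M. b i k * c (j + i) k) = e j"
          by (simp add: e_def b_last)
        finally show ?thesis by (simp add: b_0)
      qed
      then have const: "e j = e 0" for j by (induction j) auto
      have "(\<lambda>j. c j k) \<longlonglongrightarrow> 0" using sm by (rule summable_LIMSEQ_zero)
      then have "(\<lambda>j. c (j + i) k) \<longlonglongrightarrow> 0" for i by (rule LIMSEQ_ignore_initial_segment)
      then have "e \<longlonglongrightarrow> (\<Sum>i\<le>M. b i k * 0)"
        unfolding e_def by (intro tendsto_intros)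
      moreover have "e \<longlonglongrightarrow> e 0" using const by (metis LIMSEQ_const_iff ext)
      ultimately have "e 0 = 0" using LIMSEQ_unique by fastforce
      then show "(\<Sum>i\<le>M. b i k * c (j + i) k) = 0" for j using const[of j] by (simp add: e_def)
    qed
  qed
qed

text \<open>The linear functional on polynomials that sends the \<open>i\<close>-th power of the
  variable to \<open>s i\<close>. Multiplication by the variable becomes a shift of
  \<open>s\<close>, which turns identities between polynomials into recurrences for
  sequences.\<close>

definition poly_action :: "complex poly \<Rightarrow> (nat \<Rightarrow> complex) \<Rightarrow> complex" where
  "poly_action p s = (\<Sum>i\<le>degree p. coeff p i * s i)"

lemma poly_action_altdef: "degree p \<le> n \<Longrightarrow> poly_action p s = (\<Sum>i\<le>n. coeff p i * s i)"
  unfolding poly_action_def by (rule sum.mono_neutral_left) (auto simp: coeff_eq_0)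

lemma poly_action_add: "poly_action (p + q) s = poly_action p s + poly_action q s"
proof -
  define n where "n = max (degree p) (degree q)"
  have "degree p \<le> n" "degree q \<le> n" "degree (p + q) \<le> n"
    by (auto simp: n_def degree_add_le_max)
  then show ?thesis
    by (simp add: poly_action_altdef[of _ n] distrib_right sum.distrib)
qed

lemma poly_action_0 [simp]: "poly_action 0 s = 0"
  by (simp add: poly_action_def)

lemma poly_action_sum: "poly_action (\<Sum>i\<in>I. p i) s = (\<Sum>i\<in>I. poly_action (p i) s)"
  by (induction I rule: infinite_finite_induct) (auto simp: poly_action_add)

text \<open>Linear factors are the relevant case, since the entries of
  \<open>char_poly_matrix\<close> have degree at most 1.\<close>

lemma poly_action_linear_factor:
  "poly_action (p * [:d, e:]) s = poly_action p (\<lambda>i. d * s i + e * s (Suc i))"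
proof -
  define n where "n = degree p"
  have coeff: "coeff (p * [:d, e:]) i = d * coeff p i + (case i of 0 \<Rightarrow> 0 | Suc l \<Rightarrow> e * coeff p l)" for i
    by (cases i) (auto simp: mult_pCons_right)
  have "degree (p * [:d, e:]) \<le> Suc n"
    using degree_mult_le[of p "[:d, e:]"] by (simp add: n_def split: if_splits)
  then have "poly_action (p * [:d, e:]) s = (\<Sum>i\<le>Suc n. coeff (p * [:d, e:]) i * s i)"
    by (rule poly_action_altdef)
  also have "\<dots> = (\<Sum>i\<le>Suc n. d * coeff p i * s i) + (\<Sum>i\<le>Suc n. (case i of 0 \<Rightarrow> 0 | Suc l \<Rightarrow> e * coeff p l) * s i)"
    by (simp only: coeff distrib_right sum.distrib)
  also have "(\<Sum>i\<le>Suc n. d * coeff p i * s i) = (\<Sum>i\<le>n. d * coeff p i * s i)"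
    by (simp add: n_def coeff_eq_0)
  also have "(\<Sum>i\<le>Suc n. (case i of 0 \<Rightarrow> 0 | Suc l \<Rightarrow> e * coeff p l) * s i) = (\<Sum>i\<le>n. e * coeff p i * s (Suc i))"
    by (subst sum.atMost_Suc_shift) simp
  finally show ?thesis
    by (simp add: poly_action_altdef[of p n] n_def algebra_simps sum.distrib)
qed

lemma poly_action_lincomb:
  "(\<Sum>b\<in>I. d b * poly_action p (s b)) = poly_action p (\<lambda>i. \<Sum>b\<in>I. d b * s b i)"
  unfolding poly_action_def sum_distrib_left
  by (subst sum.swap) (auto simp: mult_ac intro!: sum.cong)

text \<open>Cayley--Hamilton: apply the shift to the identity \<open>adj (x - K) * (x - K) = char_poly K\<close>.\<close>

lemma char_poly_recurrence:
  fixes K :: "complex mat" and x :: "nat \<Rightarrow> nat \<Rightarrow> complex"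
  assumes K: "K \<in> carrier_mat N N"
    and x: "\<And>j a. a < N \<Longrightarrow> x (Suc j) a = (\<Sum>b<N. K $$ (a, b) * x j b)" and a: "a < N"
  shows "(\<Sum>i\<le>N. coeff (char_poly K) i * x (j + i) a) = 0"
proof -
  define P where "P = char_poly_matrix K"
  define Q where "Q = adj_mat P"
  define s where "s = (\<lambda>b i. x (j + i) b)"
  have P: "P \<in> carrier_mat N N" using K by (simp add: P_def)
  note Q = adj_mat[OF P, folded Q_def]
  have P_entry: "P $$ (l, b) = [:- K $$ (l, b), if l = b then 1 else 0:]" if "l < N" "b < N" for l b
    using K that by (simp add: P_def char_poly_matrix_def)
  have entry: "(\<Sum>l<N. Q $$ (a, l) * P $$ (l, b)) = (if a = b then char_poly K else 0)" if b: "b < N" for b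
  proof -
    have "(Q * P) $$ (a, b) = (if a = b then char_poly K else 0)"
      unfolding Q(3) using a b by (simp add: char_poly_def P_def)
    then show ?thesis
      using Q(1) P a b by (simp add: scalar_prod_def lessThan_atLeast0)
  qed
  have "(\<Sum>i\<le>N. coeff (char_poly K) i * x (j + i) a) = poly_action (char_poly K) (s a)"
    using degree_monic_char_poly[OF K] by (simp add: poly_action_def s_def)
  also have "\<dots> = (\<Sum>b<N. poly_action (if a = b then char_poly K else 0) (s b))"
    using a by (subst sum.mono_neutral_right[of "{..<N}" "{a}"]) auto
  also have "\<dots> = (\<Sum>b<N. \<Sum>l<N. poly_action (Q $$ (a, l) * P $$ (l, b)) (s b))"
    by (intro sum.cong refl) (simp only: entry lessThan_iff flip: poly_action_sum)
  also have "\<dots> = (\<Sum>l<N. \<Sum>b<N. poly_action (Q $$ (a, l) * P $$ (l, b)) (s b))"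
    by (rule sum.swap)
  also have "\<dots> = (\<Sum>l<N. 0)"
  proof (intro sum.cong refl)
    fix l assume "l \<in> {..<N}"
    then have l: "l < N" by simp
    have "(\<Sum>b<N. poly_action (Q $$ (a, l) * P $$ (l, b)) (s b))
        = (\<Sum>b<N. 1 * poly_action (Q $$ (a, l)) (\<lambda>i. - K $$ (l, b) * s b i + (if l = b then 1 else 0) * s b (Suc i)))"
      by (intro sum.cong refl) (simp only: P_entry[OF l] lessThan_iff poly_action_linear_factor mult_1)
    also have "\<dots> = poly_action (Q $$ (a, l)) (\<lambda>i. \<Sum>b<N. 1 * (- K $$ (l, b) * s b i + (if l = b then 1 else 0) * s b (Suc i)))"
      by (rule poly_action_lincomb)
    \<comment> \<open>Row \<open>l\<close> of \<open>x - K\<close>, applied to the sequence, is the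
      difference of the two sides of the recursion for component \<open>l\<close> at index
      \<open>j + i\<close>, hence 0.\<close>
    also have "(\<lambda>i. \<Sum>b<N. 1 * (- K $$ (l, b) * s b i + (if l = b then 1 else 0) * s b (Suc i))) = (\<lambda>_. 0)"
    proof
      fix i
      have "(\<Sum>b<N. (if l = b then 1 else 0) * s b (Suc i)) = (\<Sum>b<N. if l = b then s b (Suc i) else 0)"
        by (rule sum.cong) auto
      then show "(\<Sum>b<N. 1 * (- K $$ (l, b) * s b i + (if l = b then 1 else 0) * s b (Suc i))) = 0"
        using l x[OF l, of "j + i"]
        by (simp only: mult_1 mult_minus_left sum.distrib sum_negf) (simp add: s_def)
    qed
    also have "poly_action (Q $$ (a, l)) (\<lambda>_. 0) = 0" by (simp add: poly_action_def)
    finally show "(\<Sum>b<N. poly_action (Q $$ (a, l) * P $$ (l, b)) (s b)) = 0" .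
  qed
  finally show ?thesis by simp
qed

lemma circle_holomorphic_coeff_prod:
  assumes "\<And>i n. i \<in> I \<Longrightarrow> circle_holomorphic (\<lambda>k. coeff (p i k) n)"
  shows "circle_holomorphic (\<lambda>k. coeff (\<Prod>i\<in>I. p i k) n)"
  using assms
proof (induction I arbitrary: n rule: infinite_finite_induct)
  case (insert i I)
  then show ?case by (auto simp: coeff_mult intro!: circle_holomorphic_sum circle_holomorphic_mult)
qed auto

text \<open>By the Leibniz formula each coefficient is a polynomial in the entries of the
  matrix.\<close>

lemma circle_holomorphic_coeff_char_poly:
  assumes K: "\<And>k. K k \<in> carrier_mat N N"
    and hol: "\<And>a b. a < N \<Longrightarrow> b < N \<Longrightarrow> circle_holomorphic (\<lambda>k. K k $$ (a, b))"
  shows "circle_holomorphic (\<lambda>k. coeff (char_poly (K k)) n)"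
proof -
  have "coeff (char_poly (K k)) n = (\<Sum>p\<in>{p. p permutes {0..<N}}.
      of_int (sign p) * coeff (\<Prod>i=0..<N. char_poly_matrix (K k) $$ (i, p i)) n)" for k
    unfolding char_poly_def det_def'[OF char_poly_matrix_closed[OF K]] coeff_sum
  proof (intro sum.cong refl)
    fix p :: "nat \<Rightarrow> nat"
    show "coeff (signof p * (\<Prod>i=0..<N. char_poly_matrix (K k) $$ (i, p i))) n =
        of_int (sign p) * coeff (\<Prod>i=0..<N. char_poly_matrix (K k) $$ (i, p i)) n"
      by (cases p rule: sign_cases) auto
  qed
  moreover have "circle_holomorphic (\<lambda>k. coeff (\<Prod>i=0..<N. char_poly_matrix (K k) $$ (i, p i)) n)"
    if p: "p permutes {0..<N}" for p
  proof (rule circle_holomorphic_coeff_prod)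
    fix i n assume "i \<in> {0..<N}"
    then have i: "i < N" "p i < N" using permutes_in_image[OF p, of i] by auto
    have "char_poly_matrix (K k) $$ (i, p i) = [:- K k $$ (i, p i), if i = p i then 1 else 0:]" for k
      using K[of k] i by (simp add: char_poly_matrix_def)
    then show "circle_holomorphic (\<lambda>k. coeff (char_poly_matrix (K k) $$ (i, p i)) n)"
      using hol[OF i] by (cases n; cases "n - 1") (auto intro!: circle_holomorphic_uminus)
  qed
  ultimately show ?thesis
    by (simp only:) (intro circle_holomorphic_sum circle_holomorphic_mult circle_holomorphic_const, auto)
qed

text \<open>On vectorised matrices the map \<open>X \<mapsto> B X B\<^sup>\<dagger>\<close> is the Kronecker product of \<open>B\<close> with its
  complex conjugate; the pair \<open>(a, b)\<close> is encoded as \<open>a * m + b\<close>.\<close>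

lemma sandwich_recurrence:
  assumes B: "\<And>a b. a < m \<Longrightarrow> b < m \<Longrightarrow> circle_holomorphic (\<beta> a b)"
    and E: "\<And>j k a b. a < m \<Longrightarrow> b < m \<Longrightarrow>
      E (Suc j) k a b = (\<Sum>a'<m. \<Sum>b'<m. \<beta> a a' k * E j k a' b' * cnj (\<beta> b b' k))"
  obtains q :: "nat \<Rightarrow> real \<Rightarrow> complex" where "\<And>i. circle_holomorphic (q i)" "\<And>k. q (m * m) k = 1"
    "\<And>j k a b. a < m \<Longrightarrow> b < m \<Longrightarrow> (\<Sum>i\<le>m * m. q i k * E (j + i) k a b) = 0"
proof -
  define K where "K = (\<lambda>k. mat (m * m) (m * m)
    (\<lambda>(s, t). \<beta> (s div m) (t div m) k * cnj (\<beta> (s mod m) (t mod m) k)))"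
  define x where "x = (\<lambda>k j s. E j k (s div m) (s mod m))"
  have K: "K k \<in> carrier_mat (m * m) (m * m)" for k by (simp add: K_def)
  have dm: "s div m < m" "s mod m < m" if "s < m * m" for s
    using that by (auto simp: less_mult_imp_div_less) (metis gr_zeroI mod_less_divisor mult_is_0 not_less_zero)
  show ?thesis
  \<comment> \<open>The order \<open>m * m\<close> is the dimension of the space of vectorised
    matrices. The coefficients depend on \<open>k\<close> alone, so that one recurrence serves all
    entries.\<close>
  proof (rule that[of "\<lambda>i k. coeff (char_poly (K k)) i"])
    show "circle_holomorphic (\<lambda>k. coeff (char_poly (K k)) i)" for i
    proof (rule circle_holomorphic_coeff_char_poly[OF K])
      fix s t assume "s < m * m" "t < m * m"
      then show "circle_holomorphic (\<lambda>k. K k $$ (s, t))"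
        using dm by (auto simp: K_def intro!: circle_holomorphic_mult circle_holomorphic_cnj B)
    qed
    show "coeff (char_poly (K k)) (m * m) = 1" for k
      using degree_monic_char_poly[OF K] by blast
    fix j k a b assume ab: "a < m" "b < m"
    then have s: "a * m + b < m * m"
      by (metis add_less_cancel_left less_le_trans mult_Suc mult_le_mono1 Suc_leI add.commute)
    have "(\<Sum>i\<le>m * m. coeff (char_poly (K k)) i * x k (j + i) (a * m + b)) = 0"
    proof (rule char_poly_recurrence[OF K _ s])
      fix j s assume s: "s < m * m"
      have "(\<Sum>t<m * m. K k $$ (s, t) * x k j t)
          = (\<Sum>a'<m. \<Sum>t\<in>{a' * m..<a' * m + m}. K k $$ (s, t) * x k j t)"
        by (rule sum.nat_group[symmetric])
      also have "\<dots> = (\<Sum>a'<m. \<Sum>b'<m. K k $$ (s, a' * m + b') * x k j (a' * m + b'))"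
      proof (rule sum.cong[OF refl])
        fix a'
        show "(\<Sum>t\<in>{a' * m..<a' * m + m}. K k $$ (s, t) * x k j t)
            = (\<Sum>b'<m. K k $$ (s, a' * m + b') * x k j (a' * m + b'))"
          by (rule sum.reindex_bij_witness[of _ "\<lambda>b'. a' * m + b'" "\<lambda>t. t - a' * m"]) auto
      qed
      also have "\<dots> = x k (Suc j) s"
        unfolding x_def E[OF dm[OF s]]
      proof (intro sum.cong refl)
        fix a' b' assume "a' \<in> {..<m}" "b' \<in> {..<m}"
        then have ab': "a' < m" "b' < m" by auto
        then have "a' * m + b' < m * m"
          by (metis add_less_cancel_left less_le_trans mult_Suc mult_le_mono1 Suc_leI add.commute)
        then show "K k $$ (s, a' * m + b') * E j k ((a' * m + b') div m) ((a' * m + b') mod m)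
            = \<beta> (s div m) a' k * E j k a' b' * cnj (\<beta> (s mod m) b' k)"
          using s ab' by (simp add: K_def)
      qed
      finally show "x k (Suc j) s = (\<Sum>t<m * m. K k $$ (s, t) * x k j t)" by simp
    qed
    then show "(\<Sum>i\<le>m * m. coeff (char_poly (K k)) i * E (j + i) k a b) = 0"
      using ab by (simp add: x_def)
  qed
qed

section \<open>Adjoint matrices\<close>

lemma mat_adjoint_dim [simp]:
  "dim_row (mat_adjoint M) = dim_col M" "dim_col (mat_adjoint M) = dim_row M"
  by (auto simp: mat_adjoint_def)

lemma mat_adjoint_carrier [simp]: "M \<in> carrier_mat r c \<Longrightarrow> mat_adjoint M \<in> carrier_mat c r"
  by (rule carrier_matI) simp_all

lemma mat_adjoint_index [simp]:
  fixes M :: "complex mat"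
  shows "i < dim_col M \<Longrightarrow> j < dim_row M \<Longrightarrow> mat_adjoint M $$ (i, j) = cnj (M $$ (j, i))"
  by (simp add: mat_adjoint_def mat_of_rows_def)

lemma mat_adjoint_mult:
  fixes M N :: "complex mat"
  assumes "M \<in> carrier_mat a b" "N \<in> carrier_mat b c"
  shows "mat_adjoint (M * N) = mat_adjoint N * mat_adjoint M"
  using assms by (intro eq_matI) (auto simp: scalar_prod_def mult.commute)

lemma mat_adjoint_add:
  fixes M N :: "complex mat"
  assumes "M \<in> carrier_mat a b" "N \<in> carrier_mat a b"
  shows "mat_adjoint (M + N) = mat_adjoint M + mat_adjoint N"
  using assms by (intro eq_matI) auto

lemma mat_adjoint_adjoint [simp]:
  fixes M :: "complex mat"
  shows "mat_adjoint (mat_adjoint M) = M"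
  by (intro eq_matI) auto

lemma index_mult_mat_sum:
  assumes "M \<in> carrier_mat a b" "N \<in> carrier_mat b c" "i < a" "j < c"
  shows "(M * N) $$ (i, j) = (\<Sum>l<b. M $$ (i, l) * N $$ (l, j))"
  using assms by (simp add: scalar_prod_def lessThan_atLeast0)

lemma index_mult3_mat_sum:
  fixes L :: "'a :: comm_semiring_0 mat"
  assumes "L \<in> carrier_mat a b" "M \<in> carrier_mat b c" "N \<in> carrier_mat c d" "i < a" "j < d"
  shows "(L * M * N) $$ (i, j) = (\<Sum>s<b. \<Sum>t<c. L $$ (i, s) * M $$ (s, t) * N $$ (t, j))"
proof -
  have "(L * M * N) $$ (i, j) = (\<Sum>t<c. (\<Sum>s<b. L $$ (i, s) * M $$ (s, t)) * N $$ (t, j))"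
    using assms by (subst index_mult_mat_sum[of _ a c _ d]) (auto simp: index_mult_mat_sum[of _ a b] simp del: index_mult_mat(1) intro!: sum.cong)
  also have "\<dots> = (\<Sum>s<b. \<Sum>t<c. L $$ (i, s) * M $$ (s, t) * N $$ (t, j))"
    unfolding sum_distrib_right by (rule sum.swap)
  finally show ?thesis .
qed

lemma eq_mat_on_vectors:
  fixes M N :: "complex mat"
  assumes "M \<in> carrier_mat r c" "N \<in> carrier_mat r c"
    and "\<And>v. v \<in> carrier_vec c \<Longrightarrow> M *\<^sub>v v = N *\<^sub>v v"
  shows "M = N"
proof (rule eq_matI)
  fix i j assume "i < dim_row N" "j < dim_col N"
  then have ij: "i < r" "j < c" using assms by auto
  have "(M *\<^sub>v unit_vec c j) $ i = (N *\<^sub>v unit_vec c j) $ i"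
    by (simp add: assms(3))
  then show "M $$ (i, j) = N $$ (i, j)"
    using assms(1,2) ij by simp
qed (use assms in auto)

section \<open>The Hermitian inner product\<close>

lemma cinner_sum:
  fixes v w :: "complex Matrix.vec"
  shows "w \<in> carrier_vec n \<Longrightarrow> v \<bullet>c w = (\<Sum>i<n. v $ i * cnj (w $ i))"
  by (simp add: scalar_prod_def lessThan_atLeast0)

context
  fixes u v w :: "complex Matrix.vec" and n :: nat
  assumes carrier: "u \<in> carrier_vec n" "v \<in> carrier_vec n" "w \<in> carrier_vec n"
begin

lemma cinner_add_left: "(u + v) \<bullet>c w = u \<bullet>c w + v \<bullet>c w"
  using carrier by (simp add: cinner_sum[of _ n] distrib_right sum.distrib)

lemma cinner_add_right: "u \<bullet>c (v + w) = u \<bullet>c v + u \<bullet>c w"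
  using carrier by (simp add: cinner_sum[of _ n] distrib_left sum.distrib)

lemma cinner_diff_left: "(u - v) \<bullet>c w = u \<bullet>c w - v \<bullet>c w"
  using carrier by (simp add: cinner_sum[of _ n] left_diff_distrib sum_subtractf)

lemma cinner_diff_right: "u \<bullet>c (v - w) = u \<bullet>c v - u \<bullet>c w"
  using carrier by (simp add: cinner_sum[of _ n] right_diff_distrib sum_subtractf)

lemma cinner_smult_left: "(c \<cdot>\<^sub>v u) \<bullet>c w = c * (u \<bullet>c w)"
  using carrier by (simp add: cinner_sum[of _ n] sum_distrib_left mult.assoc)

lemma cinner_smult_right: "u \<bullet>c (c \<cdot>\<^sub>v w) = cnj c * (u \<bullet>c w)"
  using carrier by (simp add: cinner_sum[of _ n] sum_distrib_left mult_ac)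

lemma cinner_cnj: "cnj (u \<bullet>c v) = v \<bullet>c u"
  using carrier by (simp add: cinner_sum[of _ n] mult.commute)

end

lemma cinner_adjoint:
  fixes M :: "complex mat"
  assumes "M \<in> carrier_mat r c" "v \<in> carrier_vec c" "w \<in> carrier_vec r"
  shows "(M *\<^sub>v v) \<bullet>c w = v \<bullet>c (mat_adjoint M *\<^sub>v w)"
proof -
  have "(M *\<^sub>v v) \<bullet>c w = (\<Sum>i<r. \<Sum>j<c. M $$ (i, j) * v $ j * cnj (w $ i))"
    using assms by (simp add: cinner_sum[of _ r] scalar_prod_def sum_distrib_right lessThan_atLeast0)
  also have "\<dots> = (\<Sum>j<c. \<Sum>i<r. M $$ (i, j) * v $ j * cnj (w $ i))"
    by (rule sum.swap)
  also have "\<dots> = v \<bullet>c (mat_adjoint M *\<^sub>v w)"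
    using assms mult_mat_vec_carrier[OF mat_adjoint_carrier[OF assms(1)] assms(3)]
    by (subst cinner_sum[of _ c]) (auto simp: scalar_prod_def sum_distrib_left lessThan_atLeast0 mult_ac intro!: sum.cong)
  finally show ?thesis .
qed

lemma cinner_self:
  fixes v :: "complex Matrix.vec"
  shows "v \<bullet>c v = complex_of_real ((l2_norm_vec v)\<^sup>2)"
proof -
  have "(l2_norm_vec v)\<^sup>2 = (\<Sum>i<dim_vec v. (cmod (v $ i))\<^sup>2)"
    by (simp add: l2_norm_vec_def sum_nonneg)
  then show ?thesis
    by (simp add: cinner_sum[of _ "dim_vec v"] flip: complex_norm_square)
qed

lemma l2_norm_vec_eq_0_iff: "l2_norm_vec v = 0 \<longleftrightarrow> v = 0\<^sub>v (dim_vec v)"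
  by (auto simp: l2_norm_vec_def sum_nonneg_eq_0_iff intro: eq_vecI) (metis index_zero_vec(1))

lemma cinner_self_eq_0:
  fixes v :: "complex Matrix.vec"
  assumes "v \<in> carrier_vec n" "v \<bullet>c v = 0"
  shows "v = 0\<^sub>v n"
  using assms l2_norm_vec_eq_0_iff[of v] by (simp add: cinner_self del: conjugate_square_eq_0_vec)

section \<open>Subspaces and orthogonal projectors\<close>

definition linear_subspace :: "nat \<Rightarrow> complex Matrix.vec set \<Rightarrow> bool" where
  "linear_subspace m W \<longleftrightarrow> W \<subseteq> carrier_vec m \<and> 0\<^sub>v m \<in> W \<and>
     (\<forall>v\<in>W. \<forall>w\<in>W. v + w \<in> W) \<and> (\<forall>c. \<forall>v\<in>W. c \<cdot>\<^sub>v v \<in> W)"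

lemma linear_subspace_diff:
  assumes "linear_subspace m W" "v \<in> W" "w \<in> W"
  shows "v - w \<in> W"
proof -
  have "v - w = v + (-1) \<cdot>\<^sub>v w"
    using assms unfolding linear_subspace_def by (intro eq_vecI) auto
  then show ?thesis using assms unfolding linear_subspace_def by metis
qed

lemma linear_subspace_orthogonal_compl:
  assumes "W \<subseteq> carrier_vec m"
  shows "linear_subspace m (orthogonal_compl m W)"
  using assms unfolding linear_subspace_def orthogonal_compl_def
  by (auto simp: cinner_add_left[of _ m] cinner_smult_left[of _ m] subset_iff)

text \<open>Characterises the span as the least subspace containing \<open>S\<close>. The undamped
  space is handled through these three facts only, without linear combinations.\<close>

lemma linear_subspace_span:
  assumes "S \<subseteq> carrier_vec m"
  shows "linear_subspace m (LinearCombinations.module.span class_ring (module_vec TYPE(complex) m) S)"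
    and "S \<subseteq> LinearCombinations.module.span class_ring (module_vec TYPE(complex) m) S"
    and "linear_subspace m W \<Longrightarrow> S \<subseteq> W \<Longrightarrow>
      LinearCombinations.module.span class_ring (module_vec TYPE(complex) m) S \<subseteq> W"
proof -
  interpret vec_space "TYPE(complex)" m .
  have S: "S \<subseteq> carrier (module_vec TYPE(complex) m)" using assms by simp
  have sub: "submodule class_ring (LinearCombinations.module.span class_ring (module_vec TYPE(complex) m) S)
      (module_vec TYPE(complex) m)"
    using span_is_submodule[OF assms] .
  show "linear_subspace m (LinearCombinations.module.span class_ring (module_vec TYPE(complex) m) S)"
    using sub unfolding linear_subspace_def submodule_def
    by (auto simp: module_vec_simps class_ring_simps)
  show "S \<subseteq> LinearCombinations.module.span class_ring (module_vec TYPE(complex) m) S"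
    using in_own_span[OF assms] .
  assume W: "linear_subspace m W" "S \<subseteq> W"
  have "submodule class_ring W (module_vec TYPE(complex) m)"
    using W(1) sub unfolding linear_subspace_def submodule_def
    by (auto simp: module_vec_simps class_ring_simps)
  then show "LinearCombinations.module.span class_ring (module_vec TYPE(complex) m) S \<subseteq> W"
    by (rule span_is_subset[OF W(2)])
qed

text \<open>Orthogonal projectors whose range lies in \<open>W\<close> but may be smaller than
  \<open>W\<close>: the intermediate stages of a Gram-Schmidt process, carried without a
  basis.\<close>

definition partial_projector :: "nat \<Rightarrow> complex Matrix.vec set \<Rightarrow> complex mat \<Rightarrow> bool" where
  "partial_projector m W Q \<longleftrightarrow> Q \<in> carrier_mat m m \<and> mat_adjoint Q = Q \<and> Q * Q = Q \<and>
     (\<forall>v\<in>carrier_vec m. Q *\<^sub>v v \<in> W)"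

text \<open>One Gram-Schmidt step. The residue \<open>e = w - Q w\<close> is a nonzero vector of
  \<open>W\<close> with \<open>Q e = 0\<close>, so adding the rank-one projector onto
  \<open>e\<close> gives a partial projector again, and the trace of a rank-one projector is
  1.\<close>

lemma partial_projector_extend:
  assumes Q: "partial_projector m W Q" and W: "linear_subspace m W" and w: "w \<in> W" "Q *\<^sub>v w \<noteq> w"
  obtains Q' where "partial_projector m W Q'"
    "(\<Sum>i<m. Q' $$ (i, i)) = (\<Sum>i<m. Q $$ (i, i)) + 1"
proof -
  have Qc: "Q \<in> carrier_mat m m" and Qa: "mat_adjoint Q = Q" and QQ: "Q * Q = Q"
    and QW: "\<And>v. v \<in> carrier_vec m \<Longrightarrow> Q *\<^sub>v v \<in> W"
    using Q unfolding partial_projector_def by auto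
  have wc: "w \<in> carrier_vec m" using w W unfolding linear_subspace_def by auto
  define e where "e = w - Q *\<^sub>v w"
  have ec: "e \<in> carrier_vec m" using wc Qc by (simp add: e_def)
  have eW: "e \<in> W" unfolding e_def using linear_subspace_diff[OF W w(1) QW[OF wc]] .
  have Qe: "Q *\<^sub>v e = 0\<^sub>v m"
  proof -
    have "Q *\<^sub>v (Q *\<^sub>v w) = Q *\<^sub>v w"
      using assoc_mult_mat_vec[OF Qc Qc wc] QQ by simp
    then show ?thesis
      unfolding e_def using Qc wc by (simp add: mult_minus_distrib_mat_vec[OF Qc])
  qed
  define c where "c = e \<bullet>c e"
  have c0: "c \<noteq> 0"
  proof
    assume "c = 0"
    then have "e = 0\<^sub>v m" using cinner_self_eq_0[OF ec] by (simp add: c_def)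
    have "w = Q *\<^sub>v w"
    proof (rule eq_vecI)
      fix i assume "i < dim_vec (Q *\<^sub>v w)"
      then have i: "i < m" using Qc by simp
      then have "e $ i = 0" using \<open>e = 0\<^sub>v m\<close> by simp
      then show "w $ i = (Q *\<^sub>v w) $ i" using i Qc wc by (simp add: e_def del: index_mult_mat_vec)
    qed (use wc Qc in auto)
    then show False using w(2) by simp
  qed
  have c_real: "cnj c = c" by (simp add: c_def cinner_self)
  define Q' where "Q' = mat m m (\<lambda>(i, j). Q $$ (i, j) + e $ i * cnj (e $ j) / c)"
  have Q'c: "Q' \<in> carrier_mat m m" by (simp add: Q'_def)
  have act: "Q' *\<^sub>v v = Q *\<^sub>v v + ((v \<bullet>c e) / c) \<cdot>\<^sub>v e" if v: "v \<in> carrier_vec m" for v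
  proof (rule eq_vecI)
    fix i assume "i < dim_vec (Q *\<^sub>v v + ((v \<bullet>c e) / c) \<cdot>\<^sub>v e)"
    then have i: "i < m" using ec by simp
    have "(Q' *\<^sub>v v) $ i = (\<Sum>j<m. (Q $$ (i, j) + e $ i * cnj (e $ j) / c) * v $ j)"
      using i v by (simp add: Q'_def scalar_prod_def lessThan_atLeast0)
    also have "\<dots> = (\<Sum>j<m. Q $$ (i, j) * v $ j) + (\<Sum>j<m. v $ j * cnj (e $ j)) / c * e $ i"
      unfolding distrib_right sum.distrib
      by (simp add: sum_divide_distrib sum_distrib_left sum_distrib_right mult_ac)
    also have "\<dots> = (Q *\<^sub>v v + ((v \<bullet>c e) / c) \<cdot>\<^sub>v e) $ i"
      using i v ec Qc by (simp add: cinner_sum[of _ m] scalar_prod_def lessThan_atLeast0)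
    finally show "(Q' *\<^sub>v v) $ i = (Q *\<^sub>v v + ((v \<bullet>c e) / c) \<cdot>\<^sub>v e) $ i" .
  qed (use ec Q'c in auto)
  show ?thesis
  proof (rule that)
    have "mat_adjoint Q' = Q'"
    proof (rule eq_matI)
      fix i j assume "i < dim_row Q'" "j < dim_col Q'"
      then have ij: "i < m" "j < m" using Q'c by auto
      have "cnj (Q $$ (j, i)) = Q $$ (i, j)"
        using mat_adjoint_index[of i Q j] ij Qc unfolding Qa by simp
      then show "mat_adjoint Q' $$ (i, j) = Q' $$ (i, j)"
        using ij by (simp add: Q'_def c_real mult.commute)
    qed (use Q'c in auto)
    moreover have "Q' * Q' = Q'"
    proof (rule eq_mat_on_vectors)
      fix v :: "complex Matrix.vec" assume v: "v \<in> carrier_vec m"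
      have Qv: "Q *\<^sub>v v \<in> carrier_vec m" using Qc v by simp
      have Q'v: "Q' *\<^sub>v v \<in> carrier_vec m" using Q'c v by simp
      have "(Q *\<^sub>v v) \<bullet>c e = v \<bullet>c (Q *\<^sub>v e)"
        using cinner_adjoint[OF Qc v ec] by (simp add: Qa)
      also have "\<dots> = 0" unfolding Qe using v by (simp add: cinner_sum[of _ m])
      finally have Qve: "(Q *\<^sub>v v) \<bullet>c e = 0" .
      have coef: "(Q' *\<^sub>v v) \<bullet>c e = v \<bullet>c e"
        unfolding act[OF v] using cinner_add_left[OF Qv _ ec, of "((v \<bullet>c e) / c) \<cdot>\<^sub>v e"] ec c0
        by (simp add: Qve cinner_smult_left[OF ec ec ec] flip: c_def)
      have "Q *\<^sub>v (Q' *\<^sub>v v) = Q *\<^sub>v (Q *\<^sub>v v) + Q *\<^sub>v (((v \<bullet>c e) / c) \<cdot>\<^sub>v e)"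
        unfolding act[OF v] using Qv ec by (intro mult_add_distrib_mat_vec[OF Qc]) auto
      also have "\<dots> = Q *\<^sub>v v"
      proof -
        have "((v \<bullet>c e) / c) \<cdot>\<^sub>v 0\<^sub>v m = 0\<^sub>v m" by (rule eq_vecI) auto
        then show ?thesis
          using assoc_mult_mat_vec[OF Qc Qc v] QQ Qv by (simp add: mult_mat_vec[OF Qc ec] Qe)
      qed
      finally have "Q' *\<^sub>v (Q' *\<^sub>v v) = Q' *\<^sub>v v"
        unfolding act[OF Q'v] coef by (simp add: act[OF v])
      then show "Q' * Q' *\<^sub>v v = Q' *\<^sub>v v"
        using assoc_mult_mat_vec[OF Q'c Q'c v] by simp
    qed (use Q'c in auto)
    moreover have "Q' *\<^sub>v v \<in> W" if "v \<in> carrier_vec m" for v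
      unfolding act[OF that] using QW[OF that] eW W unfolding linear_subspace_def by blast
    ultimately show "partial_projector m W Q'"
      using Q'c unfolding partial_projector_def by auto
    have "(\<Sum>i<m. Q' $$ (i, i)) = (\<Sum>i<m. Q $$ (i, i)) + (\<Sum>i<m. e $ i * cnj (e $ i)) / c"
      by (simp add: Q'_def sum.distrib sum_divide_distrib)
    also have "(\<Sum>i<m. e $ i * cnj (e $ i)) = c"
      unfolding c_def using ec by (simp add: cinner_sum[of _ m])
    finally show "(\<Sum>i<m. Q' $$ (i, i)) = (\<Sum>i<m. Q $$ (i, i)) + 1" using c0 by simp
  qed
qed

text \<open>The trace of a partial projector is its rank, so it cannot be increased for ever.\<close>

lemma orthogonal_projector_exists:
  assumes W: "linear_subspace m W"
  obtains Q where "Q \<in> carrier_mat m m"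
    "\<And>v. v \<in> carrier_vec m \<Longrightarrow> Q *\<^sub>v v \<in> W \<and> v - Q *\<^sub>v v \<in> orthogonal_compl m W"
proof -
  have "\<exists>Q. partial_projector m W Q \<and> (\<forall>w\<in>W. Q *\<^sub>v w = w)"
  proof (rule ccontr)
    assume "\<nexists>Q. partial_projector m W Q \<and> (\<forall>w\<in>W. Q *\<^sub>v w = w)"
    then have step: "\<exists>Q'. partial_projector m W Q' \<and> (\<Sum>i<m. Q' $$ (i, i)) = (\<Sum>i<m. Q $$ (i, i)) + 1"
      if "partial_projector m W Q" for Q
      using partial_projector_extend[OF that W] that by metis
    have "\<exists>Q. partial_projector m W Q \<and> (\<Sum>i<m. Q $$ (i, i)) = of_nat l" for l
    proof (induction l)
      case 0
      have "0\<^sub>m m m *\<^sub>v v = 0\<^sub>v m" if "v \<in> carrier_vec m" for v :: "complex Matrix.vec"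
        using that by (intro eq_vecI) auto
      then have "partial_projector m W (0\<^sub>m m m)"
        using W unfolding partial_projector_def linear_subspace_def
        by (auto intro!: eq_matI)
      then show ?case by (intro exI[of _ "0\<^sub>m m m"]) auto
    next
      case (Suc l)
      then show ?case using step by (metis of_nat_Suc add.commute)
    qed
    \<comment> \<open>The value \<open>Suc m\<close> is one more than the trace of an orthogonal
      projector on an \<open>m\<close>-dimensional space can be.\<close>
    then obtain Q where Q: "partial_projector m W Q" "(\<Sum>i<m. Q $$ (i, i)) = of_nat (Suc m)" by blast
    then have Qc: "Q \<in> carrier_mat m m" and Qa: "mat_adjoint Q = Q" and QQ: "Q * Q = Q"
      unfolding partial_projector_def by auto
    \<comment> \<open>A self-adjoint idempotent has on its diagonal the squared norms of its
      columns; such a number dominates its own square and therefore is at most 1.\<close>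
    have "Re (Q $$ (i, i)) \<le> 1" if i: "i < m" for i
    proof -
      have "Q $$ (i, i) = (\<Sum>j<m. mat_adjoint Q $$ (i, j) * Q $$ (j, i))"
        using index_mult_mat_sum[OF Qc Qc i i] QQ Qa by simp
      also have "\<dots> = complex_of_real (\<Sum>j<m. (cmod (Q $$ (j, i)))\<^sup>2)"
        using i Qc by (simp add: complex_norm_square mult.commute[of "cnj _"] del: of_real_power)
      finally have eq: "Q $$ (i, i) = complex_of_real (\<Sum>j<m. (cmod (Q $$ (j, i)))\<^sup>2)" .
      have "(Re (Q $$ (i, i)))\<^sup>2 \<le> (cmod (Q $$ (i, i)))\<^sup>2"
        by (simp add: cmod_power2)
      also have "\<dots> \<le> (\<Sum>j<m. (cmod (Q $$ (j, i)))\<^sup>2)"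
        using i by (intro member_le_sum) auto
      also have "\<dots> = Re (Q $$ (i, i))" using eq by (metis Re_complex_of_real)
      finally have "(Re (Q $$ (i, i)))\<^sup>2 \<le> Re (Q $$ (i, i))" .
      moreover have "Re (Q $$ (i, i)) * 1 < Re (Q $$ (i, i)) * Re (Q $$ (i, i))" if "1 < Re (Q $$ (i, i))"
        using that by (intro mult_strict_left_mono) auto
      ultimately show ?thesis
        by (cases "1 < Re (Q $$ (i, i))") (simp_all add: power2_eq_square)
    qed
    then have "(\<Sum>i<m. Re (Q $$ (i, i))) \<le> (\<Sum>i<m. 1)" by (intro sum_mono) auto
    moreover have "(\<Sum>i<m. Re (Q $$ (i, i))) = Re (of_nat (Suc m))"
      using Q(2) by (metis Re_sum)
    ultimately show False by simp
  qed
  then obtain Q where Q: "partial_projector m W Q" "\<And>w. w \<in> W \<Longrightarrow> Q *\<^sub>v w = w" by blast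
  then have Qc: "Q \<in> carrier_mat m m" and Qa: "mat_adjoint Q = Q"
    and QW: "\<And>v. v \<in> carrier_vec m \<Longrightarrow> Q *\<^sub>v v \<in> W"
    unfolding partial_projector_def by auto
  show ?thesis
  proof (rule that[OF Qc], intro conjI QW)
    fix v :: "complex Matrix.vec" assume v: "v \<in> carrier_vec m"
    have Qv: "Q *\<^sub>v v \<in> carrier_vec m" using Qc v by simp
    have "(v - Q *\<^sub>v v) \<bullet>c w = 0" if w: "w \<in> W" for w
    proof -
      have wc: "w \<in> carrier_vec m" using w W unfolding linear_subspace_def by auto
      show ?thesis
        unfolding cinner_diff_left[OF v Qv wc] cinner_adjoint[OF Qc v wc] Qa Q(2)[OF w] by simp
    qed
    then show "v - Q *\<^sub>v v \<in> orthogonal_compl m W"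
      using v Qv by (simp add: orthogonal_compl_def)
  qed
qed

section \<open>The steady state\<close>

lemma pow_smult_mat:
  fixes c :: "'a :: comm_semiring_1"
  assumes "M \<in> carrier_mat n n"
  shows "(c \<cdot>\<^sub>m M) ^\<^sub>m k = c ^ k \<cdot>\<^sub>m M ^\<^sub>m k"
proof (induction k)
  case 0
  then show ?case using assms by (intro eq_matI) auto
next
  case (Suc k)
  have "(c \<cdot>\<^sub>m M) ^\<^sub>m Suc k = (c ^ k \<cdot>\<^sub>m M ^\<^sub>m k) * (c \<cdot>\<^sub>m M)" by (simp add: Suc)
  also have "\<dots> = c ^ Suc k \<cdot>\<^sub>m M ^\<^sub>m Suc k"
    using assms pow_carrier_mat[OF assms, of k]
    by (intro eq_matI) (auto simp: scalar_prod_def sum_distrib_left mult_ac intro!: sum.cong)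
  finally show ?case .
qed

lemma pow_mat_commute:
  assumes M: "M \<in> carrier_mat n n"
  shows "M ^\<^sub>m j * M = M * M ^\<^sub>m j"
proof (induction j)
  case 0
  then show ?case using M by simp
next
  case (Suc j)
  have "M ^\<^sub>m Suc j * M = M * M ^\<^sub>m j * M" by (simp add: Suc)
  also have "\<dots> = M * (M ^\<^sub>m j * M)" by (rule assoc_mult_mat[OF M _ M]) (use M in simp)
  finally show ?case by simp
qed

lemma mult_sandwich_carrier:
  assumes "L \<in> carrier_mat r n" "Y \<in> carrier_mat n n"
  shows "L * Y * mat_adjoint L \<in> carrier_mat r r"
  by (rule mult_carrier_mat[OF mult_carrier_mat[OF assms] mat_adjoint_carrier[OF assms(1)]])

lemma mult_mat_sandwich_assoc:
  assumes c: "L \<in> carrier_mat n n" "M \<in> carrier_mat n n" "Y \<in> carrier_mat n n"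
    "R \<in> carrier_mat n n" "S \<in> carrier_mat n n"
  shows "L * M * Y * (R * S) = L * (M * Y * R) * S"
proof -
  have MY: "M * Y \<in> carrier_mat n n" and LMY: "L * (M * Y) \<in> carrier_mat n n" using c by auto
  have "L * M * Y * (R * S) = L * (M * Y) * (R * S)" by (simp only: assoc_mult_mat[OF c(1-3)])
  also have "\<dots> = L * (M * Y) * R * S" by (rule assoc_mult_mat[OF LMY c(4,5), symmetric])
  also have "L * (M * Y) * R = L * (M * Y * R)" by (rule assoc_mult_mat[OF c(1) MY c(4)])
  finally show ?thesis .
qed

text \<open>The additional factor is split off on the outside for the recurrence in \<open>j\<close>
  and the fixed-point equation, and on the inside for iterating a given fixed point.\<close>

lemma power_sandwich_Suc:
  fixes M :: "complex mat"
  assumes M: "M \<in> carrier_mat n n" and Y: "Y \<in> carrier_mat n n"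
  shows "M ^\<^sub>m Suc j * Y * mat_adjoint (M ^\<^sub>m Suc j) = M * (M ^\<^sub>m j * Y * mat_adjoint (M ^\<^sub>m j)) * mat_adjoint M"
    and "M ^\<^sub>m Suc j * Y * mat_adjoint (M ^\<^sub>m Suc j) = M ^\<^sub>m j * (M * Y * mat_adjoint M) * mat_adjoint (M ^\<^sub>m j)"
proof -
  define N where "N = M ^\<^sub>m j"
  have N: "N \<in> carrier_mat n n" using M by (simp add: N_def)
  have comm: "N * M = M * N" unfolding N_def by (rule pow_mat_commute[OF M])
  have Suc: "M ^\<^sub>m Suc j = N * M" by (simp add: N_def)
  note adj = mat_adjoint_carrier[OF M] mat_adjoint_carrier[OF N]
  show "M ^\<^sub>m Suc j * Y * mat_adjoint (M ^\<^sub>m Suc j) = M * (M ^\<^sub>m j * Y * mat_adjoint (M ^\<^sub>m j)) * mat_adjoint M"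
    unfolding Suc unfolding comm mat_adjoint_mult[OF M N] N_def[symmetric]
    by (rule mult_mat_sandwich_assoc[where n = n]) (intro M N Y adj)+
  show "M ^\<^sub>m Suc j * Y * mat_adjoint (M ^\<^sub>m Suc j) = M ^\<^sub>m j * (M * Y * mat_adjoint M) * mat_adjoint (M ^\<^sub>m j)"
    unfolding Suc mat_adjoint_mult[OF N M] N_def[symmetric]
    by (rule mult_mat_sandwich_assoc[where n = n]) (intro M N Y adj)+
qed

lemma mult_sandwich:
  fixes L M Y :: "complex mat"
  assumes L: "L \<in> carrier_mat r n" and M: "M \<in> carrier_mat n n" and Y: "Y \<in> carrier_mat n n"
  shows "(L * M) * Y * mat_adjoint (L * M) = L * (M * Y * mat_adjoint M) * mat_adjoint L"
proof -
  note La = mat_adjoint_carrier[OF L] and Ma = mat_adjoint_carrier[OF M]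
  have 1: "M * Y \<in> carrier_mat n n" and 2: "L * (M * Y) \<in> carrier_mat r n" using L M Y by auto
  have "(L * M) * Y * mat_adjoint (L * M) = L * (M * Y) * (mat_adjoint M * mat_adjoint L)"
    by (simp only: assoc_mult_mat[OF L M Y] mat_adjoint_mult[OF L M])
  also have "\<dots> = L * (M * Y) * mat_adjoint M * mat_adjoint L"
    by (rule assoc_mult_mat[OF 2 Ma La, symmetric])
  also have "L * (M * Y) * mat_adjoint M = L * (M * Y * mat_adjoint M)"
    by (rule assoc_mult_mat[OF L 1 Ma])
  finally show ?thesis .
qed

text \<open>Choose \<open>r\<close> strictly between the spectral radius and 1. All eigenvalues of
  \<open>M / r\<close> lie in the open unit disc, so its powers are bounded; rescaling gives the
  factor \<open>r ^ j\<close>.\<close>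

lemma matrix_powers_decay:
  fixes M :: "complex mat"
  assumes M: "M \<in> carrier_mat n n" and ev: "\<And>c. eigenvalue M c \<Longrightarrow> cmod c < 1"
  obtains C r where "0 < r" "r < 1"
    "\<And>j a b. a < n \<Longrightarrow> b < n \<Longrightarrow> cmod ((M ^\<^sub>m j) $$ (a, b)) \<le> C * r ^ j"
proof -
  \<comment> \<open>Inserting 0 keeps the maximum meaningful when the matrix has dimension 0 and
    hence no eigenvalue.\<close>
  define s where "s = Max (insert 0 (cmod ` spectrum M))"
  have fin: "finite (insert 0 (cmod ` spectrum M))" using card_finite_spectrum(1)[OF M] by simp
  have s: "0 \<le> s" "\<And>c. eigenvalue M c \<Longrightarrow> cmod c \<le> s"
    unfolding s_def using fin by (auto intro!: Max_ge simp: spectrum_def)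
  have "s < 1" unfolding s_def using fin ev by (subst Max_less_iff) (auto simp: spectrum_def)
  define r where "r = (1 + s) / 2"
  have r: "0 < r" "r < 1" "s < r" using s \<open>s < 1\<close> by (auto simp: r_def)
  define N where "N = complex_of_real (1 / r) \<cdot>\<^sub>m M"
  have N: "N \<in> carrier_mat n n" using M by (simp add: N_def)
  obtain as where as: "char_poly N = (\<Prod>a\<leftarrow>as. [:- a, 1:])"
    using char_poly_factorized[OF N] by blast
  have lt: "cmod a < 1" if "a \<in> set as" for a
  proof -
    have "poly (char_poly N) a = 0" unfolding as by (rule linear_poly_root[OF that])
    then obtain v where v: "v \<in> carrier_vec n" "v \<noteq> 0\<^sub>v n" "N *\<^sub>v v = a \<cdot>\<^sub>v v"
      using eigenvalue_root_char_poly[OF N] N unfolding eigenvalue_def eigenvector_def by auto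
    have "M *\<^sub>v v = complex_of_real r \<cdot>\<^sub>v (N *\<^sub>v v)"
      using r(1) M v(1) by (intro eq_vecI) (auto simp: N_def scalar_prod_def sum_distrib_left)
    also have "\<dots> = (complex_of_real r * a) \<cdot>\<^sub>v v"
      unfolding v(3) by (simp add: smult_smult_assoc)
    finally have "eigenvalue M (complex_of_real r * a)"
      using v M unfolding eigenvalue_def eigenvector_def by auto
    then have "r * cmod a \<le> s" using s(2) r(1) by (fastforce simp: norm_mult)
    then have "r * cmod a < r * 1" using r(3) by simp
    then show ?thesis using r(1) by (simp only: mult_less_cancel_left_pos)
  qed
  \<comment> \<open>The \<open>0\<close> in the exponent bounds the multiplicity of the eigenvalues
    of modulus 1, of which there are none. On natural numbers \<open>0 - 1 = 0\<close>, so the bound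
    is constant in \<open>k\<close>.\<close>
  have "\<exists>c1 c2. \<forall>k. norm_bound (N ^\<^sub>m k) (c1 + c2 * of_nat k ^ (0 - 1))"
    by (rule factored_char_poly_norm_bound_cof[OF N as]) (use lt in force)+
  then obtain C where C: "\<And>k. norm_bound (N ^\<^sub>m k) C" by auto
  have "cmod ((M ^\<^sub>m j) $$ (a, b)) \<le> C * r ^ j" if "a < n" "b < n" for j a b
  proof -
    have "cmod ((N ^\<^sub>m j) $$ (a, b)) \<le> C"
      using C[of j] that unfolding norm_bound_def by (simp add: carrier_matD[OF N])
    moreover have "(N ^\<^sub>m j) $$ (a, b) = complex_of_real ((1 / r) ^ j) * (M ^\<^sub>m j) $$ (a, b)"
      using that by (simp add: N_def pow_smult_mat[OF M] carrier_matD[OF M])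
    ultimately have "(1 / r) ^ j * cmod ((M ^\<^sub>m j) $$ (a, b)) \<le> C"
      using r(1) by (simp add: norm_mult norm_power norm_divide)
    then show ?thesis using r(1) by (simp add: power_one_over field_simps)
  qed
  with r that show ?thesis by blast
qed

lemma sums_sandwich:
  fixes L R X :: "complex mat"
  assumes "L \<in> carrier_mat a b" "R \<in> carrier_mat c d" "X \<in> carrier_mat b c" "\<And>j. F j \<in> carrier_mat b c"
    and F: "\<And>s t. s < b \<Longrightarrow> t < c \<Longrightarrow> (\<lambda>j. F j $$ (s, t)) sums (X $$ (s, t))"
    and "i < a" "l < d"
  shows "(\<lambda>j. (L * F j * R) $$ (i, l)) sums ((L * X * R) $$ (i, l))"
proof -
  have "(\<lambda>j. \<Sum>s<b. \<Sum>t<c. L $$ (i, s) * F j $$ (s, t) * R $$ (t, l)) sums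
      (\<Sum>s<b. \<Sum>t<c. L $$ (i, s) * X $$ (s, t) * R $$ (t, l))"
    by (intro sums_sum sums_mult sums_mult2 F) auto
  then show ?thesis
    by (simp only: index_mult3_mat_sum[OF assms(1,4,2,6,7)] index_mult3_mat_sum[OF assms(1,3,2,6,7)])
qed

lemma sandwich_power_bound:
  fixes M X :: "complex mat"
  assumes M: "M \<in> carrier_mat n n" and X: "X \<in> carrier_mat n n"
    and C: "\<And>j a b. a < n \<Longrightarrow> b < n \<Longrightarrow> cmod ((M ^\<^sub>m j) $$ (a, b)) \<le> C * r ^ j" and r: "0 < r"
    and ab: "a < n" "b < n"
  shows "cmod ((M ^\<^sub>m j * X * mat_adjoint (M ^\<^sub>m j)) $$ (a, b)) \<le>
    (\<Sum>s<n. \<Sum>t<n. C * cmod (X $$ (s, t)) * C) * (r ^ 2) ^ j"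
proof -
  have Mj: "M ^\<^sub>m j \<in> carrier_mat n n" using M by simp
  have C0: "0 \<le> C * r ^ j" using C[OF ab, of j] norm_ge_zero order_trans by blast
  have "cmod ((M ^\<^sub>m j * X * mat_adjoint (M ^\<^sub>m j)) $$ (a, b))
      = cmod (\<Sum>s<n. \<Sum>t<n. (M ^\<^sub>m j) $$ (a, s) * X $$ (s, t) * cnj ((M ^\<^sub>m j) $$ (b, t)))"
    using ab by (subst index_mult3_mat_sum[OF Mj X mat_adjoint_carrier[OF Mj]])
      (simp_all add: carrier_matD[OF M])
  also have "\<dots> \<le> (\<Sum>s<n. \<Sum>t<n. cmod ((M ^\<^sub>m j) $$ (a, s) * X $$ (s, t) * cnj ((M ^\<^sub>m j) $$ (b, t))))"
    by (rule order_trans[OF norm_sum sum_mono[OF norm_sum]])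
  also have "\<dots> \<le> (\<Sum>s<n. \<Sum>t<n. (C * r ^ j) * cmod (X $$ (s, t)) * (C * r ^ j))"
    unfolding norm_mult complex_mod_cnj using C0 ab
    by (intro sum_mono mult_mono C) (auto intro!: mult_nonneg_nonneg)
  also have "\<dots> = (\<Sum>s<n. \<Sum>t<n. C * cmod (X $$ (s, t)) * C) * (r ^ 2) ^ j"
    unfolding sum_distrib_right power2_eq_square power_mult_distrib by (simp add: mult_ac)
  finally show ?thesis .
qed

lemma vec_diff_eq_0D:
  fixes v w :: "complex Matrix.vec"
  assumes "v \<in> carrier_vec n" "w \<in> carrier_vec n" "v - w = 0\<^sub>v n"
  shows "v = w"
proof (rule eq_vecI)
  fix i assume "i < dim_vec w"
  then have i: "i < n" using assms by simp
  then have "(v - w) $ i = 0" using assms(3) by simp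
  then show "v $ i = w $ i" using i assms(1,2) by simp
qed (use assms in auto)

text \<open>The properties of one period at a fixed momentum. The first norm condition is
  \<open>B\<^sub>P\<^sup>\<dagger> B\<^sub>P + B\<^sup>\<dagger> B = 1\<close>. The next two are
  what remains of \<open>A\<^sup>\<dagger> A + B B\<^sup>\<dagger> \<le> 1\<close>: the adjoint of
  \<open>B\<close> is a contraction, and \<open>A\<close> vanishes wherever it preserves the norm.
  In this form they pass from the two layers to their composition by following norms along a
  vector.\<close>

locale damped_gaussian_map =
  fixes m p :: nat and A B BP :: "complex mat"
  assumes A: "A \<in> carrier_mat m m" and B: "B \<in> carrier_mat m m" and BP: "BP \<in> carrier_mat p m"
    and isometric: "v \<in> carrier_vec m \<Longrightarrow>
      (l2_norm_vec (BP *\<^sub>v v))\<^sup>2 + (l2_norm_vec (B *\<^sub>v v))\<^sup>2 = (l2_norm_vec v)\<^sup>2"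
    and adjoint_contraction: "v \<in> carrier_vec m \<Longrightarrow> l2_norm_vec (mat_adjoint B *\<^sub>v v) \<le> l2_norm_vec v"
    and undamped_kernel: "v \<in> carrier_vec m \<Longrightarrow>
      l2_norm_vec (mat_adjoint B *\<^sub>v v) = l2_norm_vec v \<Longrightarrow> A *\<^sub>v v = 0\<^sub>v m"
    and skew: "mat_adjoint A = - A"
begin

lemmas B_adj = mat_adjoint_carrier[OF B]

text \<open>Since \<open>B\<close> preserves the norm of \<open>v\<close>, nothing is left for
  \<open>BP\<close>. Expanding the square shows that the squared norm of
  \<open>B\<^sup>\<dagger> v - cnj c v\<close> is the squared norm of
  \<open>B\<^sup>\<dagger> v\<close> minus that of \<open>v\<close>, which contraction makes
  nonpositive. So \<open>v\<close> is an eigenvector of the adjoint too, which then preserves its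
  norm, and this forces \<open>A v = 0\<close>.\<close>

lemma undamped_eigenvector:
  assumes c: "cmod c = 1" and ev: "eigenvector B v c"
  shows "BP *\<^sub>v v = 0\<^sub>v p" "mat_adjoint B *\<^sub>v v = cnj c \<cdot>\<^sub>v v" "A *\<^sub>v v = 0\<^sub>v m"
proof -
  have v: "v \<in> carrier_vec m" and Bv: "B *\<^sub>v v = c \<cdot>\<^sub>v v"
    using ev B unfolding eigenvector_def by auto
  have cc: "c * cnj c = 1" using c by (simp add: complex_norm_square[symmetric])
  then have cc': "cnj c * c = 1" by (simp add: mult.commute)
  have "complex_of_real ((l2_norm_vec (B *\<^sub>v v))\<^sup>2) = complex_of_real ((l2_norm_vec v)\<^sup>2)"
    unfolding cinner_self[symmetric] Bv using v
    by (simp add: cinner_smult_left[of v m] cinner_smult_right[of _ m v] cc cc' flip: mult.assoc)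
  then have "(l2_norm_vec (B *\<^sub>v v))\<^sup>2 = (l2_norm_vec v)\<^sup>2" by (simp only: of_real_eq_iff)
  then have "l2_norm_vec (BP *\<^sub>v v) = 0" using isometric[OF v] by simp
  then show "BP *\<^sub>v v = 0\<^sub>v p" using BP unfolding l2_norm_vec_eq_0_iff by simp
  define w where "w = mat_adjoint B *\<^sub>v v - cnj c \<cdot>\<^sub>v v"
  have Bav: "mat_adjoint B *\<^sub>v v \<in> carrier_vec m" using B_adj v by simp
  have cv: "cnj c \<cdot>\<^sub>v v \<in> carrier_vec m" using v by simp
  have w: "w \<in> carrier_vec m" using Bav cv by (simp add: w_def)
  have 1: "(mat_adjoint B *\<^sub>v v) \<bullet>c v = cnj c * (v \<bullet>c v)"
    using cinner_adjoint[OF B_adj v v] v by (simp add: Bv cinner_smult_right[of v m v])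
  have 2: "v \<bullet>c (mat_adjoint B *\<^sub>v v) = c * (v \<bullet>c v)"
    using cinner_adjoint[OF B v v] v by (simp add: Bv cinner_smult_left[of v m v])
  have "w \<bullet>c w = (mat_adjoint B *\<^sub>v v) \<bullet>c (mat_adjoint B *\<^sub>v v) - v \<bullet>c v"
    unfolding w_def using Bav v cv cc
    by (simp add: cinner_diff_left[of _ m] cinner_diff_right[of _ m] cinner_smult_left[of v m]
        cinner_smult_right[of _ m v] 1 2 flip: mult.assoc) (simp add: mult.commute)
  then have "complex_of_real ((l2_norm_vec w)\<^sup>2)
      = complex_of_real ((l2_norm_vec (mat_adjoint B *\<^sub>v v))\<^sup>2 - (l2_norm_vec v)\<^sup>2)"
    unfolding cinner_self by simp
  then have "(l2_norm_vec w)\<^sup>2 = (l2_norm_vec (mat_adjoint B *\<^sub>v v))\<^sup>2 - (l2_norm_vec v)\<^sup>2"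
    by (simp only: of_real_eq_iff)
  moreover have "(l2_norm_vec (mat_adjoint B *\<^sub>v v))\<^sup>2 \<le> (l2_norm_vec v)\<^sup>2"
    using adjoint_contraction[OF v] by (intro power_mono) (auto simp: l2_norm_vec_def sum_nonneg)
  ultimately have "(l2_norm_vec w)\<^sup>2 \<le> 0" by simp
  then have w0: "l2_norm_vec w = 0" by simp
  then have "w = 0\<^sub>v m" using w unfolding l2_norm_vec_eq_0_iff by simp
  show eq: "mat_adjoint B *\<^sub>v v = cnj c \<cdot>\<^sub>v v"
    using \<open>w = 0\<^sub>v m\<close> unfolding w_def by (rule vec_diff_eq_0D[OF Bav cv])
  have "(l2_norm_vec (mat_adjoint B *\<^sub>v v))\<^sup>2 = (l2_norm_vec v)\<^sup>2"
    using \<open>(l2_norm_vec w)\<^sup>2 = _\<close> w0 by simp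
  then have "l2_norm_vec (mat_adjoint B *\<^sub>v v) = l2_norm_vec v"
    by (rule power2_eq_imp_eq) (auto simp: l2_norm_vec_def sum_nonneg)
  then show "A *\<^sub>v v = 0\<^sub>v m" by (rule undamped_kernel[OF v])
qed

section \<open>Orthogonal splitting into undamped and damped space\<close>

abbreviation "U \<equiv> undamped_space m B"
abbreviation "D \<equiv> damped_space m B"

lemma eigenvectors_carrier: "{v. \<exists>c. cmod c = 1 \<and> eigenvector B v c} \<subseteq> carrier_vec m"
  using B unfolding eigenvector_def by auto

lemma U_subspace: "linear_subspace m U"
  unfolding undamped_space_def by (rule linear_subspace_span(1)[OF eigenvectors_carrier])

lemma U_carrier: "v \<in> U \<Longrightarrow> v \<in> carrier_vec m"
  using U_subspace unfolding linear_subspace_def by auto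

lemma undamped_eigenvector_in_U: "cmod c = 1 \<Longrightarrow> eigenvector B v c \<Longrightarrow> v \<in> U"
  unfolding undamped_space_def using linear_subspace_span(2)[OF eigenvectors_carrier] by auto

text \<open>All four conditions are linear in \<open>u\<close> and hold for the spanning
  eigenvectors. Invariance under both \<open>B\<close> and its adjoint is what makes the orthogonal
  complement \<open>D\<close> invariant under \<open>B\<close>.\<close>

lemma U_closed:
  assumes "u \<in> U"
  shows "BP *\<^sub>v u = 0\<^sub>v p" "A *\<^sub>v u = 0\<^sub>v m" "B *\<^sub>v u \<in> U" "mat_adjoint B *\<^sub>v u \<in> U"
proof -
  define W where "W = {v \<in> U. BP *\<^sub>v v = 0\<^sub>v p \<and> A *\<^sub>v v = 0\<^sub>v m \<and> B *\<^sub>v v \<in> U \<and> mat_adjoint B *\<^sub>v v \<in> U}"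
  have zero [simp]: "M *\<^sub>v 0\<^sub>v m = 0\<^sub>v r" if "M \<in> carrier_mat r m" for r and M :: "complex mat"
    using that by (intro eq_vecI) auto
  have [simp]: "c \<cdot>\<^sub>v 0\<^sub>v r = 0\<^sub>v r" for c :: complex and r by (rule eq_vecI) auto
  have "linear_subspace m W"
    using U_subspace U_carrier A B BP B_adj unfolding linear_subspace_def W_def
    by (auto simp: mult_add_distrib_mat_vec[where nc = m] mult_mat_vec[where nc = m]
        mult_add_distrib_mat_vec[OF B_adj] mult_mat_vec[OF B_adj] zero[OF B_adj])
  moreover have "{v. \<exists>c. cmod c = 1 \<and> eigenvector B v c} \<subseteq> W"
  proof
    fix v assume "v \<in> {v. \<exists>c. cmod c = 1 \<and> eigenvector B v c}"
    then obtain c where c: "cmod c = 1" "eigenvector B v c" by blast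
    have "v \<in> U" by (rule undamped_eigenvector_in_U[OF c])
    moreover have "B *\<^sub>v v = c \<cdot>\<^sub>v v" using c unfolding eigenvector_def by auto
    ultimately show "v \<in> W"
      using undamped_eigenvector[OF c] U_subspace unfolding W_def linear_subspace_def by auto
  qed
  ultimately have "U \<subseteq> W"
    unfolding undamped_space_def by (rule linear_subspace_span(3)[OF eigenvectors_carrier])
  then show "BP *\<^sub>v u = 0\<^sub>v p" "A *\<^sub>v u = 0\<^sub>v m" "B *\<^sub>v u \<in> U" "mat_adjoint B *\<^sub>v u \<in> U"
    using assms unfolding W_def by auto
qed

lemma D_iff: "v \<in> D \<longleftrightarrow> v \<in> carrier_vec m \<and> (\<forall>u\<in>U. v \<bullet>c u = 0)"
  by (simp add: damped_space_def orthogonal_compl_def)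

lemma D_subspace: "linear_subspace m D"
  unfolding damped_space_def using U_carrier by (intro linear_subspace_orthogonal_compl) auto

lemma D_closed:
  assumes "v \<in> D"
  shows "B *\<^sub>v v \<in> D"
  using assms U_closed(4) U_carrier B unfolding D_iff by (auto simp: cinner_adjoint[OF B])

text \<open>As \<open>A\<close> is anti-Hermitian, its range is orthogonal to its kernel, which
  contains \<open>U\<close>. This is the source of \<open>P * A = A\<close>.\<close>

lemma A_in_D:
  assumes v: "v \<in> carrier_vec m"
  shows "A *\<^sub>v v \<in> D"
  unfolding D_iff
proof (intro conjI ballI)
  fix u assume u: "u \<in> U"
  have "(- A) *\<^sub>v u = 0\<^sub>v m"
    using U_closed(2)[OF u] U_carrier[OF u] A by (simp add: uminus_mult_mat_vec)
  then show "(A *\<^sub>v v) \<bullet>c u = 0"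
    using cinner_adjoint[OF A v U_carrier[OF u]] v by (simp add: skew cinner_sum[of _ m])
qed (use A v in simp)

lemma D_U_disjoint: "v \<in> D \<Longrightarrow> v \<in> U \<Longrightarrow> v = 0\<^sub>v m"
  by (rule cinner_self_eq_0) (auto simp: D_iff)

definition P :: "complex mat" where "P = orthogonal_projector m D"

text \<open>\<open>D\<close> is defined as the complement of \<open>U\<close>, so its projector is
  \<open>1 - Q\<close> with \<open>Q\<close> the projector onto \<open>U\<close>. This places
  \<open>v - P v\<close> in \<open>U\<close> itself, not merely in the complement of
  \<open>D\<close>. The definite description is unambiguous because two candidates differ on each
  vector by an element of both \<open>D\<close> and its complement.\<close>

lemma P_props: "P \<in> carrier_mat m m"
    "\<And>v. v \<in> carrier_vec m \<Longrightarrow> P *\<^sub>v v \<in> D" "\<And>v. v \<in> carrier_vec m \<Longrightarrow> v - P *\<^sub>v v \<in> U"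
proof -
  obtain Q where Qc: "Q \<in> carrier_mat m m"
    and Q: "\<And>v. v \<in> carrier_vec m \<Longrightarrow> Q *\<^sub>v v \<in> U \<and> v - Q *\<^sub>v v \<in> orthogonal_compl m U"
    using orthogonal_projector_exists[OF U_subspace] by blast
  define P' where "P' = 1\<^sub>m m - Q"
  have P'c: "P' \<in> carrier_mat m m" unfolding P'_def using Qc by (rule minus_carrier_mat)
  have P'v: "P' *\<^sub>v v = v - Q *\<^sub>v v" if "v \<in> carrier_vec m" for v
    unfolding P'_def using that Qc by (simp add: minus_mult_distrib_mat_vec[of _ m m])
  have P'D: "P' *\<^sub>v v \<in> D" if "v \<in> carrier_vec m" for v
    using P'v[OF that] Q[OF that] by (simp add: damped_space_def)
  have P'U: "v - P' *\<^sub>v v \<in> U" if "v \<in> carrier_vec m" for v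
  proof -
    have "v - P' *\<^sub>v v = Q *\<^sub>v v"
      unfolding P'v[OF that] using that Qc by (intro eq_vecI) (auto simp del: index_mult_mat_vec)
    then show ?thesis using Q[OF that] by simp
  qed
  have U_perp: "u \<in> orthogonal_compl m D" if u: "u \<in> U" for u
    unfolding orthogonal_compl_def
  proof (intro CollectI conjI ballI)
    fix d assume d: "d \<in> D"
    then have "cnj (d \<bullet>c u) = 0" using u by (auto simp: D_iff)
    then show "u \<bullet>c d = 0" using d u U_carrier cinner_cnj[of d m u] by (auto simp: D_iff)
  qed (rule U_carrier[OF u])
  have "P = P'"
    unfolding P_def orthogonal_projector_def
  proof (rule the_equality, intro conjI ballI P'c)
    fix v :: "complex Matrix.vec" assume v: "v \<in> carrier_vec m"
    show "P' *\<^sub>v v \<in> D" by (rule P'D[OF v])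
    show "v - P' *\<^sub>v v \<in> orthogonal_compl m D" by (rule U_perp[OF P'U[OF v]])
  next
    fix R assume R: "R \<in> carrier_mat m m \<and> (\<forall>v\<in>carrier_vec m. R *\<^sub>v v \<in> D \<and> v - R *\<^sub>v v \<in> orthogonal_compl m D)"
    show "R = P'"
    proof (rule eq_mat_on_vectors)
      fix v :: "complex Matrix.vec" assume v: "v \<in> carrier_vec m"
      define d where "d = R *\<^sub>v v - P' *\<^sub>v v"
      have c: "R *\<^sub>v v \<in> carrier_vec m" "P' *\<^sub>v v \<in> carrier_vec m" using R P'c v by auto
      have d: "d \<in> D" unfolding d_def using R v P'D[OF v] by (intro linear_subspace_diff[OF D_subspace]) auto
      have "d = (v - P' *\<^sub>v v) - (v - R *\<^sub>v v)"
        unfolding d_def by (rule eq_vecI) (use c v in \<open>simp_all del: index_mult_mat_vec dim_mult_mat_vec\<close>)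
      also have "\<dots> \<in> orthogonal_compl m D"
      proof (rule linear_subspace_diff[OF linear_subspace_orthogonal_compl])
        show "v - P' *\<^sub>v v \<in> orthogonal_compl m D" by (rule U_perp[OF P'U[OF v]])
        show "v - R *\<^sub>v v \<in> orthogonal_compl m D" using R v by blast
      qed (auto simp: D_iff)
      finally have "d \<bullet>c d = 0" using d by (auto simp: orthogonal_compl_def)
      then have "d = 0\<^sub>v m" using d by (intro cinner_self_eq_0) (auto simp: D_iff)
      then show "R *\<^sub>v v = P' *\<^sub>v v" unfolding d_def by (rule vec_diff_eq_0D[OF c])
    qed (use R P'c in auto)
  qed
  then show "P \<in> carrier_mat m m" "\<And>v. v \<in> carrier_vec m \<Longrightarrow> P *\<^sub>v v \<in> D"
    "\<And>v. v \<in> carrier_vec m \<Longrightarrow> v - P *\<^sub>v v \<in> U"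
    using P'c P'D P'U by auto
qed

lemmas P = P_props(1)

lemma P_on_D: "v \<in> D \<Longrightarrow> P *\<^sub>v v = v"
  and P_on_U: "u \<in> U \<Longrightarrow> P *\<^sub>v u = 0\<^sub>v m"
proof -
  assume v: "v \<in> D"
  then have vc: "v \<in> carrier_vec m" by (simp add: D_iff)
  have "v - P *\<^sub>v v \<in> D" using v P_props(2)[OF vc] by (rule linear_subspace_diff[OF D_subspace])
  then have "v - P *\<^sub>v v = 0\<^sub>v m" using P_props(3)[OF vc] by (rule D_U_disjoint)
  then show "P *\<^sub>v v = v" using vec_diff_eq_0D[of v m "P *\<^sub>v v"] vc P by simp
next
  assume u: "u \<in> U"
  have uc: "u \<in> carrier_vec m" by (rule U_carrier[OF u])
  have "u - (u - P *\<^sub>v u) \<in> U" using u P_props(3)[OF uc] by (rule linear_subspace_diff[OF U_subspace])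
  moreover have "u - (u - P *\<^sub>v u) = P *\<^sub>v u"
    using uc P by (intro eq_vecI) (auto simp del: index_mult_mat_vec)
  ultimately show "P *\<^sub>v u = 0\<^sub>v m" using P_props(2)[OF uc] D_U_disjoint by simp
qed

lemma P_adjoint: "mat_adjoint P = P"
proof (rule eq_mat_on_vectors)
  fix v :: "complex Matrix.vec" assume v: "v \<in> carrier_vec m"
  have Pv: "P *\<^sub>v v \<in> carrier_vec m" using P v by simp
  have Pav: "mat_adjoint P *\<^sub>v v \<in> carrier_vec m" using mat_adjoint_carrier[OF P] v by simp
  have "w \<bullet>c (mat_adjoint P *\<^sub>v v) = w \<bullet>c (P *\<^sub>v v)" if w: "w \<in> carrier_vec m" for w
  proof -
    have Pw: "P *\<^sub>v w \<in> carrier_vec m" using P w by simp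
    have "cnj ((P *\<^sub>v w) \<bullet>c (v - P *\<^sub>v v)) = 0"
      using P_props(2)[OF w] P_props(3)[OF v] by (auto simp: D_iff)
    then have 1: "(P *\<^sub>v w) \<bullet>c v = (P *\<^sub>v w) \<bullet>c (P *\<^sub>v v)"
      using cinner_diff_right[OF Pw v Pv] by simp
    have "(P *\<^sub>v v) \<bullet>c (w - P *\<^sub>v w) = 0"
      using P_props(2)[OF v] P_props(3)[OF w] by (auto simp: D_iff)
    then have "cnj ((P *\<^sub>v v) \<bullet>c w) = cnj ((P *\<^sub>v v) \<bullet>c (P *\<^sub>v w))"
      using cinner_diff_right[OF Pv w Pw] by simp
    then have 2: "w \<bullet>c (P *\<^sub>v v) = (P *\<^sub>v w) \<bullet>c (P *\<^sub>v v)"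
      using cinner_cnj[OF Pv w w] cinner_cnj[OF Pv Pw Pw] by simp
    show ?thesis using cinner_adjoint[OF P w v] 1 2 by simp
  qed
  from this[of "mat_adjoint P *\<^sub>v v - P *\<^sub>v v"]
  have "(mat_adjoint P *\<^sub>v v - P *\<^sub>v v) \<bullet>c (mat_adjoint P *\<^sub>v v - P *\<^sub>v v) = 0"
    using Pav Pv cinner_diff_right[of "mat_adjoint P *\<^sub>v v - P *\<^sub>v v" m "mat_adjoint P *\<^sub>v v" "P *\<^sub>v v"] by simp
  then have "mat_adjoint P *\<^sub>v v - P *\<^sub>v v = 0\<^sub>v m" using Pav Pv by (intro cinner_self_eq_0) auto
  then show "mat_adjoint P *\<^sub>v v = P *\<^sub>v v" by (rule vec_diff_eq_0D[OF Pav Pv])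
qed (use P in auto)

lemma mult_P_right:
  assumes M: "M \<in> carrier_mat r m" and ker: "\<And>u. u \<in> U \<Longrightarrow> M *\<^sub>v u = 0\<^sub>v r"
  shows "M * P = M"
proof (rule eq_mat_on_vectors)
  fix v :: "complex Matrix.vec" assume v: "v \<in> carrier_vec m"
  have Pv: "P *\<^sub>v v \<in> carrier_vec m" using P v by simp
  have "M *\<^sub>v v - M *\<^sub>v (P *\<^sub>v v) = 0\<^sub>v r"
    using ker[OF P_props(3)[OF v]] mult_minus_distrib_mat_vec[OF M v Pv] by simp
  then have "M *\<^sub>v v = M *\<^sub>v (P *\<^sub>v v)"
    by (rule vec_diff_eq_0D[rotated 2]) (use M v Pv in auto)
  then show "M * P *\<^sub>v v = M *\<^sub>v v" using assoc_mult_mat_vec[OF M P v] by simp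
qed (use M P in auto)

lemma P_A: "P * A = A"
proof (rule eq_mat_on_vectors)
  fix v :: "complex Matrix.vec" assume v: "v \<in> carrier_vec m"
  show "P * A *\<^sub>v v = A *\<^sub>v v"
    using assoc_mult_mat_vec[OF P A v] P_on_D[OF A_in_D[OF v]] by simp
qed (use P A in auto)

text \<open>An eigenvector of \<open>P * B\<close> with nonzero eigenvalue lies in \<open>D\<close>,
  where \<open>P * B\<close> acts as \<open>B\<close>. The isometry condition gives modulus at most
  1, and modulus 1 would put the eigenvector into \<open>U\<close> as well. The rate belongs to the
  given momentum; it serves for convergence and uniqueness, not for the uniform bound.\<close>

lemma damped_powers_decay:
  obtains C r where "0 < r" "r < 1"
    "\<And>j a b. a < m \<Longrightarrow> b < m \<Longrightarrow> cmod (((P * B) ^\<^sub>m j) $$ (a, b)) \<le> C * r ^ j"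
proof (rule matrix_powers_decay)
  show PB: "P * B \<in> carrier_mat m m" using P B by simp
  fix c assume "eigenvalue (P * B) c"
  then obtain v where v: "v \<in> carrier_vec m" "v \<noteq> 0\<^sub>v m" "P * B *\<^sub>v v = c \<cdot>\<^sub>v v"
    using P B unfolding eigenvalue_def eigenvector_def by auto
  show "cmod c < 1"
  proof (cases "c = 0")
    case False
    have "c \<cdot>\<^sub>v v \<in> D"
      using v(3) P_props(2)[of "B *\<^sub>v v"] assoc_mult_mat_vec[OF P B v(1)] B v(1) by simp
    then have "(1 / c) \<cdot>\<^sub>v (c \<cdot>\<^sub>v v) \<in> D" using D_subspace unfolding linear_subspace_def by blast
    then have vD: "v \<in> D" using False by (simp add: smult_smult_assoc)
    have "B *\<^sub>v v = P * B *\<^sub>v v"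
      using P_on_D[OF D_closed[OF vD]] assoc_mult_mat_vec[OF P B v(1)] by simp
    then have Bv: "B *\<^sub>v v = c \<cdot>\<^sub>v v" using v(3) by simp
    have "v \<bullet>c v \<noteq> 0" using cinner_self_eq_0[OF v(1)] v(2) by blast
    then have norm_pos: "(l2_norm_vec v)\<^sup>2 > 0" by (simp add: cinner_self del: conjugate_square_eq_0_vec)
    have "complex_of_real ((l2_norm_vec (B *\<^sub>v v))\<^sup>2) = complex_of_real ((cmod c)\<^sup>2 * (l2_norm_vec v)\<^sup>2)"
      unfolding cinner_self[symmetric] Bv of_real_mult using v(1)
      by (simp add: cinner_smult_left[of v m] cinner_smult_right[of _ m v] complex_norm_square mult_ac
          del: of_real_power)
    then have "(l2_norm_vec (B *\<^sub>v v))\<^sup>2 = (cmod c)\<^sup>2 * (l2_norm_vec v)\<^sup>2"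
      by (simp only: of_real_eq_iff)
    moreover have "(l2_norm_vec (B *\<^sub>v v))\<^sup>2 \<le> (l2_norm_vec v)\<^sup>2"
      using isometric[OF v(1)] zero_le_power2[of "l2_norm_vec (BP *\<^sub>v v)"] by linarith
    ultimately have "(cmod c)\<^sup>2 * (l2_norm_vec v)\<^sup>2 \<le> 1 * (l2_norm_vec v)\<^sup>2" by simp
    then have "(cmod c)\<^sup>2 \<le> 1" using norm_pos by (simp only: mult_le_cancel_right_pos)
    then have "cmod c \<le> 1" by (simp add: power_le_one_iff)
    moreover have "cmod c \<noteq> 1"
    proof
      assume "cmod c = 1"
      moreover have "eigenvector B v c" using v(1,2) Bv B unfolding eigenvector_def by auto
      ultimately have "v \<in> U" by (rule undamped_eigenvector_in_U)
      then show False using D_U_disjoint[OF vD] v(2) by simp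
    qed
    ultimately show ?thesis by simp
  qed simp
qed (use that in blast)

text \<open>The undamped space is invariant under \<open>B\<close> and annihilated by \<open>BP\<close>.\<close>

lemma BP_damped_power: "BP * (P * B) ^\<^sub>m j = BP * B ^\<^sub>m j"
proof (induction j)
  case 0
  then show ?case using P B by simp
next
  case (Suc j)
  have Bj: "B ^\<^sub>m j \<in> carrier_mat m m" using B by simp
  have PBj: "(P * B) ^\<^sub>m j \<in> carrier_mat m m" using P B by simp
  have kill: "BP * B ^\<^sub>m j *\<^sub>v u = 0\<^sub>v p" if "u \<in> U" for u
  proof -
    have "B ^\<^sub>m i *\<^sub>v u \<in> U" if "u \<in> U" for i u
      using that
    proof (induction i arbitrary: u)
      case 0
      then show ?case using U_carrier B by simp
    next
      case (Suc i)
      have "B ^\<^sub>m Suc i *\<^sub>v u = B ^\<^sub>m i *\<^sub>v (B *\<^sub>v u)"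
        using assoc_mult_mat_vec[OF pow_carrier_mat[OF B] B U_carrier[OF Suc.prems], of i] by simp
      then show ?case using Suc.IH[OF U_closed(3)[OF Suc.prems]] by simp
    qed
    from U_closed(1)[OF this[OF that]] show ?thesis
      using assoc_mult_mat_vec[OF BP Bj U_carrier[OF that]] by simp
  qed
  have "BP * (P * B) ^\<^sub>m Suc j = BP * (P * B) ^\<^sub>m j * (P * B)"
    using assoc_mult_mat[OF BP PBj, of "P * B" m] P B by simp
  also have "\<dots> = BP * B ^\<^sub>m j * P * B"
    unfolding Suc by (rule assoc_mult_mat[OF mult_carrier_mat[OF BP Bj] P B, symmetric])
  also have "BP * B ^\<^sub>m j * P = BP * B ^\<^sub>m j"
    using BP Bj kill by (intro mult_P_right) auto
  also have "BP * B ^\<^sub>m j * B = BP * B ^\<^sub>m Suc j"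
    using assoc_mult_mat[OF BP Bj B] by simp
  finally show ?case .
qed

text \<open>Neumann series of the steady-state equation, formed entrywise.\<close>

definition X :: "complex mat" where
  "X = mat m m (\<lambda>ab. \<Sum>j. ((P * B) ^\<^sub>m j * A * mat_adjoint ((P * B) ^\<^sub>m j)) $$ ab)"

lemma X_sums:
  assumes "a < m" "b < m"
  shows "(\<lambda>j. ((P * B) ^\<^sub>m j * A * mat_adjoint ((P * B) ^\<^sub>m j)) $$ (a, b)) sums (X $$ (a, b))"
proof -
  obtain C r where Cr: "0 < r" "r < 1"
    "\<And>j a b. a < m \<Longrightarrow> b < m \<Longrightarrow> cmod (((P * B) ^\<^sub>m j) $$ (a, b)) \<le> C * r ^ j"
    by (rule damped_powers_decay) (rule that; assumption)
  have PB: "P * B \<in> carrier_mat m m" using P B by simp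
  have "norm (r ^ 2) < 1" using Cr(1,2) by (simp add: abs_square_less_1)
  then have "summable (\<lambda>j. (\<Sum>s<m. \<Sum>t<m. C * cmod (A $$ (s, t)) * C) * (r ^ 2) ^ j)"
    by (intro summable_mult summable_geometric)
  then have "summable (\<lambda>j. ((P * B) ^\<^sub>m j * A * mat_adjoint ((P * B) ^\<^sub>m j)) $$ (a, b))"
    by (rule summable_comparison_test'[where N = 0])
      (rule sandwich_power_bound[OF PB A Cr(3,1) assms])
  then show ?thesis
    unfolding X_def using assms by (simp only: index_mat prod.case summable_sums)
qed

lemma X_carrier: "X \<in> carrier_mat m m" by (simp add: X_def)

lemma damped_adjoint: "mat_adjoint (P * B) = mat_adjoint B * P"
  by (simp add: mat_adjoint_mult[OF P B] P_adjoint)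

lemma damped_equation_iff:
  assumes "Y \<in> carrier_mat m m"
  shows "P * A + P * B * Y * mat_adjoint B * P = A + (P * B) * Y * mat_adjoint (P * B)"
  using assoc_mult_mat[of "P * B * Y" m m "mat_adjoint B" m P m] P B B_adj assms
  by (simp add: P_A damped_adjoint)

text \<open>Conjugating the series termwise by \<open>P * B\<close> shifts it by one index; the
  missing zeroth term is \<open>A\<close>.\<close>

lemma X_fixed_point: "X = A + (P * B) * X * mat_adjoint (P * B)"
proof (rule eq_matI)
  have PB: "P * B \<in> carrier_mat m m" using P B by simp
  define F where "F j = (P * B) ^\<^sub>m j * A * mat_adjoint ((P * B) ^\<^sub>m j)" for j
  have F: "F j \<in> carrier_mat m m" for j
    unfolding F_def using pow_carrier_mat[OF PB] A by (rule mult_sandwich_carrier)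
  fix a b assume "a < dim_row (A + (P * B) * X * mat_adjoint (P * B))"
    "b < dim_col (A + (P * B) * X * mat_adjoint (P * B))"
  then have ab: "a < m" "b < m" using P B by auto
  have "(\<lambda>j. ((P * B) * F j * mat_adjoint (P * B)) $$ (a, b)) sums (((P * B) * X * mat_adjoint (P * B)) $$ (a, b))"
    using X_sums[folded F_def] by (intro sums_sandwich[OF PB mat_adjoint_carrier[OF PB] X_carrier F _ ab])
  then have "(\<lambda>j. F (Suc j) $$ (a, b)) sums (((P * B) * X * mat_adjoint (P * B)) $$ (a, b))"
    by (simp only: F_def power_sandwich_Suc(1)[OF PB A])
  moreover have "F 0 $$ (a, b) = A $$ (a, b)"
  proof -
    have "mat_adjoint (1\<^sub>m m) = (1\<^sub>m m :: complex mat)" by (intro eq_matI) auto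
    then show ?thesis using A P B by (simp add: F_def)
  qed
  ultimately have "(\<lambda>j. F j $$ (a, b)) sums (((P * B) * X * mat_adjoint (P * B)) $$ (a, b) + A $$ (a, b))"
    by (subst (asm) sums_Suc_iff) simp
  then have "X $$ (a, b) = ((P * B) * X * mat_adjoint (P * B)) $$ (a, b) + A $$ (a, b)"
    using X_sums[OF ab, folded F_def] sums_unique2 by blast
  then show "X $$ (a, b) = (A + (P * B) * X * mat_adjoint (P * B)) $$ (a, b)"
    using ab P B by (simp add: add.commute)
qed (use P B X_carrier in auto)

text \<open>The difference of two solutions is fixed by conjugation with \<open>P * B\<close>, hence
  with all its powers, and these tend to 0.\<close>

lemma damped_fixed_point_unique:
  assumes Y: "Y \<in> carrier_mat m m" "Y = A + (P * B) * Y * mat_adjoint (P * B)"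
  shows "Y = X"
proof -
  have PB: "P * B \<in> carrier_mat m m" using P B by simp
  note PBa = mat_adjoint_carrier[OF PB]
  define Z where "Z = Y - X"
  have Z: "Z \<in> carrier_mat m m" unfolding Z_def by (rule minus_carrier_mat[OF X_carrier])
  have fixed: "Z = (P * B) * Z * mat_adjoint (P * B)"
  proof (rule eq_matI)
    fix a b assume "a < dim_row ((P * B) * Z * mat_adjoint (P * B))"
      "b < dim_col ((P * B) * Z * mat_adjoint (P * B))"
    then have ab: "a < m" "b < m" using P B by auto
    have "Z $$ (a, b) = Y $$ (a, b) - X $$ (a, b)" using ab Y(1) X_carrier by (simp add: Z_def)
    also have "\<dots> = ((P * B) * Y * mat_adjoint (P * B)) $$ (a, b) - ((P * B) * X * mat_adjoint (P * B)) $$ (a, b)"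
      using arg_cong[OF Y(2), of "\<lambda>M. M $$ (a, b)"] arg_cong[OF X_fixed_point, of "\<lambda>M. M $$ (a, b)"] ab A P B
      by (simp del: index_mult_mat(1))
    also have "\<dots> = ((P * B) * Z * mat_adjoint (P * B)) $$ (a, b)"
      unfolding index_mult3_mat_sum[OF PB Y(1) PBa ab] index_mult3_mat_sum[OF PB X_carrier PBa ab]
        index_mult3_mat_sum[OF PB Z PBa ab] sum_subtractf[symmetric]
      using Y(1) X_carrier by (intro sum.cong refl) (simp add: Z_def left_diff_distrib right_diff_distrib del: index_mult_mat(1))
    finally show "Z $$ (a, b) = ((P * B) * Z * mat_adjoint (P * B)) $$ (a, b)" .
  qed (use P B Z in auto)
  have iter: "Z = (P * B) ^\<^sub>m j * Z * mat_adjoint ((P * B) ^\<^sub>m j)" for j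
  proof (induction j)
    case 0
    have "mat_adjoint (1\<^sub>m m) = (1\<^sub>m m :: complex mat)" by (intro eq_matI) auto
    then show ?case using Z P B by simp
  next
    case (Suc j)
    show ?case unfolding power_sandwich_Suc(2)[OF PB Z] fixed[symmetric] by (rule Suc)
  qed
  obtain C r where Cr: "0 < r" "r < 1"
    "\<And>j a b. a < m \<Longrightarrow> b < m \<Longrightarrow> cmod (((P * B) ^\<^sub>m j) $$ (a, b)) \<le> C * r ^ j"
    by (rule damped_powers_decay) (rule that; assumption)
  have "Z $$ (a, b) = 0" if ab: "a < m" "b < m" for a b
  proof -
    define K where "K = (\<Sum>s<m. \<Sum>t<m. C * cmod (Z $$ (s, t)) * C)"
    have "cmod (Z $$ (a, b)) \<le> K * (r ^ 2) ^ j" for j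
      using sandwich_power_bound[OF PB Z Cr(3,1) ab, of j] unfolding iter[symmetric] K_def .
    moreover have "(\<lambda>j. K * (r ^ 2) ^ j) \<longlonglongrightarrow> K * 0"
      using Cr(1,2) by (intro tendsto_mult tendsto_const LIMSEQ_power_zero) (use Cr(1,2) in \<open>simp add: abs_square_less_1\<close>)
    ultimately have "cmod (Z $$ (a, b)) \<le> K * 0"
      by (intro LIMSEQ_le_const[of "\<lambda>j. K * (r ^ 2) ^ j"]) auto
    then show ?thesis by simp
  qed
  then show ?thesis
    using Y(1) X_carrier by (intro eq_matI) (auto simp: Z_def)
qed

text \<open>The two side conditions follow from the fixed-point equation: both of its summands have
  range in \<open>D\<close>, and both annihilate \<open>U\<close> because \<open>A\<close> and
  \<open>P\<close> do.\<close>

lemma steady_state_eq: "steady_state m A B = X"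
  unfolding steady_state_def Let_def P_def[symmetric]
proof (rule the_equality, intro conjI ballI X_carrier)
  have PB: "P * B \<in> carrier_mat m m" using P B by simp
  note PBa = mat_adjoint_carrier[OF PB]
  have zero: "M *\<^sub>v 0\<^sub>v m = 0\<^sub>v m" if "M \<in> carrier_mat m m" for M :: "complex mat"
    using that by (intro eq_vecI) auto
  have act: "X *\<^sub>v v = A *\<^sub>v v + P *\<^sub>v (B *\<^sub>v (X *\<^sub>v (mat_adjoint B *\<^sub>v (P *\<^sub>v v))))"
    if v: "v \<in> carrier_vec m" for v
  proof -
    have 1: "P *\<^sub>v v \<in> carrier_vec m" using P v by simp
    then have 2: "mat_adjoint B *\<^sub>v (P *\<^sub>v v) \<in> carrier_vec m" using B_adj by simp
    then have 3: "X *\<^sub>v (mat_adjoint B *\<^sub>v (P *\<^sub>v v)) \<in> carrier_vec m" using X_carrier by simp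
    have "X *\<^sub>v v = A *\<^sub>v v + (P * B) * X * mat_adjoint (P * B) *\<^sub>v v"
      by (subst X_fixed_point, rule add_mult_distrib_mat_vec[OF A _ v]) (rule mult_sandwich_carrier[OF PB X_carrier])
    also have "(P * B) * X * mat_adjoint (P * B) *\<^sub>v v = (P * B) * X *\<^sub>v (mat_adjoint (P * B) *\<^sub>v v)"
      by (rule assoc_mult_mat_vec[OF mult_carrier_mat[OF PB X_carrier] PBa v])
    also have "mat_adjoint (P * B) *\<^sub>v v = mat_adjoint B *\<^sub>v (P *\<^sub>v v)"
      unfolding damped_adjoint by (rule assoc_mult_mat_vec[OF B_adj P v])
    also have "(P * B) * X *\<^sub>v (mat_adjoint B *\<^sub>v (P *\<^sub>v v)) = (P * B) *\<^sub>v (X *\<^sub>v (mat_adjoint B *\<^sub>v (P *\<^sub>v v)))"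
      by (rule assoc_mult_mat_vec[OF PB X_carrier 2])
    also have "\<dots> = P *\<^sub>v (B *\<^sub>v (X *\<^sub>v (mat_adjoint B *\<^sub>v (P *\<^sub>v v))))"
      by (rule assoc_mult_mat_vec[OF P B 3])
    finally show ?thesis .
  qed
  show "X *\<^sub>v v \<in> D" if "v \<in> D" for v
  proof -
    have v: "v \<in> carrier_vec m" using that by (simp add: D_iff)
    have "B *\<^sub>v (X *\<^sub>v (mat_adjoint B *\<^sub>v (P *\<^sub>v v))) \<in> carrier_vec m"
      using B by (intro carrier_vecI) simp
    then show ?thesis
      unfolding act[OF v] using A_in_D[OF v] P_props(2) D_subspace unfolding linear_subspace_def by blast
  qed
  show "X *\<^sub>v u = 0\<^sub>v m" if "u \<in> U" for u
    unfolding act[OF U_carrier[OF that]] P_on_U[OF that] U_closed(2)[OF that]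
    by (simp add: zero[OF B_adj] zero[OF X_carrier] zero[OF B] zero[OF P])
  show "X = P * A + P * B * X * mat_adjoint B * P"
    unfolding damped_equation_iff[OF X_carrier] by (rule X_fixed_point)
next
  fix Y assume Y: "Y \<in> carrier_mat m m \<and> (\<forall>v\<in>D. Y *\<^sub>v v \<in> D) \<and> (\<forall>v\<in>U. Y *\<^sub>v v = 0\<^sub>v m) \<and>
    Y = P * A + P * B * Y * mat_adjoint B * P"
  then show "Y = X"
    using damped_equation_iff[of Y] by (intro damped_fixed_point_unique) auto
qed

text \<open>The terms contain plain powers of \<open>B\<close> in place of \<open>P * B\<close>, so
  each single term depends holomorphically on the momentum although \<open>P\<close> may
  not.\<close>

lemma steady_state_physical_sums:
  assumes "a < p" "b < p"
  shows "(\<lambda>j. ((BP * B ^\<^sub>m j) * A * mat_adjoint (BP * B ^\<^sub>m j)) $$ (a, b)) sums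
    ((BP * steady_state m A B * mat_adjoint BP) $$ (a, b))"
proof -
  have PB: "P * B \<in> carrier_mat m m" using P B by simp
  note BPa = mat_adjoint_carrier[OF BP]
  have eq: "BP * ((P * B) ^\<^sub>m j * A * mat_adjoint ((P * B) ^\<^sub>m j)) * mat_adjoint BP
      = (BP * B ^\<^sub>m j) * A * mat_adjoint (BP * B ^\<^sub>m j)" for j
    using mult_sandwich[OF BP pow_carrier_mat[OF PB] A, of j] by (simp only: BP_damped_power)
  have F: "(P * B) ^\<^sub>m j * A * mat_adjoint ((P * B) ^\<^sub>m j) \<in> carrier_mat m m" for j
    using pow_carrier_mat[OF PB] A by (rule mult_sandwich_carrier)
  show ?thesis
    using sums_sandwich[OF BP BPa X_carrier F X_sums assms] unfolding eq steady_state_eq .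
qed

text \<open>With \<open>v j = B\<^sup>j e\<^sub>s\<close>, the isometry condition says that the
  squared norm of \<open>BP (v j)\<close> is the squared norm of \<open>v j\<close> minus that of
  \<open>v (Suc j)\<close>. The sum telescopes and is at most the squared norm of the unit vector
  \<open>v 0\<close>. The Gramian of control theory behind this gives the name.\<close>

lemma observability_bound:
  assumes a: "a < p" and s: "s < m"
  shows "(\<Sum>j<J. (cmod ((BP * B ^\<^sub>m j) $$ (a, s)))\<^sup>2) \<le> 1"
proof -
  define v where "v j = B ^\<^sub>m j *\<^sub>v unit_vec m s" for j
  have Bj: "B ^\<^sub>m j \<in> carrier_mat m m" for j using B by simp
  have v: "v j \<in> carrier_vec m" for j unfolding v_def using Bj[of j] by simp
  have step: "v (Suc j) = B *\<^sub>v v j" for j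
    using assoc_mult_mat_vec[OF B Bj unit_vec_carrier, of j s] pow_mat_commute[OF B, of j]
    by (simp add: v_def)
  have entry: "(cmod ((BP * B ^\<^sub>m j) $$ (a, s)))\<^sup>2 \<le> (l2_norm_vec (BP *\<^sub>v v j))\<^sup>2" for j
  proof -
    have "K $$ (a, s) = (K *\<^sub>v unit_vec m s) $ a" if "K \<in> carrier_mat p m" for K :: "complex mat"
      using a s that by simp
    from this[OF mult_carrier_mat[OF BP Bj]]
    have "(BP * B ^\<^sub>m j) $$ (a, s) = (BP * B ^\<^sub>m j *\<^sub>v unit_vec m s) $ a" .
    also have "BP * B ^\<^sub>m j *\<^sub>v unit_vec m s = BP *\<^sub>v v j"
      unfolding v_def by (rule assoc_mult_mat_vec[OF BP Bj]) simp
    finally have eq: "(BP * B ^\<^sub>m j) $$ (a, s) = (BP *\<^sub>v v j) $ a" .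
    have "(cmod ((BP *\<^sub>v v j) $ a))\<^sup>2 \<le> (\<Sum>i<dim_vec (BP *\<^sub>v v j). (cmod ((BP *\<^sub>v v j) $ i))\<^sup>2)"
      using a BP by (intro member_le_sum) auto
    then show ?thesis unfolding eq l2_norm_vec_def by (simp add: sum_nonneg)
  qed
  have "(\<Sum>j<J. (l2_norm_vec (BP *\<^sub>v v j))\<^sup>2) = (l2_norm_vec (v 0))\<^sup>2 - (l2_norm_vec (v J))\<^sup>2"
  proof (induction J)
    case (Suc J)
    then show ?case using isometric[OF v, of J] by (simp add: step)
  qed simp
  moreover have "(l2_norm_vec (v 0))\<^sup>2 = 1"
  proof -
    have "v 0 = unit_vec m s" using B by (simp add: v_def)
    moreover have "(\<Sum>i<m. (cmod (unit_vec m s $ i))\<^sup>2) = (\<Sum>i<m. if i = s then 1 else 0)"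
      using s by (intro sum.cong) auto
    ultimately show ?thesis using s by (simp add: l2_norm_vec_def)
  qed
  ultimately have "(\<Sum>j<J. (l2_norm_vec (BP *\<^sub>v v j))\<^sup>2) \<le> 1" by simp
  then show ?thesis using sum_mono[of "{..<J}", OF entry] by (rule order_trans[rotated])
qed

text \<open>The entries of \<open>A\<close> do not depend on \<open>j\<close> and can be taken out
  of the series; what remains is controlled by the observability bound. The resulting estimate
  contains no decay rate, so it stays finite where the spectral gap closes.\<close>

lemma steady_state_physical_bound:
  assumes ab: "a < p" "b < p"
  shows "cmod ((BP * steady_state m A B * mat_adjoint BP) $$ (a, b)) \<le> (\<Sum>s<m. \<Sum>t<m. cmod (A $$ (s, t)))"
proof -
  define C where "C j = BP * B ^\<^sub>m j" for j
  have C: "C j \<in> carrier_mat p m" for j unfolding C_def by (rule mult_carrier_mat[OF BP pow_carrier_mat[OF B]])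
  have partial: "cmod (\<Sum>j<J. (C j * A * mat_adjoint (C j)) $$ (a, b)) \<le> (\<Sum>s<m. \<Sum>t<m. cmod (A $$ (s, t)))" for J
  proof -
    have "cmod (\<Sum>j<J. (C j * A * mat_adjoint (C j)) $$ (a, b))
        \<le> (\<Sum>j<J. \<Sum>s<m. \<Sum>t<m. cmod (A $$ (s, t)) * (cmod (C j $$ (a, s)) * cmod (C j $$ (b, t))))"
    proof (rule order_trans[OF norm_sum sum_mono])
      fix j
      have "cmod ((C j * A * mat_adjoint (C j)) $$ (a, b))
          \<le> (\<Sum>s<m. \<Sum>t<m. cmod (C j $$ (a, s) * A $$ (s, t) * mat_adjoint (C j) $$ (t, b)))"
        unfolding index_mult3_mat_sum[OF C A mat_adjoint_carrier[OF C] ab]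
        by (rule order_trans[OF norm_sum sum_mono[OF norm_sum]])
      also have "\<dots> = (\<Sum>s<m. \<Sum>t<m. cmod (A $$ (s, t)) * (cmod (C j $$ (a, s)) * cmod (C j $$ (b, t))))"
        using ab carrier_matD[OF C, of j] by (simp add: norm_mult mult_ac)
      finally show "cmod ((C j * A * mat_adjoint (C j)) $$ (a, b))
          \<le> (\<Sum>s<m. \<Sum>t<m. cmod (A $$ (s, t)) * (cmod (C j $$ (a, s)) * cmod (C j $$ (b, t))))" .
    qed
    also have "\<dots> = (\<Sum>s<m. \<Sum>t<m. cmod (A $$ (s, t)) * (\<Sum>j<J. cmod (C j $$ (a, s)) * cmod (C j $$ (b, t))))"
      unfolding sum_distrib_left by (subst sum.swap, rule sum.cong[OF refl], rule sum.swap)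
    also have "\<dots> \<le> (\<Sum>s<m. \<Sum>t<m. cmod (A $$ (s, t)) * 1)"
    proof (intro sum_mono mult_left_mono)
      fix s t assume "s \<in> {..<m}" "t \<in> {..<m}"
      then have st: "s < m" "t < m" by auto
      \<comment> \<open>The arithmetic-geometric mean inequality takes the place of Cauchy-Schwarz:
        each of the two sums of squares is at most 1.\<close>
      have "2 * (x * y) \<le> x\<^sup>2 + y\<^sup>2" for x y :: real
        using sum_squares_bound[of x y] by simp
      then have "(\<Sum>j<J. 2 * (cmod (C j $$ (a, s)) * cmod (C j $$ (b, t))))
          \<le> (\<Sum>j<J. (cmod (C j $$ (a, s)))\<^sup>2 + (cmod (C j $$ (b, t)))\<^sup>2)"
        by (intro sum_mono)
      also have "\<dots> \<le> 1 + 1"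
        unfolding sum.distrib C_def by (intro add_mono observability_bound ab st)
      finally show "(\<Sum>j<J. cmod (C j $$ (a, s)) * cmod (C j $$ (b, t))) \<le> 1"
        by (simp add: sum_distrib_left[symmetric])
    qed simp
    finally show ?thesis by simp
  qed
  have "(\<lambda>J. cmod (\<Sum>j<J. (C j * A * mat_adjoint (C j)) $$ (a, b)))
      \<longlonglongrightarrow> cmod ((BP * steady_state m A B * mat_adjoint BP) $$ (a, b))"
    using steady_state_physical_sums[OF ab] unfolding sums_def C_def by (rule tendsto_norm)
  then show ?thesis by (rule LIMSEQ_le_const2) (use partial in blast)
qed

end

section \<open>Gaussian isometries as channels\<close>

lemma sum_lessThan_add:
  fixes f :: "nat \<Rightarrow> 'a :: comm_monoid_add"
  shows "(\<Sum>r<a + b. f r) = (\<Sum>r<a. f r) + (\<Sum>r<b. f (a + r))"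
  by (induction b) (simp_all add: add.assoc)

lemma gaussian_isometry_carrier:
  assumes "gaussian_isometry p m g"
  shows "blk_AP g \<in> carrier_mat p p" "blk_APV g \<in> carrier_mat p m" "blk_A g \<in> carrier_mat m m"
    "blk_BP g \<in> carrier_mat p m" "blk_B g \<in> carrier_mat m m"
  using assms by (auto simp: gaussian_isometry_def)

text \<open>These are diagonal blocks of \<open>\<Lambda>\<^sup>T \<Lambda> = 1\<close>: the last
  block column gives the first identity, the middle one the second. In the second the contribution
  of \<open>B\<close> has its indices exchanged, because the bottom row of \<open>\<Lambda>\<close>
  carries the transpose.\<close>

lemma gaussian_isometry_columns:
  assumes g: "gaussian_isometry p m g" and ij: "i < m" "j < m"
  shows "(\<Sum>r<p. blk_BP g $$ (r, i) * blk_BP g $$ (r, j)) + (\<Sum>r<m. blk_B g $$ (r, i) * blk_B g $$ (r, j))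
      = (if i = j then 1 else 0)"
    and "(\<Sum>r<p. blk_APV g $$ (r, i) * blk_APV g $$ (r, j)) + (\<Sum>r<m. blk_A g $$ (r, i) * blk_A g $$ (r, j))
        + (\<Sum>r<m. blk_B g $$ (i, r) * blk_B g $$ (j, r)) = (if i = j then 1 else 0)"
proof -
  note c [simp] = gaussian_isometry_carrier[OF g]
  note d [simp] = c[THEN carrier_matD(1)] c[THEN carrier_matD(2)]
  define L where "L = lambda_mat g"
  have L: "L \<in> carrier_mat (p + m + m) (p + m + m)"
    by (rule carrier_matI) (simp_all add: L_def lambda_mat_def append_rows_def)
  have LL: "transpose_mat L * L = 1\<^sub>m (p + m + m)"
    using g by (simp add: gaussian_isometry_def L_def)
  have prod: "(\<Sum>r<p. L $$ (r, x) * L $$ (r, y)) + (\<Sum>r<m. L $$ (p + r, x) * L $$ (p + r, y))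
      + (\<Sum>r<m. L $$ (p + m + r, x) * L $$ (p + m + r, y)) = (if x = y then 1 else 0)"
    if xy: "x < p + m + m" "y < p + m + m" for x y
  proof -
    have "(transpose_mat L * L) $$ (x, y) = (\<Sum>r<p + m + m. L $$ (r, x) * L $$ (r, y))"
      using xy carrier_matD[OF L] by (subst index_mult_mat_sum[OF _ L]) auto
    then show ?thesis using xy unfolding LL sum_lessThan_add by simp
  qed
  \<comment> \<open>\<open>E\<close>, \<open>F\<close>, \<open>G\<close> are the entries of the last
    block column from top to bottom, \<open>H\<close>, \<open>I\<close>, \<open>J\<close> those of
    the middle one.\<close>
  have E: "L $$ (r, p + m + i) = blk_BP g $$ (r, i)" if "r < p" "i < m" for r i
    using that by (simp add: L_def lambda_mat_def append_rows_def)
  have F: "L $$ (p + r, p + m + i) = blk_B g $$ (r, i)" if "r < m" "i < m" for r i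
    using that by (simp add: L_def lambda_mat_def append_rows_def)
  have G: "L $$ (p + m + r, p + m + i) = 0" if "r < m" "i < m" for r i
    using that by (simp add: L_def lambda_mat_def append_rows_def)
  have H: "L $$ (r, p + i) = blk_APV g $$ (r, i)" if "r < p" "i < m" for r i
    using that by (simp add: L_def lambda_mat_def append_rows_def)
  have I: "L $$ (p + r, p + i) = blk_A g $$ (r, i)" if "r < m" "i < m" for r i
    using that by (simp add: L_def lambda_mat_def append_rows_def)
  have J: "L $$ (p + m + r, p + i) = - blk_B g $$ (i, r)" if "r < m" "i < m" for r i
    using that by (simp add: L_def lambda_mat_def append_rows_def)
  show "(\<Sum>r<p. blk_BP g $$ (r, i) * blk_BP g $$ (r, j)) + (\<Sum>r<m. blk_B g $$ (r, i) * blk_B g $$ (r, j))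
      = (if i = j then 1 else 0)"
    using prod[of "p + m + i" "p + m + j"] ij by (simp add: E F G)
  show "(\<Sum>r<p. blk_APV g $$ (r, i) * blk_APV g $$ (r, j)) + (\<Sum>r<m. blk_A g $$ (r, i) * blk_A g $$ (r, j))
        + (\<Sum>r<m. blk_B g $$ (i, r) * blk_B g $$ (j, r)) = (if i = j then 1 else 0)"
    using prod[of "p + i" "p + j"] ij by (simp add: H I J)
qed

lemma l2_norm_vec_mult:
  assumes M: "M \<in> carrier_mat r m" and v: "v \<in> carrier_vec m"
  shows "complex_of_real ((l2_norm_vec (M *\<^sub>v v))\<^sup>2) = v \<bullet>c (mat_adjoint M * M *\<^sub>v v)"
  unfolding cinner_self[symmetric] using M v
  by (subst cinner_adjoint[OF M v]) (auto simp: assoc_mult_mat_vec[OF mat_adjoint_carrier[OF M] M v])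

text \<open>Three stacked blocks cover both column identities; for the one with only two blocks, the
  third is a matrix without rows.\<close>

lemma l2_norm_vec_isometry:
  assumes "K \<in> carrier_mat a m" "L \<in> carrier_mat b m" "M \<in> carrier_mat c m"
    and iso: "mat_adjoint K * K + mat_adjoint L * L + mat_adjoint M * M = 1\<^sub>m m"
    and v: "v \<in> carrier_vec m"
  shows "(l2_norm_vec (K *\<^sub>v v))\<^sup>2 + (l2_norm_vec (L *\<^sub>v v))\<^sup>2 + (l2_norm_vec (M *\<^sub>v v))\<^sup>2 = (l2_norm_vec v)\<^sup>2"
proof -
  note adj = assms(1-3)[THEN mat_adjoint_carrier]
  have c: "mat_adjoint K * K \<in> carrier_mat m m" "mat_adjoint L * L \<in> carrier_mat m m"
    "mat_adjoint M * M \<in> carrier_mat m m"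
    using adj assms(1-3) by (auto intro: mult_carrier_mat)
  have cv: "mat_adjoint K * K *\<^sub>v v \<in> carrier_vec m" "mat_adjoint L * L *\<^sub>v v \<in> carrier_vec m"
    "mat_adjoint M * M *\<^sub>v v \<in> carrier_vec m"
    using c v by (auto intro: mult_mat_vec_carrier)
  have "v = (mat_adjoint K * K + mat_adjoint L * L + mat_adjoint M * M) *\<^sub>v v"
    unfolding iso using v by simp
  also have "\<dots> = mat_adjoint K * K *\<^sub>v v + mat_adjoint L * L *\<^sub>v v + mat_adjoint M * M *\<^sub>v v"
    using add_mult_distrib_mat_vec[OF _ c(3) v, of "mat_adjoint K * K + mat_adjoint L * L"]
      add_mult_distrib_mat_vec[OF c(1,2) v] c by simp
  finally have "v \<bullet>c v = v \<bullet>c (mat_adjoint K * K *\<^sub>v v + mat_adjoint L * L *\<^sub>v v + mat_adjoint M * M *\<^sub>v v)"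
    by simp
  also have "\<dots> = v \<bullet>c (mat_adjoint K * K *\<^sub>v v) + v \<bullet>c (mat_adjoint L * L *\<^sub>v v) + v \<bullet>c (mat_adjoint M * M *\<^sub>v v)"
    unfolding cinner_add_right[OF v add_carrier_vec[OF cv(1,2)] cv(3)] cinner_add_right[OF v cv(1,2)] ..
  finally have "complex_of_real ((l2_norm_vec v)\<^sup>2) = complex_of_real ((l2_norm_vec (K *\<^sub>v v))\<^sup>2
      + (l2_norm_vec (L *\<^sub>v v))\<^sup>2 + (l2_norm_vec (M *\<^sub>v v))\<^sup>2)"
    unfolding of_real_add using assms(1-3)[THEN l2_norm_vec_mult, OF v] by (simp only: cinner_self)
  then show ?thesis by (simp only: of_real_eq_iff)
qed

text \<open>The two column identities of the isometry over the complex numbers, as norm identities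
  on vectors. In this form they are visibly unaffected by a unitary change of the virtual
  modes.\<close>

definition gaussian_channel :: "nat \<Rightarrow> nat \<Rightarrow> complex gaussian_map \<Rightarrow> bool" where
  "gaussian_channel p m g \<longleftrightarrow>
     blk_AP g \<in> carrier_mat p p \<and> blk_APV g \<in> carrier_mat p m \<and> blk_A g \<in> carrier_mat m m \<and>
     blk_BP g \<in> carrier_mat p m \<and> blk_B g \<in> carrier_mat m m \<and> mat_adjoint (blk_A g) = - blk_A g \<and>
     (\<forall>v\<in>carrier_vec m. (l2_norm_vec (blk_BP g *\<^sub>v v))\<^sup>2 + (l2_norm_vec (blk_B g *\<^sub>v v))\<^sup>2 = (l2_norm_vec v)\<^sup>2) \<and>
     (\<forall>v\<in>carrier_vec m. (l2_norm_vec (blk_APV g *\<^sub>v v))\<^sup>2 + (l2_norm_vec (blk_A g *\<^sub>v v))\<^sup>2 +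
        (l2_norm_vec (mat_adjoint (blk_B g) *\<^sub>v v))\<^sup>2 = (l2_norm_vec v)\<^sup>2)"

lemma gaussian_channel_odd_layer:
  assumes g: "gaussian_isometry p m g"
  shows "gaussian_channel p m (odd_layer g)"
proof -
  note c = gaussian_isometry_carrier[OF g]
  note d [simp] = c[THEN carrier_matD(1)] c[THEN carrier_matD(2)]
  let ?c = "map_mat complex_of_real"
  have adj: "mat_adjoint (?c M) = ?c (transpose_mat M)" for M
    by (rule eq_matI) auto
  have carriers: "?c (blk_APV g) \<in> carrier_mat p m" "?c (blk_A g) \<in> carrier_mat m m"
    "?c (blk_BP g) \<in> carrier_mat p m" "?c (blk_B g) \<in> carrier_mat m m"
    using c by auto
  have "mat_adjoint (?c (blk_BP g)) * ?c (blk_BP g) + mat_adjoint (?c (blk_B g)) * ?c (blk_B g)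
      + mat_adjoint (0\<^sub>m 0 m) * 0\<^sub>m 0 m = 1\<^sub>m m"
  proof (rule eq_matI)
    fix i j assume "i < dim_row (1\<^sub>m m :: complex mat)" "j < dim_col (1\<^sub>m m :: complex mat)"
    then have ij: "i < m" "j < m" by auto
    show "(mat_adjoint (?c (blk_BP g)) * ?c (blk_BP g) + mat_adjoint (?c (blk_B g)) * ?c (blk_B g)
      + mat_adjoint (0\<^sub>m 0 m) * 0\<^sub>m 0 m) $$ (i, j) = 1\<^sub>m m $$ (i, j)"
      using ij arg_cong[OF gaussian_isometry_columns(1)[OF g ij], of complex_of_real]
      by (simp add: scalar_prod_def lessThan_atLeast0)
  qed auto
  then have 1: "(l2_norm_vec (?c (blk_BP g) *\<^sub>v v))\<^sup>2 + (l2_norm_vec (?c (blk_B g) *\<^sub>v v))\<^sup>2 = (l2_norm_vec v)\<^sup>2"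
    if "v \<in> carrier_vec m" for v
    using l2_norm_vec_isometry[OF carriers(3,4) zero_carrier_mat, of 0 v] that
    by (simp add: l2_norm_vec_def)
  have "mat_adjoint (?c (blk_APV g)) * ?c (blk_APV g) + mat_adjoint (?c (blk_A g)) * ?c (blk_A g)
      + mat_adjoint (mat_adjoint (?c (blk_B g))) * mat_adjoint (?c (blk_B g)) = 1\<^sub>m m"
  proof (rule eq_matI)
    fix i j assume "i < dim_row (1\<^sub>m m :: complex mat)" "j < dim_col (1\<^sub>m m :: complex mat)"
    then have ij: "i < m" "j < m" by auto
    show "(mat_adjoint (?c (blk_APV g)) * ?c (blk_APV g) + mat_adjoint (?c (blk_A g)) * ?c (blk_A g)
      + mat_adjoint (mat_adjoint (?c (blk_B g))) * mat_adjoint (?c (blk_B g))) $$ (i, j) = 1\<^sub>m m $$ (i, j)"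
      using ij arg_cong[OF gaussian_isometry_columns(2)[OF g ij], of complex_of_real]
      by (simp add: scalar_prod_def lessThan_atLeast0)
  qed auto
  then have 2: "(l2_norm_vec (?c (blk_APV g) *\<^sub>v v))\<^sup>2 + (l2_norm_vec (?c (blk_A g) *\<^sub>v v))\<^sup>2 +
        (l2_norm_vec (mat_adjoint (?c (blk_B g)) *\<^sub>v v))\<^sup>2 = (l2_norm_vec v)\<^sup>2"
    if "v \<in> carrier_vec m" for v
    using l2_norm_vec_isometry[OF carriers(1,2) mat_adjoint_carrier[OF carriers(4)]] that by simp
  have "mat_adjoint (?c (blk_A g)) = - ?c (blk_A g)"
    using g unfolding adj gaussian_isometry_def by (auto intro!: eq_matI)
  then show ?thesis
    using 1 2 carriers c(1) by (simp add: gaussian_channel_def odd_layer_def)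
qed

lemma bond_mat_carrier: "bond_mat n k \<in> carrier_mat (2 * n) (2 * n)"
  by (rule carrier_matI) (simp_all add: bond_mat_def)

lemma bond_mat_unitary:
  "mat_adjoint (bond_mat n k) * bond_mat n k = 1\<^sub>m (2 * n)"
  "bond_mat n k * mat_adjoint (bond_mat n k) = 1\<^sub>m (2 * n)"
proof -
  have adj: "mat_adjoint (bond_mat n k) = four_block_mat (0\<^sub>m n n) (cis (- k) \<cdot>\<^sub>m 1\<^sub>m n) (1\<^sub>m n) (0\<^sub>m n n)"
    by (rule eq_matI) (auto simp: bond_mat_def cis_cnj)
  have one: "four_block_mat (1\<^sub>m n) (0\<^sub>m n n) (0\<^sub>m n n) (1\<^sub>m n) = (1\<^sub>m (2 * n) :: complex mat)"
    by (simp add: mult_2)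
  have phase: "(cis a \<cdot>\<^sub>m 1\<^sub>m n) * (cis b \<cdot>\<^sub>m 1\<^sub>m n) = cis (a + b) \<cdot>\<^sub>m (1\<^sub>m n :: complex mat)" for a b
    by (rule eq_matI) (auto simp: scalar_prod_def cis_mult if_distrib[of "\<lambda>x. x * _"] if_distrib[of "\<lambda>x. _ * x"] cong: if_cong)
  have "cis 0 \<cdot>\<^sub>m 1\<^sub>m n = (1\<^sub>m n :: complex mat)" by (rule eq_matI) auto
  note simps = phase this
  show "mat_adjoint (bond_mat n k) * bond_mat n k = 1\<^sub>m (2 * n)"
    unfolding adj unfolding bond_mat_def
    by (subst mult_four_block_mat[of _ n n _ n _ n _ _ n _ n]) (simp_all add: simps one mult_2 flip: cis_zero)
  show "bond_mat n k * mat_adjoint (bond_mat n k) = 1\<^sub>m (2 * n)"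
    unfolding adj unfolding bond_mat_def
    by (subst mult_four_block_mat[of _ n n _ n _ n _ _ n _ n]) (simp_all add: simps one mult_2 flip: cis_zero)
qed

lemma l2_norm_vec_unitary:
  assumes S: "S \<in> carrier_mat m m" and "mat_adjoint S * S = 1\<^sub>m m" and v: "v \<in> carrier_vec m"
  shows "l2_norm_vec (S *\<^sub>v v) = l2_norm_vec v"
proof -
  have "complex_of_real ((l2_norm_vec (S *\<^sub>v v))\<^sup>2) = complex_of_real ((l2_norm_vec v)\<^sup>2)"
    unfolding l2_norm_vec_mult[OF S v] assms(2) using v by (simp only: one_mult_mat_vec cinner_self)
  then have "(l2_norm_vec (S *\<^sub>v v))\<^sup>2 = (l2_norm_vec v)\<^sup>2" by (simp only: of_real_eq_iff)
  then show ?thesis by (rule power2_eq_imp_eq) (auto simp: l2_norm_vec_def sum_nonneg)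
qed

text \<open>The even layer is the complexified gate seen through the unitary \<open>S\<close>.
  Unitaries preserve norms, so both identities at \<open>v\<close> are those of the gate at
  \<open>S v\<close>.\<close>

lemma gaussian_channel_even_layer:
  assumes g: "gaussian_isometry p (2 * n) g"
  shows "gaussian_channel p (2 * n) (even_layer n g k)"
proof -
  define m where "m = 2 * n"
  define S where "S = bond_mat n k"
  \<comment> \<open>\<open>odd_layer g\<close> serves here merely as the complexification of the
    gate \<open>g\<close>.\<close>
  define AV A BP B where "AV = blk_APV (odd_layer g)" and "A = blk_A (odd_layer g)"
    and "BP = blk_BP (odd_layer g)" and "B = blk_B (odd_layer g)"
  have ch: "gaussian_channel p m (odd_layer g)"
    using gaussian_channel_odd_layer[OF g] by (simp add: m_def)
  have c: "AV \<in> carrier_mat p m" "A \<in> carrier_mat m m" "BP \<in> carrier_mat p m" "B \<in> carrier_mat m m"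
    and skew: "mat_adjoint A = - A"
    and iso: "\<And>v. v \<in> carrier_vec m \<Longrightarrow> (l2_norm_vec (BP *\<^sub>v v))\<^sup>2 + (l2_norm_vec (B *\<^sub>v v))\<^sup>2 = (l2_norm_vec v)\<^sup>2"
    and iso': "\<And>v. v \<in> carrier_vec m \<Longrightarrow> (l2_norm_vec (AV *\<^sub>v v))\<^sup>2 + (l2_norm_vec (A *\<^sub>v v))\<^sup>2 +
        (l2_norm_vec (mat_adjoint B *\<^sub>v v))\<^sup>2 = (l2_norm_vec v)\<^sup>2"
    using ch unfolding gaussian_channel_def AV_def A_def BP_def B_def by auto
  have S: "S \<in> carrier_mat m m" "mat_adjoint S * S = 1\<^sub>m m" "S * mat_adjoint S = 1\<^sub>m m"
    using bond_mat_carrier bond_mat_unitary by (simp_all add: S_def m_def)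
  note Sa = mat_adjoint_carrier[OF S(1)]
  have blocks: "blk_AP (even_layer n g k) = blk_AP (odd_layer g)" "blk_APV (even_layer n g k) = AV * S"
    "blk_A (even_layer n g k) = mat_adjoint S * A * S" "blk_BP (even_layer n g k) = BP * S"
    "blk_B (even_layer n g k) = mat_adjoint S * B * S"
    by (simp_all add: even_layer_def Let_def odd_layer_def AV_def A_def BP_def B_def S_def)
  have conj_carrier: "mat_adjoint S * M * S \<in> carrier_mat m m" if "M \<in> carrier_mat m m" for M
    by (rule mult_carrier_mat[OF mult_carrier_mat[OF Sa that] S(1)])
  have conj_adjoint: "mat_adjoint (mat_adjoint S * M * S) = mat_adjoint S * mat_adjoint M * S"
    if M: "M \<in> carrier_mat m m" for M
    unfolding mat_adjoint_mult[OF mult_carrier_mat[OF Sa M] S(1)] mat_adjoint_mult[OF Sa M] mat_adjoint_adjoint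
    by (rule assoc_mult_mat[OF Sa mat_adjoint_carrier[OF M] S(1), symmetric])
  have Sv: "S *\<^sub>v v \<in> carrier_vec m" if "v \<in> carrier_vec m" for v
    using S(1) that by (rule mult_mat_vec_carrier)
  have right: "M * S *\<^sub>v v = M *\<^sub>v (S *\<^sub>v v)" if "M \<in> carrier_mat r m" "v \<in> carrier_vec m" for M v r
    using that(1) S(1) that(2) by (rule assoc_mult_mat_vec)
  have conj_norm: "l2_norm_vec (mat_adjoint S * M * S *\<^sub>v v) = l2_norm_vec (M *\<^sub>v (S *\<^sub>v v))"
    if M: "M \<in> carrier_mat m m" and v: "v \<in> carrier_vec m" for M v
  proof -
    have "mat_adjoint S * M * S *\<^sub>v v = mat_adjoint S *\<^sub>v (M *\<^sub>v (S *\<^sub>v v))"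
      unfolding right[OF mult_carrier_mat[OF Sa M] v] by (rule assoc_mult_mat_vec[OF Sa M Sv[OF v]])
    then show ?thesis
      using l2_norm_vec_unitary[OF Sa _ mult_mat_vec_carrier[OF M Sv[OF v]]] S(3) by simp
  qed
  have norm_S: "l2_norm_vec (S *\<^sub>v v) = l2_norm_vec v" if "v \<in> carrier_vec m" for v
    using S(1,2) that by (rule l2_norm_vec_unitary)
  have "gaussian_channel p m (even_layer n g k)"
    unfolding gaussian_channel_def blocks
  proof (intro conjI ballI)
    show "blk_AP (odd_layer g) \<in> carrier_mat p p" using ch by (simp add: gaussian_channel_def)
    show "AV * S \<in> carrier_mat p m" "BP * S \<in> carrier_mat p m"
      by (rule mult_carrier_mat[OF c(1) S(1)], rule mult_carrier_mat[OF c(3) S(1)])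
    show "mat_adjoint S * A * S \<in> carrier_mat m m" "mat_adjoint S * B * S \<in> carrier_mat m m"
      using c by (auto intro: conj_carrier)
    show "mat_adjoint (mat_adjoint S * A * S) = - (mat_adjoint S * A * S)"
      unfolding conj_adjoint[OF c(2)] skew
      using uminus_mult_right_mat[of "mat_adjoint S" A] uminus_mult_left_mat[of "mat_adjoint S * A" S] c(2) S(1)
      by simp
    fix v :: "complex Matrix.vec" assume v: "v \<in> carrier_vec m"
    show "(l2_norm_vec (BP * S *\<^sub>v v))\<^sup>2 + (l2_norm_vec (mat_adjoint S * B * S *\<^sub>v v))\<^sup>2 = (l2_norm_vec v)\<^sup>2"
      unfolding right[OF c(3) v] conj_norm[OF c(4) v] iso[OF Sv[OF v]] norm_S[OF v] ..
    show "(l2_norm_vec (AV * S *\<^sub>v v))\<^sup>2 + (l2_norm_vec (mat_adjoint S * A * S *\<^sub>v v))\<^sup>2 +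
        (l2_norm_vec (mat_adjoint (mat_adjoint S * B * S) *\<^sub>v v))\<^sup>2 = (l2_norm_vec v)\<^sup>2"
      unfolding right[OF c(1) v] conj_adjoint[OF c(4)] conj_norm[OF c(2) v]
        conj_norm[OF mat_adjoint_carrier[OF c(4)] v] iso'[OF Sv[OF v]] norm_S[OF v] ..
  qed
  then show ?thesis by (simp add: m_def)
qed

lemma l2_norm_vec_append:
  "(l2_norm_vec (v @\<^sub>v w))\<^sup>2 = (l2_norm_vec v)\<^sup>2 + (l2_norm_vec w)\<^sup>2"
  by (simp add: l2_norm_vec_def sum_nonneg sum_lessThan_add)

text \<open>The adjoint of \<open>blk_B f\<close> applies the adjoint of \<open>blk_B h\<close> and
  then that of \<open>blk_B g\<close>. Both are contractions, so if the norm is preserved overall,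
  it is preserved in each step. Each layer's \<open>A\<close> block then annihilates the vector it
  meets, and both summands of \<open>blk_A f\<close> vanish on \<open>v\<close>.\<close>

lemma damped_gaussian_map_comp:
  assumes g: "gaussian_channel p m g" and h: "gaussian_channel q m h"
  defines "f \<equiv> gaussian_comp h g"
  shows "damped_gaussian_map m (p + q) (blk_A f) (blk_B f) (blk_BP f)"
proof -
  have c: "blk_A g \<in> carrier_mat m m" "blk_BP g \<in> carrier_mat p m" "blk_B g \<in> carrier_mat m m"
    "blk_A h \<in> carrier_mat m m" "blk_BP h \<in> carrier_mat q m" "blk_B h \<in> carrier_mat m m"
    and skew: "mat_adjoint (blk_A g) = - blk_A g" "mat_adjoint (blk_A h) = - blk_A h"
    using g h by (auto simp: gaussian_channel_def)
  note Ba = mat_adjoint_carrier[OF c(3)] mat_adjoint_carrier[OF c(6)]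
  have blocks: "blk_A f = blk_A h + blk_B h * blk_A g * mat_adjoint (blk_B h)"
    "blk_BP f = blk_BP g @\<^sub>r (blk_BP h * blk_B g)" "blk_B f = blk_B h * blk_B g"
    by (simp_all add: f_def gaussian_comp_def)
  have BA: "blk_B h * blk_A g * mat_adjoint (blk_B h) \<in> carrier_mat m m"
    by (rule mult_sandwich_carrier[OF c(6,1)])
  have adj: "mat_adjoint (blk_B f) *\<^sub>v v = mat_adjoint (blk_B g) *\<^sub>v (mat_adjoint (blk_B h) *\<^sub>v v)"
    if v: "v \<in> carrier_vec m" for v
    unfolding blocks mat_adjoint_mult[OF c(6,3)] by (rule assoc_mult_mat_vec[OF Ba(1,2) v])
  have contr: "l2_norm_vec (mat_adjoint (blk_B x) *\<^sub>v v) \<le> l2_norm_vec v"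
    "l2_norm_vec (mat_adjoint (blk_B x) *\<^sub>v v) = l2_norm_vec v \<Longrightarrow> blk_A x *\<^sub>v v = 0\<^sub>v m"
    if x: "gaussian_channel r m x" and v: "v \<in> carrier_vec m" for r x v
  proof -
    have eq: "(l2_norm_vec (blk_APV x *\<^sub>v v))\<^sup>2 + (l2_norm_vec (blk_A x *\<^sub>v v))\<^sup>2 +
        (l2_norm_vec (mat_adjoint (blk_B x) *\<^sub>v v))\<^sup>2 = (l2_norm_vec v)\<^sup>2"
      and A: "blk_A x \<in> carrier_mat m m"
      using x v by (auto simp: gaussian_channel_def)
    have "(l2_norm_vec (mat_adjoint (blk_B x) *\<^sub>v v))\<^sup>2 \<le> (l2_norm_vec v)\<^sup>2"
      using eq zero_le_power2[of "l2_norm_vec (blk_APV x *\<^sub>v v)"] zero_le_power2[of "l2_norm_vec (blk_A x *\<^sub>v v)"]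
      by linarith
    then show "l2_norm_vec (mat_adjoint (blk_B x) *\<^sub>v v) \<le> l2_norm_vec v"
      by (rule power2_le_imp_le) (simp add: l2_norm_vec_def sum_nonneg)
    assume "l2_norm_vec (mat_adjoint (blk_B x) *\<^sub>v v) = l2_norm_vec v"
    then have "(l2_norm_vec (blk_A x *\<^sub>v v))\<^sup>2 = 0"
      using eq zero_le_power2[of "l2_norm_vec (blk_APV x *\<^sub>v v)"] zero_le_power2[of "l2_norm_vec (blk_A x *\<^sub>v v)"]
      by simp
    then show "blk_A x *\<^sub>v v = 0\<^sub>v m"
      using A l2_norm_vec_eq_0_iff[of "blk_A x *\<^sub>v v"] by simp
  qed
  show ?thesis
  proof
    show "blk_A f \<in> carrier_mat m m" unfolding blocks using BA by (rule add_carrier_mat)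
    show "blk_B f \<in> carrier_mat m m" unfolding blocks by (rule mult_carrier_mat[OF c(6,3)])
    show "blk_BP f \<in> carrier_mat (p + q) m"
      unfolding blocks by (rule carrier_append_rows[OF c(2) mult_carrier_mat[OF c(5,3)]])
    show "mat_adjoint (blk_A f) = - blk_A f"
    proof -
      have "mat_adjoint (blk_B h * blk_A g * mat_adjoint (blk_B h)) = blk_B h * (mat_adjoint (blk_A g) * mat_adjoint (blk_B h))"
        unfolding mat_adjoint_mult[OF mult_carrier_mat[OF c(6,1)] Ba(2)] mat_adjoint_mult[OF c(6,1)] by simp
      also have "\<dots> = - (blk_B h * blk_A g * mat_adjoint (blk_B h))"
        unfolding skew using c Ba assoc_mult_mat[OF c(6,1) Ba(2)] by simp
      finally show ?thesis
        unfolding blocks mat_adjoint_add[OF c(4) BA] skew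
        using c(4) BA by (intro eq_matI) auto
    qed
    fix v :: "complex Matrix.vec" assume v: "v \<in> carrier_vec m"
    have w: "mat_adjoint (blk_B h) *\<^sub>v v \<in> carrier_vec m" by (rule mult_mat_vec_carrier[OF Ba(2) v])
    have Bv: "blk_B g *\<^sub>v v \<in> carrier_vec m" by (rule mult_mat_vec_carrier[OF c(3) v])
    have 1: "(l2_norm_vec (blk_BP g *\<^sub>v v))\<^sup>2 + (l2_norm_vec (blk_B g *\<^sub>v v))\<^sup>2 = (l2_norm_vec v)\<^sup>2"
      using g v by (simp add: gaussian_channel_def)
    have 2: "(l2_norm_vec (blk_BP h *\<^sub>v (blk_B g *\<^sub>v v)))\<^sup>2 + (l2_norm_vec (blk_B h *\<^sub>v (blk_B g *\<^sub>v v)))\<^sup>2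
        = (l2_norm_vec (blk_B g *\<^sub>v v))\<^sup>2"
      using h Bv by (simp add: gaussian_channel_def)
    show "(l2_norm_vec (blk_BP f *\<^sub>v v))\<^sup>2 + (l2_norm_vec (blk_B f *\<^sub>v v))\<^sup>2 = (l2_norm_vec v)\<^sup>2"
      unfolding blocks mat_mult_append[OF c(2) mult_carrier_mat[OF c(5,3)] v] l2_norm_vec_append
        assoc_mult_mat_vec[OF c(5,3) v] assoc_mult_mat_vec[OF c(6,3) v]
      using 1 2 by simp
    have le: "l2_norm_vec (mat_adjoint (blk_B f) *\<^sub>v v) \<le> l2_norm_vec (mat_adjoint (blk_B h) *\<^sub>v v)"
      unfolding adj[OF v] by (rule contr(1)[OF g w])
    have le': "l2_norm_vec (mat_adjoint (blk_B h) *\<^sub>v v) \<le> l2_norm_vec v"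
      by (rule contr(1)[OF h v])
    show "l2_norm_vec (mat_adjoint (blk_B f) *\<^sub>v v) \<le> l2_norm_vec v" using le le' by simp
    assume eq: "l2_norm_vec (mat_adjoint (blk_B f) *\<^sub>v v) = l2_norm_vec v"
    have Ah: "blk_A h *\<^sub>v v = 0\<^sub>v m" using le le' eq by (intro contr(2)[OF h v]) simp
    have Ag: "blk_A g *\<^sub>v (mat_adjoint (blk_B h) *\<^sub>v v) = 0\<^sub>v m"
      using le le' eq by (intro contr(2)[OF g w]) (simp add: adj[OF v])
    have "blk_B h * blk_A g * mat_adjoint (blk_B h) *\<^sub>v v
        = blk_B h *\<^sub>v (blk_A g *\<^sub>v (mat_adjoint (blk_B h) *\<^sub>v v))"
      unfolding assoc_mult_mat_vec[OF mult_carrier_mat[OF c(6,1)] Ba(2) v] by (rule assoc_mult_mat_vec[OF c(6,1) w])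
    also have "\<dots> = 0\<^sub>v m" unfolding Ag using c(6) by (intro eq_vecI) auto
    finally show "blk_A f *\<^sub>v v = 0\<^sub>v m"
      unfolding blocks add_mult_distrib_mat_vec[OF c(4) BA v] Ah by simp
  qed
qed

section \<open>Dependence on the momentum\<close>

definition mat_circle_holomorphic :: "nat \<Rightarrow> nat \<Rightarrow> (real \<Rightarrow> complex mat) \<Rightarrow> bool" where
  "mat_circle_holomorphic r c M \<longleftrightarrow> (\<forall>k. M k \<in> carrier_mat r c) \<and>
     (\<forall>i<r. \<forall>j<c. circle_holomorphic (\<lambda>k. M k $$ (i, j)))"

lemma mat_circle_holomorphicI:
  assumes "\<And>k. M k \<in> carrier_mat r c"
    and "\<And>i j. i < r \<Longrightarrow> j < c \<Longrightarrow> circle_holomorphic (\<lambda>k. M k $$ (i, j))"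
  shows "mat_circle_holomorphic r c M"
  using assms by (simp add: mat_circle_holomorphic_def)

lemma mat_circle_holomorphicD:
  assumes "mat_circle_holomorphic r c M"
  shows "M k \<in> carrier_mat r c" "i < r \<Longrightarrow> j < c \<Longrightarrow> circle_holomorphic (\<lambda>k. M k $$ (i, j))"
  using assms by (simp_all add: mat_circle_holomorphic_def)

lemma mat_circle_holomorphic_const: "M \<in> carrier_mat r c \<Longrightarrow> mat_circle_holomorphic r c (\<lambda>_. M)"
  by (rule mat_circle_holomorphicI) auto

lemma mat_circle_holomorphic_mult:
  assumes "mat_circle_holomorphic a b M" "mat_circle_holomorphic b c N"
  shows "mat_circle_holomorphic a c (\<lambda>k. M k * N k)"
proof (rule mat_circle_holomorphicI)
  show "M k * N k \<in> carrier_mat a c" for k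
    by (rule mult_carrier_mat[OF assms[THEN mat_circle_holomorphicD(1)]])
  fix i j assume ij: "i < a" "j < c"
  have "circle_holomorphic (\<lambda>k. \<Sum>l<b. M k $$ (i, l) * N k $$ (l, j))"
    using ij assms[THEN mat_circle_holomorphicD(2)]
    by (intro circle_holomorphic_sum circle_holomorphic_mult) auto
  then show "circle_holomorphic (\<lambda>k. (M k * N k) $$ (i, j))"
    by (simp only: index_mult_mat_sum[OF assms[THEN mat_circle_holomorphicD(1)] ij])
qed

lemma mat_circle_holomorphic_add:
  assumes M: "mat_circle_holomorphic a b M" and N: "mat_circle_holomorphic a b N"
  shows "mat_circle_holomorphic a b (\<lambda>k. M k + N k)"
proof (rule mat_circle_holomorphicI)
  note d = mat_circle_holomorphicD(1)[OF M] mat_circle_holomorphicD(1)[OF N]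
  show "M k + N k \<in> carrier_mat a b" for k using d by simp
  fix i j assume ij: "i < a" "j < b"
  have "circle_holomorphic (\<lambda>k. M k $$ (i, j) + N k $$ (i, j))"
    by (intro circle_holomorphic_add mat_circle_holomorphicD(2)[OF M ij] mat_circle_holomorphicD(2)[OF N ij])
  then show "circle_holomorphic (\<lambda>k. (M k + N k) $$ (i, j))"
    using ij carrier_matD[OF d(2)] by simp
qed

lemma mat_circle_holomorphic_uminus:
  assumes M: "mat_circle_holomorphic a b M"
  shows "mat_circle_holomorphic a b (\<lambda>k. - M k)"
proof (rule mat_circle_holomorphicI)
  note d = mat_circle_holomorphicD(1)[OF M]
  show "- M k \<in> carrier_mat a b" for k using d by simp
  fix i j assume ij: "i < a" "j < b"
  show "circle_holomorphic (\<lambda>k. (- M k) $$ (i, j))"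
    using circle_holomorphic_uminus[OF mat_circle_holomorphicD(2)[OF M ij]] ij carrier_matD[OF d] by simp
qed

lemma mat_circle_holomorphic_adjoint:
  assumes M: "mat_circle_holomorphic a b M"
  shows "mat_circle_holomorphic b a (\<lambda>k. mat_adjoint (M k))"
proof (rule mat_circle_holomorphicI)
  note d = mat_circle_holomorphicD(1)[OF M]
  show "mat_adjoint (M k) \<in> carrier_mat b a" for k using d by simp
  fix i j assume ij: "i < b" "j < a"
  show "circle_holomorphic (\<lambda>k. mat_adjoint (M k) $$ (i, j))"
    using circle_holomorphic_cnj[OF mat_circle_holomorphicD(2)[OF M ij(2,1)]] ij carrier_matD[OF d] by simp
qed

lemma mat_circle_holomorphic_pow:
  assumes M: "mat_circle_holomorphic a a M"
  shows "mat_circle_holomorphic a a (\<lambda>k. M k ^\<^sub>m j)"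
proof (induction j)
  case 0
  have "(\<lambda>k. M k ^\<^sub>m 0) = (\<lambda>_. 1\<^sub>m a)" using carrier_matD[OF mat_circle_holomorphicD(1)[OF M]] by simp
  then show ?case using mat_circle_holomorphic_const[of "1\<^sub>m a" a a] by (simp only: one_carrier_mat)
next
  case (Suc j)
  then show ?case using mat_circle_holomorphic_mult[OF Suc M] by simp
qed

lemma mat_circle_holomorphic_four_block:
  assumes "mat_circle_holomorphic a b M" "mat_circle_holomorphic a d N"
    "mat_circle_holomorphic c b K" "mat_circle_holomorphic c d L"
  shows "mat_circle_holomorphic (a + c) (b + d) (\<lambda>k. four_block_mat (M k) (N k) (K k) (L k))"
proof (rule mat_circle_holomorphicI)
  note D = assms[THEN mat_circle_holomorphicD(1)]
  note [simp] = D[THEN carrier_matD(1)] D[THEN carrier_matD(2)]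
  show "four_block_mat (M k) (N k) (K k) (L k) \<in> carrier_mat (a + c) (b + d)" for k
    by (rule four_block_carrier_mat[OF D(1,4)])
  fix i j assume "i < a + c" "j < b + d"
  then show "circle_holomorphic (\<lambda>k. four_block_mat (M k) (N k) (K k) (L k) $$ (i, j))"
    using assms[THEN mat_circle_holomorphicD(2)]
    by (cases "i < a"; cases "j < b") auto
qed

lemma mat_circle_holomorphic_append_rows:
  assumes M: "mat_circle_holomorphic a b M" and N: "mat_circle_holomorphic c b N"
  shows "mat_circle_holomorphic (a + c) b (\<lambda>k. M k @\<^sub>r N k)"
proof -
  note d = mat_circle_holomorphicD(1)[OF M] mat_circle_holomorphicD(1)[OF N]
  have "mat_circle_holomorphic (a + c) (b + 0) (\<lambda>k. four_block_mat (M k) (0\<^sub>m a 0) (N k) (0\<^sub>m c 0))"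
    by (intro mat_circle_holomorphic_four_block M N mat_circle_holomorphic_const zero_carrier_mat)
  then show ?thesis
    using carrier_matD(1)[OF d(1)] carrier_matD(1)[OF d(2)] by (simp add: append_rows_def)
qed

lemma mat_circle_holomorphic_bond_mat: "mat_circle_holomorphic (2 * n) (2 * n) (bond_mat n)"
proof (rule mat_circle_holomorphicI)
  fix i j assume "i < 2 * n" "j < 2 * n"
  then show "circle_holomorphic (\<lambda>k. bond_mat n k $$ (i, j))"
    by (cases "i < n"; cases "j < n"; cases "i - n = j") (auto simp: bond_mat_def mult_2)
qed (rule bond_mat_carrier)

lemma mat_circle_holomorphic_period:
  assumes go: "gaussian_isometry p (2 * n) g_odd" and ge: "gaussian_isometry q (2 * n) g_even"
  shows "mat_circle_holomorphic (p + q) (p + q) (\<lambda>k. blk_AP (period n g_odd g_even k))"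
    and "mat_circle_holomorphic (2 * n) (2 * n) (\<lambda>k. blk_A (period n g_odd g_even k))"
    and "mat_circle_holomorphic (p + q) (2 * n) (\<lambda>k. blk_BP (period n g_odd g_even k))"
    and "mat_circle_holomorphic (2 * n) (2 * n) (\<lambda>k. blk_B (period n g_odd g_even k))"
proof -
  have const: "mat_circle_holomorphic r c (\<lambda>_. map_mat complex_of_real M)" if "M \<in> carrier_mat r c" for M r c
    using that by (intro mat_circle_holomorphic_const) auto
  note o = gaussian_isometry_carrier[OF go, THEN const] and e = gaussian_isometry_carrier[OF ge, THEN const]
  note intros = mat_circle_holomorphic_mult mat_circle_holomorphic_add mat_circle_holomorphic_adjoint
    mat_circle_holomorphic_uminus mat_circle_holomorphic_four_block mat_circle_holomorphic_append_rows
    mat_circle_holomorphic_bond_mat o e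
  show "mat_circle_holomorphic (p + q) (p + q) (\<lambda>k. blk_AP (period n g_odd g_even k))"
    "mat_circle_holomorphic (2 * n) (2 * n) (\<lambda>k. blk_A (period n g_odd g_even k))"
    "mat_circle_holomorphic (p + q) (2 * n) (\<lambda>k. blk_BP (period n g_odd g_even k))"
    "mat_circle_holomorphic (2 * n) (2 * n) (\<lambda>k. blk_B (period n g_odd g_even k))"
    unfolding period_def gaussian_comp_def even_layer_def odd_layer_def Let_def gaussian_map.simps
    by (rule intros)+
qed

text \<open>Joins the two descriptions of the series: the recurrence, valid uniformly in form,
  yields the quotient, and the isometry condition yields the bound.\<close>

lemma physical_correlation_quotient:
  assumes go: "gaussian_isometry p (2 * n) g_odd" and ge: "gaussian_isometry q (2 * n) g_even"
    and ab: "a < p + q" "b < p + q"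
  defines "T \<equiv> \<lambda>k. (blk_BP (period n g_odd g_even k) *
      steady_state (2 * n) (blk_A (period n g_odd g_even k)) (blk_B (period n g_odd g_even k)) *
      mat_adjoint (blk_BP (period n g_odd g_even k))) $$ (a, b)"
  obtains \<gamma> \<eta> k\<^sub>0 M where "circle_holomorphic \<gamma>" "circle_holomorphic \<eta>" "\<eta> k\<^sub>0 \<noteq> 0"
    "\<And>k. T k * \<eta> k = \<gamma> k" "\<And>k. cmod (T k) \<le> M"
proof -
  define m where "m = 2 * n"
  define A where "A k = blk_A (period n g_odd g_even k)" for k
  define B where "B k = blk_B (period n g_odd g_even k)" for k
  define BP where "BP k = blk_BP (period n g_odd g_even k)" for k
  have hol: "mat_circle_holomorphic m m A" "mat_circle_holomorphic (p + q) m BP" "mat_circle_holomorphic m m B"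
    using mat_circle_holomorphic_period[OF go ge] unfolding A_def B_def BP_def m_def by auto
  note A = mat_circle_holomorphicD(1)[OF hol(1)] and BP = mat_circle_holomorphicD(1)[OF hol(2)]
    and B = mat_circle_holomorphicD(1)[OF hol(3)]
  have damped: "damped_gaussian_map m (p + q) (A k) (B k) (BP k)" for k
    unfolding A_def B_def BP_def m_def period_def
    by (rule damped_gaussian_map_comp[OF gaussian_channel_odd_layer[OF go] gaussian_channel_even_layer[OF ge]])
  have T: "T k = (BP k * steady_state m (A k) (B k) * mat_adjoint (BP k)) $$ (a, b)" for k
    by (simp only: T_def A_def B_def BP_def m_def)
  define E where "E j k = B k ^\<^sub>m j * A k * mat_adjoint (B k ^\<^sub>m j)" for j k
  have Bj: "mat_circle_holomorphic m m (\<lambda>k. B k ^\<^sub>m j)" for j by (rule mat_circle_holomorphic_pow[OF hol(3)])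
  have E_hol: "mat_circle_holomorphic m m (E j)" for j
    unfolding E_def
    by (rule mat_circle_holomorphic_mult[OF mat_circle_holomorphic_mult[OF Bj hol(1)]
        mat_circle_holomorphic_adjoint[OF Bj]])
  note E = mat_circle_holomorphicD(1)[OF E_hol]
  define c where "c j k = (BP k * E j k * mat_adjoint (BP k)) $$ (a, b)" for j k
  have c_hol: "circle_holomorphic (c j)" for j
  proof -
    have "mat_circle_holomorphic (p + q) (p + q) (\<lambda>k. BP k * E j k * mat_adjoint (BP k))"
      by (rule mat_circle_holomorphic_mult[OF mat_circle_holomorphic_mult[OF hol(2) E_hol]
          mat_circle_holomorphic_adjoint[OF hol(2)]])
    from mat_circle_holomorphicD(2)[OF this ab] show ?thesis unfolding c_def[abs_def] .
  qed
  have c_sums: "(\<lambda>j. c j k) sums T k" for k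
    using damped_gaussian_map.steady_state_physical_sums[OF damped ab, of k]
    unfolding T c_def E_def mult_sandwich[OF BP pow_carrier_mat[OF B] A] .
  obtain d where d: "\<And>i. circle_holomorphic (d i)" "\<And>k. d (m * m) k = 1"
    "\<And>j k s t. s < m \<Longrightarrow> t < m \<Longrightarrow> (\<Sum>i\<le>m * m. d i k * E (j + i) k $$ (s, t)) = 0"
  proof (rule sandwich_recurrence[of m "\<lambda>s t k. B k $$ (s, t)" "\<lambda>j k s t. E j k $$ (s, t)"])
    show "circle_holomorphic (\<lambda>k. B k $$ (s, t))" if "s < m" "t < m" for s t
      by (rule mat_circle_holomorphicD(2)[OF hol(3) that])
    show "E (Suc j) k $$ (s, t) = (\<Sum>s'<m. \<Sum>t'<m. B k $$ (s, s') * E j k $$ (s', t') * cnj (B k $$ (t, t')))"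
      if st: "s < m" "t < m" for j k s t
    proof -
      have "E (Suc j) k = B k * E j k * mat_adjoint (B k)"
        unfolding E_def by (rule power_sandwich_Suc(1)[OF B A])
      then show ?thesis
        unfolding index_mult3_mat_sum[OF B E mat_adjoint_carrier[OF B] st]
        using index_mult3_mat_sum[OF B E mat_adjoint_carrier[OF B] st] st carrier_matD[OF B] by simp
    qed
  qed (rule that; assumption)
  \<comment> \<open>At fixed \<open>k\<close>, \<open>c j k\<close> is a linear combination of the
    entries of \<open>E j k\<close> with coefficients independent of \<open>j\<close>, so it
    inherits their recurrence.\<close>
  have rec: "(\<Sum>i\<le>m * m. d i k * c (j + i) k) = 0" for j k
  proof -
    have "(\<Sum>i\<le>m * m. d i k * c (j + i) k) = (\<Sum>i\<le>m * m. \<Sum>s<m. \<Sum>t<m.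
        BP k $$ (a, s) * mat_adjoint (BP k) $$ (t, b) * (d i k * E (j + i) k $$ (s, t)))"
      unfolding c_def index_mult3_mat_sum[OF BP E mat_adjoint_carrier[OF BP] ab] sum_distrib_left
      by (intro sum.cong refl) (simp add: mult_ac)
    also have "\<dots> = (\<Sum>s<m. \<Sum>t<m. BP k $$ (a, s) * mat_adjoint (BP k) $$ (t, b) *
        (\<Sum>i\<le>m * m. d i k * E (j + i) k $$ (s, t)))"
      unfolding sum_distrib_left by (subst sum.swap, rule sum.cong[OF refl], rule sum.swap)
    also have "\<dots> = 0" by (simp add: d(3))
    finally show ?thesis .
  qed
  obtain \<gamma> \<eta> k\<^sub>0 where q: "circle_holomorphic \<gamma>" "circle_holomorphic \<eta>" "\<eta> k\<^sub>0 \<noteq> 0"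
    "\<And>k. (\<Sum>j. c j k) * \<eta> k = \<gamma> k"
    using summable_recurrence_quotient[OF c_hol sums_summable[OF c_sums] d(1,2) rec] by blast
  have "\<exists>M. \<forall>k. cmod (A k $$ (s, t)) \<le> M" if "s < m" "t < m" for s t
    using bounded_on_circle[OF mat_circle_holomorphicD(2)[OF hol(1) that]] by blast
  then obtain M where M: "\<And>s t k. s < m \<Longrightarrow> t < m \<Longrightarrow> cmod (A k $$ (s, t)) \<le> M s t" by metis
  have bound: "cmod (T k) \<le> (\<Sum>s<m. \<Sum>t<m. M s t)" for k
    unfolding T
    by (rule order_trans[OF damped_gaussian_map.steady_state_physical_bound[OF damped ab]])
      (intro sum_mono M, auto)
  have "T k * \<eta> k = \<gamma> k" for k
    using q(4)[of k] sums_unique[OF c_sums, of k] by simp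
  then show ?thesis using q(1-3) bound by (intro that)
qed

text \<open>A crude bound is enough for a finite matrix: coordinates of a vector in the unit ball
  have modulus at most 1, and the Euclidean norm is at most the sum of the moduli.\<close>

lemma operator_norm_le_sum:
  assumes M: "M \<in> carrier_mat r c"
  shows "operator_norm M \<le> (\<Sum>i<r. \<Sum>j<c. cmod (M $$ (i, j)))"
  unfolding operator_norm_def
proof (rule cSUP_least)
  have "0\<^sub>v c \<in> {v \<in> carrier_vec (dim_col M). l2_norm_vec v \<le> 1}"
    using M by (simp add: l2_norm_vec_def)
  then show "{v \<in> carrier_vec (dim_col M). l2_norm_vec v \<le> 1} \<noteq> {}" by blast
  fix v assume "v \<in> {v \<in> carrier_vec (dim_col M). l2_norm_vec v \<le> 1}"
  then have v: "v \<in> carrier_vec c" "l2_norm_vec v \<le> 1" using M by auto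
  have v_le: "cmod (v $ j) \<le> 1" if "j < c" for j
  proof -
    have "cmod (v $ j) \<le> L2_set (\<lambda>j. cmod (v $ j)) {..<c}"
      using that by (intro member_le_L2_set) auto
    also have "\<dots> = l2_norm_vec v" using v(1) by (simp add: l2_norm_vec_def L2_set_def)
    finally show ?thesis using v(2) by simp
  qed
  have "l2_norm_vec (M *\<^sub>v v) = L2_set (\<lambda>i. cmod ((M *\<^sub>v v) $ i)) {..<r}"
    using M by (simp add: l2_norm_vec_def L2_set_def)
  also have "\<dots> \<le> (\<Sum>i<r. cmod ((M *\<^sub>v v) $ i))"
    by (rule L2_set_le_sum) simp
  also have "\<dots> \<le> (\<Sum>i<r. \<Sum>j<c. cmod (M $$ (i, j)))"
  proof (rule sum_mono)
    fix i assume "i \<in> {..<r}"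
    then have "(M *\<^sub>v v) $ i = (\<Sum>j<c. M $$ (i, j) * v $ j)"
      using M v(1) by (simp add: scalar_prod_def lessThan_atLeast0)
    also have "cmod \<dots> \<le> (\<Sum>j<c. cmod (M $$ (i, j)) * cmod (v $ j))"
      by (rule order_trans[OF norm_sum]) (simp add: norm_mult)
    also have "\<dots> \<le> (\<Sum>j<c. cmod (M $$ (i, j)) * 1)"
      by (intro sum_mono mult_left_mono v_le) auto
    finally show "cmod ((M *\<^sub>v v) $ i) \<le> (\<Sum>j<c. cmod (M $$ (i, j)))" by simp
  qed
  finally show "l2_norm_vec (M *\<^sub>v v) \<le> (\<Sum>i<r. \<Sum>j<c. cmod (M $$ (i, j)))" .
qed

theorem corollary3p4:
  fixes n p q :: nat and g_odd g_even :: "real gaussian_map"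
  assumes "gaussian_isometry p (2 * n) g_odd"
    and "gaussian_isometry q (2 * n) g_even"
  shows "\<exists>C>0. \<exists>\<xi>>0. \<forall>x::int.
    operator_norm (bulk_correlation n p q g_odd g_even x) \<le> C * exp (- real_of_int \<bar>x\<bar> / \<xi>)"
proof -
  define N where "N = p + q"
  let ?G = "bulk_correlation n p q g_odd g_even"
  have "\<exists>C>0. \<exists>\<delta>>0. \<forall>x::int. cmod (?G x $$ (a, b)) \<le> C * exp (- \<delta> * real_of_int \<bar>x\<bar>)"
    if "a < N" "b < N" for a b
  proof -
    have ab: "a < p + q" "b < p + q" using that by (auto simp: N_def)
    note hol = mat_circle_holomorphic_period[OF assms]
    define T where "T k = (blk_BP (period n g_odd g_even k) *
      steady_state (2 * n) (blk_A (period n g_odd g_even k)) (blk_B (period n g_odd g_even k)) *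
      mat_adjoint (blk_BP (period n g_odd g_even k))) $$ (a, b)" for k
    obtain \<gamma> \<eta> k\<^sub>0 M where quotient: "circle_holomorphic \<gamma>" "circle_holomorphic \<eta>" "\<eta> k\<^sub>0 \<noteq> 0"
      "\<And>k. T k * \<eta> k = \<gamma> k" "\<And>k. cmod (T k) \<le> M"
      using physical_correlation_quotient[OF assms ab] unfolding T_def by metis
    have "bulk_correlation_momentum n g_odd g_even k $$ (a, b) = blk_AP (period n g_odd g_even k) $$ (a, b) + T k" for k
      using ab carrier_matD[OF mat_circle_holomorphicD(1)[OF hol(3)], of k]
      by (simp add: bulk_correlation_momentum_def Let_def T_def del: index_mult_mat(1))
    then have "?G x $$ (a, b) = integral {-pi..pi} (\<lambda>k. 1 / (2 * complex_of_real pi) *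
        cis (k * real_of_int x) * (blk_AP (period n g_odd g_even k) $$ (a, b) + T k))" for x
      using ab by (simp add: bulk_correlation_def)
    then show ?thesis
      using fourier_decay_of_bounded_quotient[OF mat_circle_holomorphicD(2)[OF hol(1) ab] quotient(1,2,4,5,3)]
      by simp
  qed
  then obtain C \<delta> where C: "\<And>a b. a < N \<Longrightarrow> b < N \<Longrightarrow> C a b > 0" "\<And>a b. a < N \<Longrightarrow> b < N \<Longrightarrow> \<delta> a b > 0"
    "\<And>a b x. a < N \<Longrightarrow> b < N \<Longrightarrow> cmod (?G x $$ (a, b)) \<le> C a b * exp (- \<delta> a b * real_of_int \<bar>x\<bar>)"
    by metis
  \<comment> \<open>The slowest of the finitely many entrywise rates. Inserting 1 covers the case
    without physical modes, where there are no entries.\<close>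
  define D where "D = Min (insert 1 ((\<lambda>(a, b). \<delta> a b) ` ({..<N} \<times> {..<N})))"
  have "D > 0" unfolding D_def using C(2) by (subst Min_gr_iff) auto
  have D: "D \<le> \<delta> a b" if "a < N" "b < N" for a b
    unfolding D_def using that by (intro Min_le) auto
  \<comment> \<open>The summand 1 keeps the constant positive in that case too.\<close>
  define K where "K = 1 + (\<Sum>a<N. \<Sum>b<N. C a b)"
  have "K > 0" unfolding K_def using C(1) by (intro add_pos_nonneg sum_nonneg) (auto intro: less_imp_le)
  have "operator_norm (?G x) \<le> K * exp (- real_of_int \<bar>x\<bar> / (1 / D))" for x
  proof -
    have "?G x \<in> carrier_mat N N" by (simp add: bulk_correlation_def N_def)
    then have "operator_norm (?G x) \<le> (\<Sum>a<N. \<Sum>b<N. cmod (?G x $$ (a, b)))"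
      by (rule operator_norm_le_sum)
    also have "\<dots> \<le> (\<Sum>a<N. \<Sum>b<N. C a b * exp (- D * real_of_int \<bar>x\<bar>))"
    proof (intro sum_mono)
      fix a b assume "a \<in> {..<N}" "b \<in> {..<N}"
      then have ab: "a < N" "b < N" by auto
      have "exp (- \<delta> a b * real_of_int \<bar>x\<bar>) \<le> exp (- D * real_of_int \<bar>x\<bar>)"
        using D[OF ab] by (simp add: mult_right_mono)
      then have "C a b * exp (- \<delta> a b * real_of_int \<bar>x\<bar>) \<le> C a b * exp (- D * real_of_int \<bar>x\<bar>)"
        using C(1)[OF ab] by (intro mult_left_mono) auto
      then show "cmod (?G x $$ (a, b)) \<le> C a b * exp (- D * real_of_int \<bar>x\<bar>)"
        using C(3)[OF ab, of x] by linarith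
    qed
    also have "\<dots> = (\<Sum>a<N. \<Sum>b<N. C a b) * exp (- D * real_of_int \<bar>x\<bar>)"
      by (simp add: sum_distrib_right)
    also have "\<dots> \<le> K * exp (- D * real_of_int \<bar>x\<bar>)"
      by (intro mult_right_mono) (auto simp: K_def)
    finally show ?thesis by (simp add: mult.commute)
  qed
  moreover have "1 / D > 0" using \<open>D > 0\<close> by simp
  ultimately show ?thesis using \<open>K > 0\<close> by blast
qed

end
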